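(* Let $r,d\geqslant 1$ and let $\xi_k,\gamma_{jk},\beta_j\in\mathbb{C}$ ($1\leqslant j\leqslant d$, $1\leqslant k\leqslant r$) with $|\xi_k|\leqslant 1$, $\Re\gamma_{jk}\geqslant0$, $\Re\beta_j>0$, and such that for each $j$ at least one $\Re\gamma_{jk}>0$. Let $\delta(k)=1$ if $\xi_k=1$ and $\delta(k)=0$ otherwise, and define the desingularized multiple zeta-function $$\zeta_r^{\rm des}((s_j);(\xi_k);(\gamma_{jk});(\beta_j)):=\lim_{c\to1}\frac{1}{\prod_{k=1}^r(1-\delta(k)c)}\cdot\frac{1}{\prod_{j=1}^d(e^{2\pi i s_j}-1)\Gamma(s_j)}\int_{\mathcal{C}^d}\prod_{j=1}^d x_j^{s_j-1}e^{(\sum_{k=1}^r\gamma_{jk}-\beta_j)x_j}dx_j\prod_{k=1}^r\Biggl(\frac{1}{e^{\sum_{j=1}^d\gamma_{jk}x_j}-\xi_k}-\delta(k)\frac{c}{e^{c\sum_{j=1}^d\gamma_{jk}x_j}-1}\Biggr),$$ the limit being over real $c$. Then $$\zeta_r^{\rm des}((s_j);(\xi_k);(\gamma_{jk});(\beta_j))=\frac{1}{\prod_{j=1}^d(e^{2\pi i s_j}-1)\Gamma(s_j)}\int_{\mathcal{C}^d}\prod_{j=1}^d x_j^{s_j-1}e^{(\sum_{k=1}^r\gamma_{jk}-\beta_j)x_j}dx_j\prod_{k=1}^r F_{\delta(k)}\Bigl(\sum_{j=1}^d\gamma_{jk}x_j,\xi_k\Bigr),$$ where $F_{\delta}(y,\xi)=\frac{1}{e^y-\xi}-\delta\frac{ye^y}{(e^y-1)^2}$,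 and this function of $(s_1,\dots,s_d)$ is analytically continued to $\mathbb{C}^d$ as an entire function.
   Context: $\mathcal{C}$ is the Hankel contour: it comes from $+\infty$ along the upper side of the positive real axis, goes counterclockwise around the origin on a circle of sufficiently small radius $\varepsilon$, and returns to $+\infty$ along the lower side; $x^{s-1}$ is defined with $\arg x=0$ on the upper side and $\arg x=2\pi$ on the lower side. For $s_j$ outside the poles, the factor $1/((e^{2\pi is_j}-1)\Gamma(s_j))$ is understood by analytic continuation. When all $\xi_k\neq1$, this is the standard integral representation of $\zeta_r((s_j);(\xi_k);(\gamma_{jk});(\beta_j))=\sum_{m_1,\dots,m_r\geqslant0}\prod_k\xi_k^{m_k}/\prod_j(\beta_j+\sum_k\gamma_{jk}m_k)^{s_j}$.
   Formalization: Added: for small ε no denominator e^{y_k}−ξ_k vanishes on the contour except at y_k=0, i.e. if |ξ_k|=1 each γ_jk is 0 or has positive real part; else (γ=(1,i), ξ=(1/2,1)) poles lie on the contour. Factors at the removable point y_k=0 take their limit value. *)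

theory Defs
  imports "HOL-Complex_Analysis.Complex_Analysis"
begin

no_notation fps_nth (infixl \<open>$\<close> 75)

text \<open>
  The Hankel contour with radius \<open>\<epsilon>\<close>, parametrised by the whole real line: the incoming upper side
  for \<open>t < 0\<close>, the circle for \<open>0 \<le> t \<le> 2\<pi>\<close>, the outgoing lower side for \<open>t > 2\<pi>\<close>.  The two sides are
  the same set of complex numbers, so the branch of \<open>x\<^sup>s\<close> depends on the parameter \<open>t\<close> and not just
  on the point \<open>x = hankel \<epsilon> t\<close>.
\<close>

definition hankel_abs :: "real \<Rightarrow> real \<Rightarrow> real" where
  "hankel_abs \<epsilon> t = (if t < 0 then \<epsilon> - t else if t \<le> 2 * pi then \<epsilon> else \<epsilon> + (t - 2 * pi))"

definition hankel_arg :: "real \<Rightarrow> real" where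
  "hankel_arg t = (if t < 0 then 0 else if t \<le> 2 * pi then t else 2 * pi)"

definition hankel :: "real \<Rightarrow> real \<Rightarrow> complex" where
  "hankel \<epsilon> t = rcis (hankel_abs \<epsilon> t) (hankel_arg t)"

definition hankel_powr :: "real \<Rightarrow> real \<Rightarrow> complex \<Rightarrow> complex" where
  "hankel_powr \<epsilon> t s = exp (s * Complex (ln (hankel_abs \<epsilon> t)) (hankel_arg t))"

definition hankel_form :: "real \<Rightarrow> complex^'r^'d \<Rightarrow> real^'d \<Rightarrow> 'r \<Rightarrow> complex" where
  "hankel_form \<epsilon> \<gamma> t k = (\<Sum>j\<in>UNIV. \<gamma> $ j $ k * hankel \<epsilon> (t $ j))"

text \<open>
  For all sufficiently small radii, no denominator \<open>e\<^sup>y - \<xi>\<^sub>k\<close> vanishes on the product contour, except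
  possibly at \<open>y = 0\<close> (so \<open>\<xi>\<^sub>k = 1\<close>), where the singularity of the integrands below is removable.
\<close>

definition hankel_regular :: "complex^'r \<Rightarrow> complex^'r^'d \<Rightarrow> bool" where
  "hankel_regular \<xi> \<gamma> \<longleftrightarrow>
     (\<forall>\<^sub>F \<epsilon> in at_right 0. \<forall>t k. exp (hankel_form \<epsilon> \<gamma> t k) = \<xi> $ k \<longrightarrow> hankel_form \<epsilon> \<gamma> t k = 0)"

definition delta_one :: "complex \<Rightarrow> complex" where
  "delta_one \<xi> = (if \<xi> = 1 then 1 else 0)"

definition des_F :: "complex \<Rightarrow> complex \<Rightarrow> complex \<Rightarrow> complex" where
  "des_F \<delta> y \<xi> = 1 / (exp y - \<xi>) - \<delta> * (y * exp y / (exp y - 1)\<^sup>2)"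

definition des_F_approx :: "real \<Rightarrow> complex \<Rightarrow> complex \<Rightarrow> complex \<Rightarrow> complex" where
  "des_F_approx c \<delta> y \<xi> =
     1 / (exp y - \<xi>) - \<delta> * (complex_of_real c / (exp (complex_of_real c * y) - 1))"

text \<open>
  The pullback to the parameter space of the differential form
  \<open>\<Prod>j. x\<^sub>j\<^bsup>s\<^sub>j - 1\<^esup> e\<^bsup>(\<Sum>k. \<gamma>\<^sub>j\<^sub>k - \<beta>\<^sub>j) x\<^sub>j\<^esup> dx\<^sub>j \<cdot> \<Prod>k. G\<^sub>k(\<Sum>j. \<gamma>\<^sub>j\<^sub>k x\<^sub>j)\<close>.  The factors \<open>G\<^sub>k\<close> are
  extended over their removable singularities, because division by zero would otherwise give them
  a spurious value at \<open>0\<close>.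
\<close>

definition hankel_integrand ::
  "real \<Rightarrow> complex^'r^'d \<Rightarrow> complex^'d \<Rightarrow> complex^'d \<Rightarrow> ('r \<Rightarrow> complex \<Rightarrow> complex) \<Rightarrow> real^'d \<Rightarrow> complex"
where
  "hankel_integrand \<epsilon> \<gamma> \<beta> s G t =
     (\<Prod>j\<in>UNIV. hankel_powr \<epsilon> (t $ j) (s $ j - 1)
               * exp (((\<Sum>k\<in>UNIV. \<gamma> $ j $ k) - \<beta> $ j) * hankel \<epsilon> (t $ j))
               * vector_derivative (hankel \<epsilon>) (at (t $ j)))
     * (\<Prod>k\<in>UNIV. remove_sings (G k) (hankel_form \<epsilon> \<gamma> t k))"

text \<open>
  Removing singularities supplies the analytic continuation of the factor to \<open>s = 0, -1, -2, \<dots>\<close>.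
  The points \<open>s = 1, 2, 3, \<dots>\<close> are genuine poles.
\<close>

definition hankel_factor :: "complex \<Rightarrow> complex" where
  "hankel_factor = remove_sings (\<lambda>s. 1 / ((exp (2 * of_real pi * \<i> * s) - 1) * Gamma s))"

definition hankel_value ::
  "real \<Rightarrow> complex^'r^'d \<Rightarrow> complex^'d \<Rightarrow> complex^'d \<Rightarrow> ('r \<Rightarrow> complex \<Rightarrow> complex) \<Rightarrow> complex"
where
  "hankel_value \<epsilon> \<gamma> \<beta> s G =
     (\<Prod>j\<in>UNIV. hankel_factor (s $ j)) * (\<integral>t. hankel_integrand \<epsilon> \<gamma> \<beta> s G t \<partial>lborel)"

definition zeta_des_approx ::
  "real \<Rightarrow> complex^'r \<Rightarrow> complex^'r^'d \<Rightarrow> complex^'d \<Rightarrow> complex^'d \<Rightarrow> real \<Rightarrow> complex"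
where
  "zeta_des_approx \<epsilon> \<xi> \<gamma> \<beta> s c =
     1 / (\<Prod>k\<in>UNIV. 1 - delta_one (\<xi> $ k) * complex_of_real c)
     * hankel_value \<epsilon> \<gamma> \<beta> s (\<lambda>k y. des_F_approx c (delta_one (\<xi> $ k)) y (\<xi> $ k))"

definition zeta_des ::
  "real \<Rightarrow> complex^'r \<Rightarrow> complex^'r^'d \<Rightarrow> complex^'d \<Rightarrow> complex^'d \<Rightarrow> complex"
where
  "zeta_des \<epsilon> \<xi> \<gamma> \<beta> s = Lim (at 1) (zeta_des_approx \<epsilon> \<xi> \<gamma> \<beta> s)"

definition entire_fun :: "(complex^'d \<Rightarrow> complex) \<Rightarrow> bool" where
  "entire_fun f \<longleftrightarrow> (\<forall>s. \<exists>L. (f has_derivative L) (at s) \<and> (\<forall>a v. L (a *s v) = a * L v))"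

text \<open>
  Under the bounds on \<open>\<xi>\<close> and \<open>\<gamma>\<close>, regularity excludes exactly the nonzero purely imaginary \<open>\<gamma>\<^sub>j\<^sub>k\<close> with
  \<open>|\<xi>\<^sub>k| = 1\<close>: there the integrand has poles on the contour for every radius, so that the contour
  integral is not defined.
\<close>

lemma hankel_cases:
  assumes "\<epsilon> > 0"
  shows "norm (hankel \<epsilon> t) = \<epsilon> \<or> (\<exists>u\<ge>\<epsilon>. hankel \<epsilon> t = complex_of_real u)"
proof -
  have "\<exists>u\<ge>\<epsilon>. hankel \<epsilon> t = complex_of_real u" if "t < 0"
    using that by (intro exI[of _ "\<epsilon> - t"]) (auto simp: hankel_def hankel_abs_def hankel_arg_def rcis_def)
  moreover have "\<exists>u\<ge>\<epsilon>. hankel \<epsilon> t = complex_of_real u" if "t > 2 * pi"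
    using that pi_gt_zero
    by (intro exI[of _ "\<epsilon> + (t - 2 * pi)"]) (auto simp: hankel_def hankel_abs_def hankel_arg_def rcis_def simp del: pi_gt_zero)
  moreover have "norm (hankel \<epsilon> t) = \<epsilon>" if "0 \<le> t" "t \<le> 2 * pi"
    using that assms by (auto simp: hankel_def hankel_abs_def)
  ultimately show ?thesis by (meson not_less)
qed

lemma hankel_circle:
  assumes "\<epsilon> > 0" "norm x = \<epsilon>"
  shows "\<exists>t. hankel \<epsilon> t = x"
proof -
  have "x = rcis \<epsilon> (Arg2pi x)"
    using assms Arg2pi_eq[of x] by (simp add: rcis_def cis_conv_exp)
  thus ?thesis using Arg2pi_ge_0[of x] Arg2pi_lt_2pi[of x]
    by (intro exI[of _ "Arg2pi x"]) (auto simp: hankel_def hankel_abs_def hankel_arg_def)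
qed

lemma hankel_ray:
  assumes "u > \<epsilon>"
  shows "hankel \<epsilon> (\<epsilon> - u) = complex_of_real u"
  using assms by (auto simp: hankel_def hankel_abs_def hankel_arg_def rcis_def)

lemma hankel_regular_iff:
  fixes \<xi> :: "complex^'r" and \<gamma> :: "complex^'r^'d"
  assumes xi: "\<And>k. norm (\<xi> $ k) \<le> 1" and re: "\<And>j k. Re (\<gamma> $ j $ k) \<ge> 0"
  shows "hankel_regular \<xi> \<gamma> \<longleftrightarrow>
    (\<forall>k. norm (\<xi> $ k) = 1 \<longrightarrow> (\<forall>j. \<gamma> $ j $ k = 0 \<or> Re (\<gamma> $ j $ k) > 0))"
proof (intro iffI allI impI)
  fix k j
  assume reg: "hankel_regular \<xi> \<gamma>" and k: "norm (\<xi> $ k) = 1"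
  show "\<gamma> $ j $ k = 0 \<or> Re (\<gamma> $ j $ k) > 0"
  proof (rule ccontr)
    assume "\<not> ?thesis"
    hence nz: "\<gamma> $ j $ k \<noteq> 0" and re0: "Re (\<gamma> $ j $ k) = 0" using re[of j k] by auto
    define b where "b = Im (\<gamma> $ j $ k)"
    have b: "\<gamma> $ j $ k = \<i> * b" "b \<noteq> 0"
      using nz re0 by (auto simp: b_def complex_eq_iff)
    obtain \<epsilon> :: real where e: "\<epsilon> > 0"
      "\<And>t. exp (hankel_form \<epsilon> \<gamma> t k) = \<xi> $ k \<Longrightarrow> hankel_form \<epsilon> \<gamma> t k = 0"
    proof -
      have "\<forall>\<^sub>F \<epsilon> in at_right 0. (\<forall>t k. exp (hankel_form \<epsilon> \<gamma> t k) = \<xi> $ k \<longrightarrow> hankel_form \<epsilon> \<gamma> t k = 0) \<and> \<epsilon> > 0"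
        using reg eventually_at_right_less[of "0::real"] unfolding hankel_regular_def
        by (rule eventually_conj)
      then obtain \<epsilon> :: real where "(\<forall>t k. exp (hankel_form \<epsilon> \<gamma> t k) = \<xi> $ k \<longrightarrow> hankel_form \<epsilon> \<gamma> t k = 0) \<and> \<epsilon> > 0"
        using eventually_happens trivial_limit_at_right_real by blast
      thus ?thesis using that by blast
    qed
    have "\<exists>t. Re (\<gamma> $ l $ k * hankel \<epsilon> t) = 0" for l
    proof (cases "\<gamma> $ l $ k = 0")
      case False
      define x where "x = \<epsilon> * \<i> * cnj (\<gamma> $ l $ k) / norm (\<gamma> $ l $ k)"
      have "norm x = \<epsilon>" using e(1) False by (simp add: x_def norm_mult norm_divide)
      then obtain t where t: "hankel \<epsilon> t = x" using hankel_circle e(1) by blast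
      have "\<gamma> $ l $ k * x = \<epsilon> * \<i> * (\<gamma> $ l $ k * cnj (\<gamma> $ l $ k)) / norm (\<gamma> $ l $ k)"
        by (simp add: x_def)
      also have "\<dots> = \<i> * of_real (\<epsilon> * norm (\<gamma> $ l $ k))"
        using False by (simp add: complex_norm_square[symmetric] power2_eq_square)
      finally have "Re (\<gamma> $ l $ k * hankel \<epsilon> t) = 0" unfolding t by simp
      thus ?thesis ..
    qed auto
    then obtain T where T: "\<And>l. Re (\<gamma> $ l $ k * hankel \<epsilon> (T l)) = 0" by metis
    define A where "A = (\<Sum>l\<in>UNIV-{j}. Im (\<gamma> $ l $ k * hankel \<epsilon> (T l)))"
    have A: "(\<Sum>l\<in>UNIV-{j}. \<gamma> $ l $ k * hankel \<epsilon> (T l)) = \<i> * A"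
      unfolding A_def of_real_sum sum_distrib_left
      by (rule sum.cong) (use T in \<open>auto simp: complex_eq_iff\<close>)
    define \<phi> where "\<phi> = Arg (\<xi> $ k)"
    have phi: "\<xi> $ k = exp (\<i> * \<phi>)"
      using k Arg_eq[of "\<xi> $ k"] by (cases "\<xi> $ k = 0") (auto simp: \<phi>_def)
    obtain N :: nat where N: "2 * pi * N > \<bar>A\<bar> + \<bar>\<phi>\<bar> + \<bar>b\<bar> * \<epsilon>"
      using reals_Archimedean2[of "(\<bar>A\<bar> + \<bar>\<phi>\<bar> + \<bar>b\<bar> * \<epsilon>) / (2 * pi)"]
      by (auto simp: field_simps)
    define n :: int where "n = (if b > 0 then int N else - int N)"
    define u where "u = (\<phi> + 2 * pi * n - A) / b"
    have bu: "b * u = \<phi> + 2 * pi * n - A" using b by (simp add: u_def)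
    have u: "u > \<epsilon>"
    proof (cases "b > 0")
      case True
      thus ?thesis using N by (simp add: u_def n_def field_simps)
    next
      case False
      hence "b < 0" using b by auto
      thus ?thesis using N by (simp add: u_def n_def field_simps)
    qed
    define t :: "real^'d" where "t = (\<chi> l. if l = j then \<epsilon> - u else T l)"
    have "hankel_form \<epsilon> \<gamma> t k = \<gamma> $ j $ k * hankel \<epsilon> (t $ j) + (\<Sum>l\<in>UNIV-{j}. \<gamma> $ l $ k * hankel \<epsilon> (t $ l))"
      unfolding hankel_form_def by (rule sum.remove) auto
    also have "(\<Sum>l\<in>UNIV-{j}. \<gamma> $ l $ k * hankel \<epsilon> (t $ l)) = \<i> * A"
      unfolding A[symmetric] by (rule sum.cong) (auto simp: t_def)
    also have "\<gamma> $ j $ k * hankel \<epsilon> (t $ j) = \<i> * of_real (b * u)"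
      using hankel_ray[OF u] by (simp add: t_def b)
    also have "\<i> * of_real (b * u) + \<i> * A = \<i> * of_real (\<phi> + 2 * pi * n)"
      unfolding bu by (simp add: algebra_simps)
    finally have y: "hankel_form \<epsilon> \<gamma> t k = \<i> * of_real (\<phi> + 2 * pi * n)" .
    have "exp (hankel_form \<epsilon> \<gamma> t k) = exp (\<i> * \<phi>)"
      unfolding y exp_eq by (intro exI[of _ n]) (simp add: algebra_simps)
    hence "hankel_form \<epsilon> \<gamma> t k = 0" using e(2) phi by simp
    hence "\<phi> + 2 * pi * n = 0" unfolding y by (simp del: of_real_add of_real_mult)
    moreover have "\<bar>b\<bar> * \<epsilon> \<ge> 0" using e by simp
    ultimately show False using N by (auto simp: n_def split: if_splits)
  qed
next
  assume R: "\<forall>k. norm (\<xi> $ k) = 1 \<longrightarrow> (\<forall>j. \<gamma> $ j $ k = 0 \<or> Re (\<gamma> $ j $ k) > 0)"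
  have "\<forall>\<^sub>F \<epsilon> in at_right 0. \<forall>t. exp (hankel_form \<epsilon> \<gamma> t k) = \<xi> $ k \<longrightarrow> hankel_form \<epsilon> \<gamma> t k = 0" for k
  proof -
    define C where "C = (\<Sum>j\<in>UNIV. norm (\<gamma> $ j $ k))"
    have C0: "C \<ge> 0" by (simp add: C_def sum_nonneg)
    have low: "Re (\<gamma> $ j $ k * hankel \<epsilon> s) \<ge> - (norm (\<gamma> $ j $ k) * \<epsilon>)" if "\<epsilon> > 0" for j \<epsilon> s
    proof -
      have "\<bar>Re (\<gamma> $ j $ k * hankel \<epsilon> s)\<bar> \<le> norm (\<gamma> $ j $ k) * norm (hankel \<epsilon> s)"
        using abs_Re_le_cmod[of "\<gamma> $ j $ k * hankel \<epsilon> s"] by (simp add: norm_mult)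
      moreover have "0 \<le> norm (\<gamma> $ j $ k) * \<epsilon>" using that by simp
      moreover have "Re (\<gamma> $ j $ k * of_real u) \<ge> 0" if "u \<ge> \<epsilon>" for u :: real
        using re[of j k] that \<open>\<epsilon> > 0\<close> by simp
      ultimately show ?thesis using hankel_cases[OF that, of s] by fastforce
    qed
    show ?thesis
    proof (cases "norm (\<xi> $ k) = 1")
      case False
      hence lt: "norm (\<xi> $ k) < 1" using xi[of k] by simp
      have "((\<lambda>\<epsilon>. exp (- (C * \<epsilon>))) \<longlongrightarrow> exp (- (C * 0))) (at_right (0::real))"
        by (intro tendsto_intros)
      hence "\<forall>\<^sub>F \<epsilon> in at_right 0. exp (- (C * \<epsilon>)) > norm (\<xi> $ k)"
        using lt by (intro order_tendstoD(1)) auto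
      thus ?thesis using eventually_at_right_less[of "0::real"]
      proof eventually_elim
        case (elim \<epsilon>)
        have "Re (hankel_form \<epsilon> \<gamma> t k) \<ge> - (C * \<epsilon>)" for t
          unfolding hankel_form_def C_def Re_sum sum_distrib_right sum_negf[symmetric]
          by (rule sum_mono) (use low elim in auto)
        hence "norm (exp (hankel_form \<epsilon> \<gamma> t k)) > norm (\<xi> $ k)" for t
          using elim(1) by (smt (verit) exp_le_cancel_iff norm_exp_eq_Re)
        thus ?case by (metis less_irrefl)
      qed
    next
      case True
      define M where "M = Min (insert 1 ((\<lambda>j. Re (\<gamma> $ j $ k)) ` {j. \<gamma> $ j $ k \<noteq> 0}))"
      have M0: "M > 0" using R True by (auto simp: M_def)
      have M: "M \<le> Re (\<gamma> $ j $ k)" if "\<gamma> $ j $ k \<noteq> 0" for j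
        using that by (auto simp: M_def)
      define D where "D = C * (1 + C / M)"
      have D: "norm (hankel_form \<epsilon> \<gamma> t k) \<le> D * \<epsilon>"
        if e: "\<epsilon> > 0" and eq: "exp (hankel_form \<epsilon> \<gamma> t k) = \<xi> $ k" for \<epsilon> t
      proof -
        have Re0: "Re (hankel_form \<epsilon> \<gamma> t k) = 0"
          using True eq norm_exp_eq_Re[of "hankel_form \<epsilon> \<gamma> t k"] by simp
        have "norm (\<gamma> $ j $ k * hankel \<epsilon> (t $ j)) \<le> norm (\<gamma> $ j $ k) * ((1 + C / M) * \<epsilon>)" for j
        proof (cases "\<gamma> $ j $ k = 0")
          case False
          have "Re (\<gamma> $ j $ k * hankel \<epsilon> (t $ j)) = - (\<Sum>l\<in>UNIV-{j}. Re (\<gamma> $ l $ k * hankel \<epsilon> (t $ l)))"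
            using Re0 unfolding hankel_form_def Re_sum by (subst (asm) sum.remove[of _ j]) auto
          also have "\<dots> \<le> (\<Sum>l\<in>UNIV-{j}. norm (\<gamma> $ l $ k) * \<epsilon>)"
            unfolding sum_negf[symmetric] by (rule sum_mono) (metis low[OF e] minus_le_iff)
          also have "\<dots> \<le> C * \<epsilon>"
            unfolding C_def sum_distrib_right by (rule sum_mono2) (use e in auto)
          finally have up: "Re (\<gamma> $ j $ k * hankel \<epsilon> (t $ j)) \<le> C * \<epsilon>" .
          have "norm (hankel \<epsilon> (t $ j)) \<le> (1 + C / M) * \<epsilon>"
            using hankel_cases[OF e, of "t $ j"]
          proof
            assume "norm (hankel \<epsilon> (t $ j)) = \<epsilon>"
            moreover have "C / M * \<epsilon> \<ge> 0" using C0 M0 e by simp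
            ultimately show ?thesis by (simp add: algebra_simps)
          next
            assume "\<exists>u\<ge>\<epsilon>. hankel \<epsilon> (t $ j) = complex_of_real u"
            then obtain u where u: "u \<ge> \<epsilon>" "hankel \<epsilon> (t $ j) = complex_of_real u" by blast
            have "M * u \<le> Re (\<gamma> $ j $ k) * u" using M[OF False] u e by (intro mult_right_mono) auto
            also have "\<dots> \<le> C * \<epsilon>" using up u by simp
            finally have "u \<le> C / M * \<epsilon>" using M0 by (simp add: field_simps)
            thus ?thesis using u e by (simp add: algebra_simps)
          qed
          thus ?thesis unfolding norm_mult by (intro mult_left_mono) auto
        qed auto
        hence "norm (hankel_form \<epsilon> \<gamma> t k) \<le> (\<Sum>j\<in>UNIV. norm (\<gamma> $ j $ k) * ((1 + C / M) * \<epsilon>))"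
          unfolding hankel_form_def by (intro sum_norm_le) auto
        thus ?thesis unfolding sum_distrib_right[symmetric] C_def[symmetric] by (simp add: D_def mult_ac)
      qed
      have lim: "((\<lambda>\<epsilon>. D * \<epsilon>) \<longlongrightarrow> D * 0) (at_right (0::real))" by (intro tendsto_intros)
      have "isCont (exp :: complex \<Rightarrow> complex) 0" by simp
      then obtain r where r: "r > 0"
        "\<And>y::complex. norm y < r \<Longrightarrow> \<xi> $ k \<noteq> 1 \<Longrightarrow> norm (exp y - 1) < norm (\<xi> $ k - 1)"
      proof (cases "\<xi> $ k = 1")
        case False
        assume "isCont (exp :: complex \<Rightarrow> complex) 0"
        with False have "\<exists>d>0. \<forall>y::complex. dist y 0 < d \<longrightarrow> dist (exp y) (exp 0) < norm (\<xi> $ k - 1)"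
          unfolding continuous_at_eps_delta by auto
        thus ?thesis using that by (auto simp: dist_norm)
      qed (use zero_less_one in blast)
      have "\<forall>\<^sub>F \<epsilon> in at_right 0. D * \<epsilon> < min r (2 * pi)"
        using lim r(1) by (intro order_tendstoD(2)) auto
      thus ?thesis using eventually_at_right_less[of "0::real"]
      proof eventually_elim
        case (elim \<epsilon>)
        show ?case
        proof (intro allI impI)
          fix t assume eq: "exp (hankel_form \<epsilon> \<gamma> t k) = \<xi> $ k"
          let ?y = "hankel_form \<epsilon> \<gamma> t k"
          have sm: "norm ?y < r" "norm ?y < 2 * pi" using D[OF elim(2) eq] elim(1) by auto
          have "\<xi> $ k = 1" using r(2)[OF sm(1)] eq by auto
          hence "exp ?y = 1" using eq by simp
          then obtain n :: int where n: "Re ?y = 0" "Im ?y = of_int (2 * n) * pi"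
            unfolding exp_eq_1 by auto
          have "2 * \<bar>real_of_int n\<bar> * pi \<le> norm ?y"
            using abs_Im_le_cmod[of ?y] n by (simp add: abs_mult)
          hence "\<bar>real_of_int n\<bar> * (2 * pi) < 1 * (2 * pi)" using sm(2) by linarith
          hence "\<bar>real_of_int n\<bar> < 1" by (rule mult_right_less_imp_less) simp
          hence "n = 0" by linarith
          thus "?y = 0" using n by (simp add: complex_eq_iff)
        qed
      qed
    qed
  qed
  hence "\<forall>\<^sub>F \<epsilon> in at_right 0. \<forall>k. \<forall>t. exp (hankel_form \<epsilon> \<gamma> t k) = \<xi> $ k \<longrightarrow> hankel_form \<epsilon> \<gamma> t k = 0"
    by (subst eventually_all_finite) auto
  thus "hankel_regular \<xi> \<gamma>" unfolding hankel_regular_def by (rule eventually_mono) blast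
qed

end

theory Submission
  imports Defs
begin

text \<open>
  With \<open>\<phi>(y) = y / (e\<^sup>y - 1)\<close> the two factors belonging to \<open>\<xi>\<^sub>k = 1\<close> are \<open>F\<^sub>1(y, 1) = \<phi>'(y)\<close> and
  \<open>1 / (e\<^sup>y - 1) - c / (e\<^bsup>cy\<^esup> - 1) = (\<phi>(y) - \<phi>(cy)) / y\<close>, so that division by \<open>1 - c\<close> gives a difference
  quotient of \<open>\<phi>\<close>.  The values of the linear forms lie in a sector \<open>|y| \<le> A Re y + \<eta>\<close> with small \<open>\<eta>\<close>,
  on which \<open>\<phi>'\<close> is holomorphic and \<open>O(e\<^bsup>-(1-\<kappa>) Re y\<^esup>)\<close>; for small \<open>\<kappa>\<close> the decay of \<open>e\<^bsup>-\<beta>x\<^esup>\<close> absorbs the loss,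
  and the limit \<open>c \<rightarrow> 1\<close> is dominated convergence.

  For the analytic continuation, one variable at a time: in the coordinate \<open>z = log x\<close> the integrand
  \<open>x\<^bsup>s-1\<^esup> g(x) dx\<close> becomes \<open>e\<^bsup>sz\<^esup> g(e\<^sup>z) dz\<close>, which has a primitive on a left half-plane.  Hence the Hankel
  integral does not depend on the radius, and for \<open>Re s > 0\<close> it equals \<open>e\<^bsup>2\<pi>is\<^esup> - 1\<close> times the integral over
  \<open>(0, \<infinity>)\<close>.  So in each variable the Hankel representation (holomorphic for \<open>Re s < 1\<close>) can be exchanged
  for \<open>\<Gamma>(s)\<^bsup>-1\<^esup> \<integral>\<^sub>0\<^sup>\<infinity>\<close> (holomorphic for \<open>Re s > 0\<close>), and these representations glue to an entire function.
\<close>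

section \<open>Complex differentiability of integrals depending on a parameter\<close>

text \<open>The obstacle to an entire continuation is the prefactor. For \<open>Re s < 1\<close> the
  zeros of \<open>rGamma\<close> cancel those of \<open>exp (2 * pi * \<i> * s) - 1\<close>, but
  poles remain at s = 1, 2, 3, and so on. The ray representation has only the entire prefactor
  \<open>rGamma\<close>, at the price of \<open>Re s > 0\<close>. Each coordinate chooses one of the
  two, so C^d is covered by 2^d overlapping domains.

  The loss \<kappa> comes from the factor y in F_1, which decays only like
  \<open>y * exp (- y)\<close>. Trading |y| for Re y requires the sector, and here the regularity of
  the contour enters: if |\<xi>_k| = 1, each \<gamma>_jk is 0 or has positive real part. If
  |\<xi>_k| < 1, imaginary \<gamma>_jk are allowed and the values of the form only stay in a
  half-plane Re y \<ge> -\<eta>; but then the poles of \<open>1 / (exp y - \<xi>)\<close> keep a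
  distance from the imaginary axis.

  Differentiability in d variables means a total derivative that is complex linear. It is obtained
  directly, from Cauchy estimates on complex lines under an integrable majorant.\<close>

definition complex_differentiable_at :: "(complex^'d \<Rightarrow> complex) \<Rightarrow> complex^'d \<Rightarrow> bool" where
  "complex_differentiable_at f s \<longleftrightarrow>
     (\<exists>L. (f has_derivative L) (at s) \<and> (\<forall>a v. L (a *s v) = a * L v))"

lemma complex_differentiable_at_prod:
  fixes f :: "'i \<Rightarrow> complex^'d \<Rightarrow> complex"
  assumes "\<And>i. i \<in> I \<Longrightarrow> complex_differentiable_at (f i) s"
  shows "complex_differentiable_at (\<lambda>s. \<Prod>i\<in>I. f i s) s"
proof -
  obtain L where L: "\<And>i. i \<in> I \<Longrightarrow> (f i has_derivative L i) (at s)"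
      "\<And>i a v. i \<in> I \<Longrightarrow> L i (a *s v) = a * L i v"
    using assms unfolding complex_differentiable_at_def by metis
  show ?thesis unfolding complex_differentiable_at_def
    by (intro exI[of _ "\<lambda>y. \<Sum>i\<in>I. L i y * (\<Prod>j\<in>I - {i}. f j s)"] conjI has_derivative_prod L)
       (auto simp: L(2) sum_distrib_left mult.assoc intro!: sum.cong)
qed

lemma complex_differentiable_at_mult:
  assumes "complex_differentiable_at f s" "complex_differentiable_at g s"
  shows "complex_differentiable_at (\<lambda>s. f s * g s) s"
  \<comment> \<open>A product indexed by \<open>bool\<close> specialises the rule for finite
    products to two factors.\<close>
  using complex_differentiable_at_prod[of "UNIV :: bool set" "\<lambda>b. if b then f else g" s] assms
  by (simp add: UNIV_bool mult.commute)

lemma complex_differentiable_at_const: "complex_differentiable_at (\<lambda>s. c) s"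
  unfolding complex_differentiable_at_def by (intro exI[of _ "\<lambda>_. 0"]) auto

lemma complex_differentiable_at_nth:
  assumes "h field_differentiable at (s $ j)"
  shows "complex_differentiable_at (\<lambda>s. h (s $ j)) s"
proof -
  obtain h' where h': "(h has_field_derivative h') (at (s $ j))"
    using assms by (auto simp: field_differentiable_def)
  have 1: "((\<lambda>s. s $ j) has_derivative (\<lambda>v. v $ j)) (at s)"
    by (rule bounded_linear_imp_has_derivative, rule bounded_linear_vec_nth)
  have "((\<lambda>s. h (s $ j)) has_derivative (\<lambda>v. h' * v $ j)) (at s)"
    using has_derivative_compose[OF 1, of h "(*) h'"] h'
    by (simp add: has_field_derivative_def)
  thus ?thesis unfolding complex_differentiable_at_def
    by (intro exI[of _ "\<lambda>v. h' * v $ j"]) auto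
qed

lemma complex_differentiable_at_transform:
  assumes "complex_differentiable_at f s" "open S" "s \<in> S" "\<And>x. x \<in> S \<Longrightarrow> f x = g x"
  shows "complex_differentiable_at g s"
proof -
  obtain L where L: "(f has_derivative L) (at s)" "\<forall>a v. L (a *s v) = a * L v"
    using assms(1) unfolding complex_differentiable_at_def by blast
  have "(g has_derivative L) (at s)"
    using has_derivative_transform_within_open[OF L(1) assms(2,3)] assms(4) by simp
  with L(2) show ?thesis unfolding complex_differentiable_at_def by blast
qed

lemma norm_vector_scalar_mult_complex: "norm (a *s (v::complex^'d)) = norm a * norm v"
  by (simp add: norm_vec_def norm_mult L2_set_right_distrib)

text \<open>Restriction to the complex line through \<open>s0\<close> in direction \<open>v\<close>
  leaves a function of one variable, to which Cauchy's estimates apply. Complex linearity of the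
  derivative makes the restriction holomorphic and ties its derivative at 0 to the total
  derivative.\<close>

lemma holomorphic_on_line:
  fixes f :: "complex^'d \<Rightarrow> complex"
  assumes D: "\<And>s. s \<in> ball s0 R \<Longrightarrow> complex_differentiable_at f s"
  shows "(\<lambda>z. f (s0 + z *s v)) holomorphic_on {z. norm z * norm v < R}"
    and "\<lbrakk>R > 0; (f has_derivative L) (at s0); \<And>a v. L (a *s v) = a * L v\<rbrakk> \<Longrightarrow>
          ((\<lambda>z. f (s0 + z *s v)) has_field_derivative L v) (at 0)"
proof -
  have line: "((\<lambda>z. s0 + z *s v) has_derivative (\<lambda>z. z *s v)) (at z)" for z :: complex
  proof -
    have "bounded_linear (\<lambda>z. z *s v)"
      by (rule bounded_linear_intro[of _ "norm v"])
         (auto simp: vec_eq_iff algebra_simps norm_vector_scalar_mult_complex)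
    hence "((\<lambda>z. s0 + z *s v) has_derivative (\<lambda>z. 0 + z *s v)) (at z)"
      by (intro has_derivative_add has_derivative_const bounded_linear_imp_has_derivative)
    thus ?thesis by simp
  qed
  have *: "((\<lambda>z. f (s0 + z *s v)) has_field_derivative L v) (at z)"
    if L: "(f has_derivative L) (at (s0 + z *s v))" "\<And>a v. L (a *s v) = a * L v" for z L
    using has_derivative_compose[OF line L(1)] 
    by (simp add: has_field_derivative_def L(2) mult.commute[of _ "L v"])
  show "(\<lambda>z. f (s0 + z *s v)) holomorphic_on {z. norm z * norm v < R}"
    unfolding holomorphic_on_def
  proof
    fix z :: complex assume "z \<in> {z. norm z * norm v < R}"
    hence "s0 + z *s v \<in> ball s0 R" by (simp add: dist_norm norm_vector_scalar_mult_complex)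
    from D[OF this] obtain L where "(f has_derivative L) (at (s0 + z *s v))" "\<And>a v. L (a *s v) = a * L v"
      unfolding complex_differentiable_at_def by blast
    from *[OF this] show "(\<lambda>z. f (s0 + z *s v)) field_differentiable at z within {z. norm z * norm v < R}"
      using field_differentiable_at_within field_differentiable_def by blast
  qed
  show "((\<lambda>z. f (s0 + z *s v)) has_field_derivative L v) (at 0)"
    if "R > 0" "(f has_derivative L) (at s0)" "\<And>a v. L (a *s v) = a * L v"
    using *[of L 0] that by simp
qed

text \<open>Taylor's formula on the closed unit disc needs a bound for the second derivative there.
  Cauchy's inequality on circles of radius \<open>\<rho> / 4\<close> gives it: for
  \<open>\<rho> \<ge> 4\<close> these stay inside the ball, and 32 is \<open>fact 2 * 4 ^ 2\<close>.
  With \<open>\<rho> = R / norm v\<close> the bound becomes quadratic in \<open>v\<close>.\<close>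

lemma holomorphic_first_order_remainder:
  fixes h :: "complex \<Rightarrow> complex"
  assumes hol: "h holomorphic_on ball 0 \<rho>" and \<rho>: "\<rho> \<ge> 4"
    and B: "\<And>z. z \<in> ball 0 \<rho> \<Longrightarrow> norm (h z) \<le> B"
  shows "norm (h 1 - h 0 - deriv h 0) \<le> 32 * B / \<rho>\<^sup>2"
proof -
  have B2: "norm (deriv (deriv h) z) \<le> 32 * B / \<rho>\<^sup>2" if z: "z \<in> cball 0 1" for z
  proof -
    have sub: "cball z (\<rho> / 4) \<subseteq> ball 0 \<rho>"
    proof
      fix w assume "w \<in> cball z (\<rho>/4)"
      hence "norm w \<le> norm z + \<rho> / 4" using norm_triangle_ineq2[of w z] by (simp add: dist_norm norm_minus_commute)
      thus "w \<in> ball 0 \<rho>" using z \<rho> by simp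
    qed
    have "norm ((deriv ^^ 2) h z) \<le> fact 2 * B / (\<rho> / 4) ^ 2"
    proof (rule Cauchy_inequality)
      show "h holomorphic_on ball z (\<rho>/4)"
        using hol sub by (meson ball_subset_cball holomorphic_on_subset order_trans)
      show "continuous_on (cball z (\<rho>/4)) h"
        using hol sub by (meson holomorphic_on_imp_continuous_on continuous_on_subset)
      show "norm (h x) \<le> B" if "norm (z - x) = \<rho>/4" for x
        using that sub B[of x] by (auto simp: subset_iff dist_norm)
    qed (use \<rho> in auto)
    thus ?thesis by (simp add: numeral_2_eq_2 power2_eq_square)
  qed
  have sub: "cball 0 1 \<subseteq> ball (0::complex) \<rho>" using \<rho> by auto
  have "norm ((deriv ^^ 0) h 1 - (\<Sum>i\<le>1. (deriv ^^ i) h 0 * (1 - 0) ^ i / fact i))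
          \<le> 32 * B / \<rho>\<^sup>2 * norm (1 - 0 :: complex) ^ Suc 1 / fact 1"
  proof (rule complex_Taylor[of "cball 0 1"])
    show "((deriv ^^ i) h has_field_derivative (deriv ^^ Suc i) h x) (at x within cball 0 1)"
      if "x \<in> cball 0 1" for i x
    proof -
      have "(deriv ^^ i) h holomorphic_on ball 0 \<rho>" by (intro holomorphic_higher_deriv hol) auto
      hence "((deriv ^^ i) h has_field_derivative deriv ((deriv ^^ i) h) x) (at x)"
        using that sub by (intro holomorphic_derivI[of _ "ball 0 \<rho>"]) auto
      thus ?thesis by (simp add: has_field_derivative_at_within)
    qed
    show "norm ((deriv ^^ Suc 1) h x) \<le> 32 * B / \<rho>\<^sup>2" if "x \<in> cball 0 1" for x
      using B2[OF that] by simp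
  qed auto
  thus ?thesis by (simp add: algebra_simps)
qed

text \<open>Cauchy's estimate on complex lines turns the mere bound by \<open>B\<close> into a first order remainder
  that is quadratic in the increment and uniform in \<open>t\<close>.\<close>

lemma complex_differentiable_at_integral:
  fixes f :: "complex^'d \<Rightarrow> 'a \<Rightarrow> complex"
  assumes R: "R > 0"
    and meas: "\<And>s. s \<in> ball s0 R \<Longrightarrow> f s \<in> borel_measurable M"
    and D: "\<And>s t. s \<in> ball s0 R \<Longrightarrow> complex_differentiable_at (\<lambda>s. f s t) s"
    and B: "\<And>s t. s \<in> ball s0 R \<Longrightarrow> norm (f s t) \<le> B t"
    and int: "integrable M B"
  shows "complex_differentiable_at (\<lambda>s. \<integral>t. f s t \<partial>M) s0"
proof -
  have s0: "s0 \<in> ball s0 R" using R by simp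
  have "\<forall>t. \<exists>L. ((\<lambda>s. f s t) has_derivative L) (at s0) \<and> (\<forall>a v. L (a *s v) = a * L v)"
    using D[OF s0] unfolding complex_differentiable_at_def by blast
  then obtain L where L: "\<And>t. ((\<lambda>s. f s t) has_derivative L t) (at s0)"
      "\<And>t a v. L t (a *s v) = a * L t v" by metis
  have lin: "linear (L t)" for t using L(1) has_derivative_linear by blast
  have quad: "norm (f (s0 + v) t - f s0 t - L t v) \<le> 32 * B t * norm v ^ 2 / R\<^sup>2"
    if v: "norm v \<le> R / 4" for v t
  proof (cases "v = 0")
    case True thus ?thesis using linear_0[OF lin[of t]] by simp
  next
    case False
    define h where "h = (\<lambda>z. f (s0 + z *s v) t)"
    have eq: "{z. norm z * norm v < R} = ball 0 (R / norm v)"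
      using False by (auto simp: field_simps)
    have hol: "h holomorphic_on ball 0 (R / norm v)"
      using holomorphic_on_line(1)[where f = "\<lambda>s. f s t" and v = v and ?s0.0 = s0 and R = R] D unfolding eq h_def by simp
    have der: "deriv h 0 = L t v"
      using holomorphic_on_line(2)[where f = "\<lambda>s. f s t" and v = v, OF D R L(1) L(2)] unfolding h_def by (intro DERIV_imp_deriv) simp
    have "norm (h 1 - h 0 - deriv h 0) \<le> 32 * B t / (R / norm v)\<^sup>2"
    proof (rule holomorphic_first_order_remainder[OF hol])
      show "R / norm v \<ge> 4" using v False by (simp add: field_simps)
      show "norm (h z) \<le> B t" if "z \<in> ball 0 (R / norm v)" for z
        unfolding h_def using that False
        by (intro B) (simp add: dist_norm norm_vector_scalar_mult_complex field_simps)
    qed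
    thus ?thesis by (simp add: der power_divide) (simp add: h_def)
  qed
  have intf: "integrable M (f s)" if "s \<in> ball s0 R" for s
    by (rule Bochner_Integration.integrable_bound[OF int meas[OF that]])
       (use B[OF that] in \<open>auto intro!: AE_I2 order_trans[OF _ abs_ge_self]\<close>)
  \<comment> \<open>The pointwise choice of \<open>L t\<close> says nothing about measurability in
    \<open>t\<close>; it is recovered by writing \<open>L t v\<close> as a limit of difference
    quotients. The offset \<open>N\<close> keeps all points \<open>s0 + w n\<close> in the
    ball.\<close>
  have measL: "(\<lambda>t. L t v) \<in> borel_measurable M" for v
  proof -
    obtain N :: nat where N: "real N > norm v / R" using reals_Archimedean2 by blast
    define w where "w = (\<lambda>n. of_real (1 / real (n + Suc N)) *s v)"
    have w: "s0 + w n \<in> ball s0 R" for n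
    proof -
      have "norm v < R * real N" using N R by (simp add: field_simps)
      also have "\<dots> \<le> R * real (n + Suc N)" using R by (intro mult_left_mono) auto
      finally have "norm v / real (n + Suc N) < R"
        by (subst pos_divide_less_eq) auto
      moreover have "norm (w n) = norm v / real (n + Suc N)"
        unfolding w_def norm_vector_scalar_mult_complex norm_of_real by simp
      ultimately show ?thesis by (simp only: mem_ball dist_norm) simp
    qed
    show ?thesis
    proof (rule borel_measurable_LIMSEQ_metric)
      show "(\<lambda>t. (f (s0 + w n) t - f s0 t) / of_real (1 / real (n + Suc N))) \<in> borel_measurable M" for n
        by (intro borel_measurable_divide borel_measurable_diff meas w s0) auto
      fix t assume "t \<in> space M"
      have "((\<lambda>z. (f (s0 + z *s v) t - f (s0 + 0 *s v) t) / (z - 0)) \<longlongrightarrow> L t v) (at 0)"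
        using holomorphic_on_line(2)[where f = "\<lambda>s. f s t" and v = v, OF D R L(1) L(2)] unfolding has_field_derivative_iff by simp
      moreover have "filterlim (\<lambda>n. complex_of_real (1 / real (n + Suc N))) (at 0) sequentially"
      proof -
        have "(\<lambda>n. 1 / real (n + Suc N)) \<longlonglongrightarrow> 0"
          using LIMSEQ_ignore_initial_segment[OF LIMSEQ_inverse_real_of_nat, of N]
          by (simp add: inverse_eq_divide)
        hence "(\<lambda>n. complex_of_real (1 / real (n + Suc N))) \<longlonglongrightarrow> of_real 0" by (rule tendsto_of_real)
        moreover have "complex_of_real (1 / real (n + Suc N)) \<noteq> 0" for n
          unfolding of_real_eq_0_iff by simp
        ultimately show ?thesis unfolding filterlim_at of_real_0 by (intro conjI always_eventually allI) blast+
      qed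
      ultimately have "(\<lambda>n. (f (s0 + of_real (1 / real (n + Suc N)) *s v) t - f (s0 + 0 *s v) t)
          / (of_real (1 / real (n + Suc N)) - 0)) \<longlonglongrightarrow> L t v"
        by (rule filterlim_compose)
      thus "(\<lambda>n. (f (s0 + w n) t - f s0 t) / of_real (1 / real (n + Suc N))) \<longlonglongrightarrow> L t v"
        unfolding w_def vector_smult_lzero add_0_right diff_zero .
    qed
  qed
  have intL0: "integrable M (\<lambda>t. L t v)" if v: "norm v \<le> R / 4" for v
  proof (rule Bochner_Integration.integrable_bound[OF _ measL])
    show "integrable M (\<lambda>t. B t + B t + 32 * B t * norm v ^ 2 / R\<^sup>2)"
      using int by auto
    have "norm (L t v) \<le> B t + B t + 32 * B t * norm v ^ 2 / R\<^sup>2" for t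
    proof -
      have "s0 + v \<in> ball s0 R" using v R by (simp add: dist_norm)
      thus ?thesis using quad[OF v, of t] B[OF s0, of t] B[of "s0 + v" t]
        norm_triangle_ineq4[of "f (s0 + v) t - f s0 t" "f (s0 + v) t - f s0 t - L t v"]
        norm_triangle_ineq4[of "f (s0 + v) t" "f s0 t"] by simp
    qed
    thus "AE t in M. norm (L t v) \<le> norm (B t + B t + 32 * B t * norm v ^ 2 / R\<^sup>2)"
      by (intro AE_I2) (metis abs_ge_self order_trans real_norm_def)
  qed
  \<comment> \<open>The quadratic estimate only reaches small \<open>v\<close>; homogeneity of
    \<open>L t\<close> extends integrability to all \<open>v\<close>.\<close>
  have intL: "integrable M (\<lambda>t. L t v)" for v
  proof (cases "v = 0")
    case False
    define a where "a = R / (4 * norm v)"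
    have a: "a > 0" "norm (of_real a *s v) \<le> R / 4"
      using R False by (auto simp: a_def norm_vector_scalar_mult_complex norm_of_real simp del: of_real_divide)
    have "L t v = L t (of_real a *s v) / of_real a" for t using a by (simp add: L(2))
    thus ?thesis using intL0[OF a(2)] by simp
  qed (use intL0[of v] R in auto)
  define \<Lambda> where "\<Lambda> v = (\<integral>t. L t v \<partial>M)" for v
  have "linear \<Lambda>"
    by (rule linearI) (simp_all add: \<Lambda>_def linear_add[OF lin] linear_cmul[OF lin] Bochner_Integration.integral_add[OF intL intL])
  hence bl: "bounded_linear \<Lambda>" using linear_conv_bounded_linear by blast
  define K where "K = 32 * (\<integral>t. B t \<partial>M) / R\<^sup>2"
  have bnd: "norm ((\<integral>t. f (s0 + v) t \<partial>M) - (\<integral>t. f s0 t \<partial>M) - \<Lambda> v) \<le> K * norm v ^ 2"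
    if v: "norm v \<le> R / 4" for v
  proof -
    have sv: "s0 + v \<in> ball s0 R" using v R by (simp add: dist_norm)
    have "(\<integral>t. f (s0 + v) t \<partial>M) - (\<integral>t. f s0 t \<partial>M) - \<Lambda> v = (\<integral>t. f (s0 + v) t - f s0 t - L t v \<partial>M)"
      unfolding \<Lambda>_def using intf[OF s0] intf[OF sv] intL by simp
    also have "norm \<dots> \<le> (\<integral>t. norm (f (s0 + v) t - f s0 t - L t v) \<partial>M)"
      by (rule integral_norm_bound)
    also have "\<dots> \<le> (\<integral>t. 32 * B t * norm v ^ 2 / R\<^sup>2 \<partial>M)"
      using intf[OF s0] intf[OF sv] intL int quad[OF v] by (intro integral_mono) auto
    also have "\<dots> = K * norm v ^ 2" by (simp add: K_def)
    finally show ?thesis .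
  qed
  have "((\<lambda>s. \<integral>t. f s t \<partial>M) has_derivative \<Lambda>) (at s0)"
    unfolding has_derivative_at
  proof (intro conjI bl)
    have "((\<lambda>v::complex^'d. K * norm v) \<longlongrightarrow> K * norm (0::complex^'d)) (at 0)"
      by (rule tendsto_mult[OF tendsto_const tendsto_norm[OF tendsto_ident_at]])
    hence lim: "((\<lambda>v. K * norm v) \<longlongrightarrow> 0) (at (0::complex^'d))" by simp
    show "(\<lambda>v. norm ((\<integral>t. f (s0 + v) t \<partial>M) - (\<integral>t. f s0 t \<partial>M) - \<Lambda> v) / norm v) \<midarrow>0\<rightarrow> 0"
    proof (rule Lim_null_comparison[OF _ lim])
      show "\<forall>\<^sub>F v in at 0. norm (norm ((\<integral>t. f (s0 + v) t \<partial>M) - (\<integral>t. f s0 t \<partial>M) - \<Lambda> v) / norm v) \<le> K * norm v"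
        unfolding eventually_at
      proof (intro exI[of _ "R/4"] conjI ballI impI)
        fix v :: "complex^'d" assume "v \<noteq> 0 \<and> dist v 0 < R / 4"
        thus "norm (norm ((\<integral>t. f (s0 + v) t \<partial>M) - (\<integral>t. f s0 t \<partial>M) - \<Lambda> v) / norm v) \<le> K * norm v"
          using bnd[of v] by (simp add: field_simps power2_eq_square)
      qed (use R in auto)
    qed
  qed
  moreover have "\<Lambda> (a *s v) = a * \<Lambda> v" for a v by (simp add: \<Lambda>_def L(2))
  ultimately show ?thesis unfolding complex_differentiable_at_def by blast
qed

section \<open>Hankel contours and their kernels\<close>

text \<open>For \<open>e > 0\<close> this is the set swept out by the contours of all radii in
  \<open>[0, e)\<close>, where radius 0 stands for the ray.\<close>

definition keyhole :: "real \<Rightarrow> complex set" where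
  "keyhole e = ball 0 e \<union> of_real ` {0..}"

text \<open>
  Radius \<open>0\<close> encodes the representation by \<open>\<integral>\<^sub>0\<^sup>\<infinity> u\<^bsup>s-1\<^esup> du / \<Gamma>(s)\<close>, which replaces the Hankel
  contour near \<open>s = 1, 2, 3, \<dots>\<close>, where the factor of the latter has poles.
\<close>

definition contour_point :: "real \<Rightarrow> real \<Rightarrow> complex" where
  "contour_point r t = (if r = 0 then of_real (max 0 t) else hankel r t)"

text \<open>This is the form \<open>x^(s-1) dx\<close> pulled back to the parameter. The ray, too,
  is parametrised by the whole real line, with a kernel that vanishes for \<open>t \<le> 0\<close>,
  so that all representations are integrals over the same measure space.\<close>

definition contour_kernel :: "real \<Rightarrow> complex \<Rightarrow> real \<Rightarrow> complex" where
  "contour_kernel r s t =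
     (if r = 0 then if t > 0 then exp ((s - 1) * of_real (ln t)) else 0
      else hankel_powr r t (s - 1) * vector_derivative (hankel r) (at t))"

definition contour_factor :: "real \<Rightarrow> complex \<Rightarrow> complex" where
  "contour_factor r s = (if r = 0 then rGamma s else hankel_factor s)"

section \<open>Geometry and measurability of the contours\<close>

lemma hankel_abs_altdef: "hankel_abs r t = r + max 0 (-t) + max 0 (t - 2 * pi)"
  using pi_gt_zero by (auto simp: hankel_abs_def max_def simp del: pi_gt_zero)

lemma hankel_arg_altdef: "hankel_arg t = max 0 (min t (2 * pi))"
  using pi_gt_zero by (auto simp: hankel_arg_def max_def min_def simp del: pi_gt_zero)

lemma hankel_abs_ge: "hankel_abs r t \<ge> r"
  by (simp add: hankel_abs_altdef)

lemma norm_hankel: "r > 0 \<Longrightarrow> norm (hankel r t) = hankel_abs r t"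
  using hankel_abs_ge[of r t] by (simp add: hankel_def)

lemma hankel_arg_bounds: "0 \<le> hankel_arg t" "hankel_arg t \<le> 2 * pi"
  by (auto simp: hankel_arg_altdef)

lemma continuous_hankel: "continuous_on UNIV (hankel r)"
  unfolding hankel_def[abs_def] rcis_def cis_conv_exp hankel_abs_altdef hankel_arg_altdef
  by (intro continuous_intros)

lemma continuous_contour_point: "continuous_on UNIV (contour_point r)"
proof (cases "r = 0")
  case True
  thus ?thesis unfolding contour_point_def[abs_def] by (simp, intro continuous_intros)
next
  case False
  thus ?thesis unfolding contour_point_def[abs_def] using continuous_hankel[of r] by simp
qed

lemma contour_point_in_keyhole:
  assumes "0 \<le> r" "r < e"
  shows "contour_point r t \<in> keyhole e"
proof (cases "r = 0")
  case False
  thus ?thesis using hankel_cases[of r t] assms by (auto simp: contour_point_def keyhole_def)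
qed (auto simp: contour_point_def keyhole_def)

text \<open>The junctions \<open>t = 0\<close> and \<open>t = 2 * pi\<close> are corners, where no
  derivative exists and \<open>vector_derivative\<close> is an unspecified value. They form a null
  set, but measurability and pointwise bounds still have to cope with them.\<close>

lemma vector_derivative_hankel:
  assumes "r > 0"
  shows "t < 0 \<Longrightarrow> vector_derivative (hankel r) (at t) = -1"
    and "0 < t \<Longrightarrow> t < 2 * pi \<Longrightarrow> vector_derivative (hankel r) (at t) = \<i> * hankel r t"
    and "2 * pi < t \<Longrightarrow> vector_derivative (hankel r) (at t) = 1"
proof -
  have *: "vector_derivative (hankel r) (at t) = d"
    if "(f has_vector_derivative d) (at t)" "t \<in> S" "open S" "\<And>x. x \<in> S \<Longrightarrow> f x = hankel r x" for f d S
    using has_vector_derivative_transform_within_open[OF that(1,3,2)] that(4)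
    by (intro vector_derivative_at) auto
  show "vector_derivative (hankel r) (at t) = -1" if "t < 0"
  proof (rule *[of "\<lambda>t. of_real (r - t)" _ "{..<0}"])
    show "((\<lambda>t. complex_of_real (r - t)) has_vector_derivative - 1) (at t)"
      by (auto intro!: derivative_eq_intros)
  qed (use that in \<open>auto simp: hankel_def hankel_abs_def hankel_arg_def rcis_def\<close>)
  show "vector_derivative (hankel r) (at t) = 1" if "2 * pi < t"
  proof (rule *[of "\<lambda>t. of_real (r + (t - 2 * pi))" _ "{2*pi<..}"])
    show "((\<lambda>t. complex_of_real (r + (t - 2 * pi))) has_vector_derivative 1) (at t)"
      by (auto intro!: derivative_eq_intros)
  qed (use that pi_gt_zero in \<open>auto simp: hankel_def hankel_abs_def hankel_arg_def rcis_def simp del: pi_gt_zero\<close>)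
  show "vector_derivative (hankel r) (at t) = \<i> * hankel r t" if "0 < t" "t < 2 * pi"
  proof (rule *[of "\<lambda>t. of_real r * exp (\<i> * of_real t)" _ "{0<..<2*pi}"])
    have h: "hankel r t = of_real r * exp (\<i> * of_real t)"
      using that by (auto simp: hankel_def hankel_abs_def hankel_arg_def rcis_def cis_conv_exp)
    show "((\<lambda>t. complex_of_real r * exp (\<i> * of_real t)) has_vector_derivative \<i> * hankel r t) (at t)"
      unfolding h by (rule has_vector_derivative_real_field) (auto intro!: derivative_eq_intros)
  qed (use that in \<open>auto simp: hankel_def hankel_abs_def hankel_arg_def rcis_def cis_conv_exp\<close>)
qed

lemma measurable_contour_kernel [measurable]:
  assumes "r \<ge> 0"
  shows "contour_kernel r s \<in> borel_measurable borel"
proof (cases "r = 0")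
  case True
  have "(\<lambda>t. if t > 0 then exp ((s - 1) * complex_of_real (ln t)) else 0) \<in> borel_measurable borel"
    by measurable
  thus ?thesis using True by (simp add: contour_kernel_def[abs_def])
next
  case False
  hence r: "r > 0" using assms by simp
  have [measurable]: "hankel r \<in> borel_measurable borel"
    by (rule borel_measurable_continuous_onI, rule continuous_hankel)
  have "continuous_on UNIV (\<lambda>t. hankel_powr r t (s - 1))"
    unfolding hankel_powr_def hankel_abs_altdef hankel_arg_altdef Complex_eq
    by (intro continuous_intros ballI) (use r in \<open>auto simp: max_def\<close>)
  hence [measurable]: "(\<lambda>t. hankel_powr r t (s - 1)) \<in> borel_measurable borel"
    by (rule borel_measurable_continuous_onI)
  define d where "d t = vector_derivative (hankel r) (at t)" for t
  \<comment> \<open>The unspecified values at the two corners enter as constants.\<close>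
  have "d = (\<lambda>t. if t < 0 then -1 else if t = 0 then d 0 else if t < 2 * pi then \<i> * hankel r t
                 else if t = 2 * pi then d (2 * pi) else 1)"
    using vector_derivative_hankel[OF r] by (auto simp: fun_eq_iff d_def)
  hence "d \<in> borel_measurable borel" by (rule ssubst) measurable
  thus ?thesis using False by (simp add: contour_kernel_def[abs_def] d_def[abs_def])
qed

section \<open>Integrable majorants for the kernels\<close>

lemma integrable_powr_exp:
  fixes a b :: real
  assumes "a > -1" "b > 0"
  shows "integrable lborel (\<lambda>u. indicator {0<..} u * (u powr a * exp (- (b * u))))"
proof -
  \<comment> \<open>In absolute value this is the integrand of the Gamma integral at
    \<open>a + 1\<close>.\<close>
  have "(\<lambda>t. complex_of_real t powr (of_real (a + 1) - 1) / of_real (exp (b * t))) absolutely_integrable_on {0<..}"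
    by (rule absolutely_integrable_Gamma_integral) (use assms in auto)
  hence "integrable lebesgue (\<lambda>t. norm (indicator {0<..} t *\<^sub>R (complex_of_real t powr (of_real (a + 1) - 1) / of_real (exp (b * t)))))"
    unfolding set_integrable_def by (rule integrable_norm)
  also have "(\<lambda>t. norm (indicator {0<..} t *\<^sub>R (complex_of_real t powr (of_real (a + 1) - 1) / of_real (exp (b * t)))))
      = (\<lambda>u. indicator {0<..} u * (u powr a * exp (- (b * u))))"
    by (auto simp: fun_eq_iff indicator_def norm_divide exp_minus field_simps powr_of_real)
  finally show ?thesis by (subst (asm) integrable_completion) auto
qed

lemma integrable_powr_exp_truncated:
  fixes a b r :: real
  assumes "r > 0" "b > 0"
  shows "integrable lborel (\<lambda>u. indicator {r..} u * (u powr a * exp (- (b * u))))"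
proof -
  \<comment> \<open>Away from 0 a negative exponent is harmless: since
    \<open>a - a' \<le> 0\<close>, \<open>u powr (a - a')\<close> is at most its value at
    \<open>r\<close>, and the remaining exponent \<open>a'\<close> is covered by the Gamma
    integral.\<close>
  define a' where "a' = max a 0"
  have "integrable lborel (\<lambda>u. r powr (a - a') * (indicator {0<..} u * (u powr a' * exp (- (b * u)))))"
    by (intro integrable_mult_right integrable_powr_exp) (use assms in \<open>auto simp: a'_def\<close>)
  thus ?thesis
  proof (rule Bochner_Integration.integrable_bound)
    show "AE u in lborel. norm (indicator {r..} u * (u powr a * exp (- (b * u))))
            \<le> norm (r powr (a - a') * (indicator {0<..} u * (u powr a' * exp (- (b * u)))))"
    proof (intro AE_I2)
      fix u :: real
      show "norm (indicator {r..} u * (u powr a * exp (- (b * u))))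
            \<le> norm (r powr (a - a') * (indicator {0<..} u * (u powr a' * exp (- (b * u)))))"
      proof (cases "u \<ge> r")
        case True
        have "u powr a = u powr (a - a') * u powr a'" by (simp add: powr_add[symmetric])
        also have "\<dots> \<le> r powr (a - a') * u powr a'"
          using assms True by (intro mult_right_mono powr_mono2') (auto simp: a'_def)
        finally show ?thesis using True assms by (simp add: indicator_def)
      qed (simp add: indicator_def)
    qed
  qed auto
qed

lemma integrable_hankel_abs:
  fixes a b r :: real
  assumes r: "r > 0" and b: "b > 0"
  shows "integrable lborel (\<lambda>t. hankel_abs r t powr a * exp (- (b * hankel_abs r t)))"
proof -
  define h where "h u = indicator {r..} u * (u powr a * exp (- (b * u)))" for u
  have h: "integrable lborel h" unfolding h_def[abs_def] by (rule integrable_powr_exp_truncated[OF assms])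
  have 1: "integrable lborel (\<lambda>t. indicator {..<0} t *\<^sub>R h (r + (-1) * t))"
    by (intro integrable_mult_indicator lborel_integrable_real_affine h) auto
  have 2: "integrable lborel (\<lambda>t. indicator {2*pi<..} t *\<^sub>R h ((r - 2 * pi) + 1 * t))"
    by (intro integrable_mult_indicator lborel_integrable_real_affine h) auto
  have 3: "integrable lborel (\<lambda>t. indicator {0..2*pi} t * (r powr a * exp (- (b * r))))"
    by (intro integrable_mult_left integrable_real_indicator) auto
  have "(\<lambda>t. hankel_abs r t powr a * exp (- (b * hankel_abs r t))) =
    (\<lambda>t. indicator {..<0} t *\<^sub>R h (r + (-1) * t) + indicator {2*pi<..} t *\<^sub>R h ((r - 2 * pi) + 1 * t)
        + indicator {0..2*pi} t * (r powr a * exp (- (b * r))))"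
    using pi_gt_zero by (auto simp: fun_eq_iff hankel_abs_def h_def indicator_def algebra_simps simp del: pi_gt_zero)
  thus ?thesis using 1 2 3 by simp
qed

text \<open>One of the two ends dominates, according to whether \<open>u \<ge> 1\<close>. Their sum
  does not depend on \<open>x\<close>, as a bound locally uniform in \<open>s\<close>
  requires.\<close>

lemma powr_le_powr_ends:
  fixes u :: real
  assumes "u > 0" "\<bar>x - a\<bar> \<le> R"
  shows "u powr x \<le> u powr (a - R) + u powr (a + R)"
proof (cases "u \<ge> 1")
  case True
  hence "u powr x \<le> u powr (a + R)" using assms by (intro powr_mono) auto
  moreover have "u powr (a - R) \<ge> 0" by simp
  ultimately show ?thesis by linarith
next
  case False
  hence "u powr x \<le> u powr (a - R)" using assms by (intro powr_mono') auto
  moreover have "u powr (a + R) \<ge> 0" by simp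
  ultimately show ?thesis by linarith
qed

lemma norm_hankel_powr:
  assumes "r > 0"
  shows "norm (hankel_powr r t s) = hankel_abs r t powr Re s * exp (- (Im s * hankel_arg t))"
  using hankel_abs_ge[of r t] assms
  by (simp add: hankel_powr_def powr_def exp_diff exp_minus field_simps flip: exp_add)

text \<open>One \<open>k\<close> serves all \<open>s\<close> in a closed disc, as differentiation
  under the integral sign demands. The factor \<open>exp (- (b * norm x))\<close> will be supplied
  by the integrand. For radius 0 the condition \<open>Re s0 > R\<close> keeps the exponents at the
  origin above -1.\<close>

lemma contour_kernel_majorant:
  assumes r: "r \<ge> 0" and R: "R \<ge> 0" and s0: "r = 0 \<Longrightarrow> Re s0 > R" and b: "b > 0"
  obtains k where "integrable lborel k"
    "\<And>s t. norm (s - s0) \<le> R \<Longrightarrow> norm (contour_kernel r s t) * exp (- (b * norm (contour_point r t))) \<le> k t"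
proof -
  have re: "\<bar>(Re s - 1) - (Re s0 - 1)\<bar> \<le> R" if "norm (s - s0) \<le> R" for s
    using that abs_Re_le_cmod[of "s - s0"] by simp
  have im: "\<bar>Im s\<bar> \<le> \<bar>Im s0\<bar> + R" if "norm (s - s0) \<le> R" for s
    using that abs_Im_le_cmod[of "s - s0"] by simp
  show ?thesis
  proof (cases "r = 0")
    case True
    define k where "k u = indicator {0<..} u * (u powr (Re s0 - 1 - R) * exp (- (b * u)))
                        + indicator {0<..} u * (u powr (Re s0 - 1 + R) * exp (- (b * u)))" for u
    show ?thesis
    proof (rule that[of k])
      show "integrable lborel k" unfolding k_def[abs_def]
        by (intro Bochner_Integration.integrable_add integrable_powr_exp) (use s0[OF True] R b in auto)
      fix s t assume s: "norm (s - s0) \<le> R"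
      show "norm (contour_kernel r s t) * exp (- (b * norm (contour_point r t))) \<le> k t"
      proof (cases "t > 0")
        case t: True
        have "norm (contour_kernel r s t) = t powr (Re s - 1)"
          using True t by (simp add: contour_kernel_def powr_def)
        also have "\<dots> \<le> t powr (Re s0 - 1 - R) + t powr (Re s0 - 1 + R)"
          using powr_le_powr_ends[OF t re[OF s]] by simp
        finally have "norm (contour_kernel r s t) * exp (- (b * t))
              \<le> (t powr (Re s0 - 1 - R) + t powr (Re s0 - 1 + R)) * exp (- (b * t))"
          by (rule mult_right_mono) simp
        thus ?thesis using True t by (simp add: k_def contour_point_def algebra_simps)
      qed (use True in \<open>auto simp: contour_kernel_def k_def\<close>)
    qed
  next
    case False
    hence r0: "r > 0" using r by simp
    define d where "d t = vector_derivative (hankel r) (at t)" for t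
    \<comment> \<open>A bound for the speed of the contour: 1 on the two sides, \<open>r\<close> on
      the circle, and the unspecified values at the corners.\<close>
    define D where "D = Max {1, r, norm (d 0), norm (d (2 * pi))}"
    have D: "norm (d t) \<le> D" for t
    proof -
      consider "t < 0" | "t = 0" | "0 < t" "t < 2 * pi" | "t = 2 * pi" | "t > 2 * pi" by linarith
      thus ?thesis
        by cases (use r0 in \<open>auto simp: D_def d_def vector_derivative_hankel norm_mult norm_hankel hankel_abs_def\<close>)
    qed
    have D0: "D \<ge> 0" using order_trans[OF norm_ge_zero D] .
    \<comment> \<open>Besides a power of the modulus, \<open>x^(s-1)\<close> contributes
      \<open>exp (- (Im s * arg x))\<close>, with \<open>arg x\<close> between 0 and
      \<open>2 * pi\<close>.\<close>
    define C where "C = D * exp ((\<bar>Im s0\<bar> + R) * (2 * pi))"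
    have C0: "C \<ge> 0" using D0 by (simp add: C_def)
    define k where "k t = C * (hankel_abs r t powr (Re s0 - 1 - R) * exp (- (b * hankel_abs r t)))
                        + C * (hankel_abs r t powr (Re s0 - 1 + R) * exp (- (b * hankel_abs r t)))" for t
    show ?thesis
    proof (rule that[of k])
      show "integrable lborel k" unfolding k_def[abs_def]
        by (intro Bochner_Integration.integrable_add integrable_mult_right integrable_hankel_abs r0 b)
      fix s t assume s: "norm (s - s0) \<le> R"
      let ?A = "hankel_abs r t"
      have A: "?A > 0" using hankel_abs_ge[of r t] r0 by simp
      have "- (Im s * hankel_arg t) \<le> \<bar>Im s\<bar> * hankel_arg t"
        using hankel_arg_bounds(1)[of t] by (metis abs_ge_minus_self minus_mult_left mult_right_mono)
      also have "\<dots> \<le> (\<bar>Im s0\<bar> + R) * (2 * pi)"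
        using im[OF s] hankel_arg_bounds[of t] by (intro mult_mono) auto
      finally have "norm (hankel_powr r t (s - 1))
          \<le> (?A powr (Re s0 - 1 - R) + ?A powr (Re s0 - 1 + R)) * exp ((\<bar>Im s0\<bar> + R) * (2 * pi))"
        unfolding norm_hankel_powr[OF r0] using powr_le_powr_ends[OF A re[OF s]]
        by (intro mult_mono) auto
      hence "norm (contour_kernel r s t)
          \<le> ((?A powr (Re s0 - 1 - R) + ?A powr (Re s0 - 1 + R)) * exp ((\<bar>Im s0\<bar> + R) * (2 * pi))) * D"
        using D[of t] D0 False unfolding contour_kernel_def d_def by (simp add: norm_mult mult_mono)
      hence "norm (contour_kernel r s t) * exp (- (b * ?A))
          \<le> ((?A powr (Re s0 - 1 - R) + ?A powr (Re s0 - 1 + R)) * exp ((\<bar>Im s0\<bar> + R) * (2 * pi))) * D * exp (- (b * ?A))"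
        by (rule mult_right_mono) simp
      thus "norm (contour_kernel r s t) * exp (- (b * norm (contour_point r t))) \<le> k t"
        using r0 by (simp add: contour_point_def norm_hankel k_def C_def algebra_simps)
    qed
  qed
qed

lemma contour_kernel_field_differentiable:
  "(\<lambda>s. contour_kernel r s t) field_differentiable at s"
proof -
  have *: "(\<lambda>s. exp ((s - 1) * c) * d) field_differentiable at s" for c d :: complex
    by (intro holomorphic_on_imp_differentiable_at[of _ UNIV] holomorphic_intros) auto
  show ?thesis
    unfolding contour_kernel_def hankel_powr_def
    using *[of "of_real (ln t)" 1] *[of _ "vector_derivative (hankel r) (at t)"]
    by (cases "r = 0"; cases "t > 0") auto
qed

section \<open>Contour integrals in one variable\<close>

lemma hankel_factor_altdef:
  "hankel_factor = remove_sings (\<lambda>s. rGamma s / (exp (2 * of_real pi * \<i> * s) - 1))"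
  \<comment> \<open>At the poles of \<open>Gamma\<close> both expressions are 0 by the conventions
    for division, so they agree everywhere even before singularities are removed.\<close>
  unfolding hankel_factor_def
  by (rule arg_cong[of _ _ remove_sings]) (simp add: fun_eq_iff rGamma_inverse_Gamma field_simps)

lemma exp_2pi_i_neq_1:
  assumes "s \<notin> \<int>"
  shows "exp (2 * of_real pi * \<i> * s) - 1 \<noteq> 0"
proof
  assume "exp (2 * of_real pi * \<i> * s) - 1 = 0"
  hence "exp (2 * of_real pi * \<i> * s) = 1" by simp
  then obtain n :: int where n: "Re (2 * of_real pi * \<i> * s) = 0" "Im (2 * of_real pi * \<i> * s) = of_int (2 * n) * pi"
    unfolding exp_eq_1 by auto
  hence "s = of_int n" by (auto simp: complex_eq_iff)
  thus False using assms by simp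
qed

lemma analytic_rGamma_over_exp:
  assumes "s \<notin> \<int>"
  shows "(\<lambda>s. rGamma s / (exp (2 * of_real pi * \<i> * s) - 1)) analytic_on {s}"
proof -
  have "open (- \<int> :: complex set)" using closed_Ints open_Compl by blast
  moreover have "(\<lambda>s. rGamma s / (exp (2 * of_real pi * \<i> * s) - 1)) holomorphic_on - \<int>"
    by (intro holomorphic_intros) (use exp_2pi_i_neq_1 in auto)
  ultimately have "(\<lambda>s. rGamma s / (exp (2 * of_real pi * \<i> * s) - 1)) analytic_on - \<int>"
    by (simp add: analytic_on_open)
  thus ?thesis by (rule analytic_on_subset) (use assms in auto)
qed

lemma hankel_factor_eq:
  "s \<notin> \<int> \<Longrightarrow> hankel_factor s = rGamma s / (exp (2 * of_real pi * \<i> * s) - 1)"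
  unfolding hankel_factor_altdef by (rule remove_sings_at_analytic[OF analytic_rGamma_over_exp])

text \<open>At an integer \<open>s \<le> 0\<close> numerator and denominator both vanish, the
  denominator to first order. Dividing each by \<open>z - s\<close> shows that the quotient has a
  finite limit, so the singularity is removable. At positive integers \<open>rGamma\<close> does not
  vanish, hence the restriction on \<open>Re s\<close>.\<close>

lemma hankel_factor_field_differentiable:
  assumes "Re s < 1"
  shows "hankel_factor field_differentiable at s"
proof -
  let ?q = "\<lambda>z. rGamma z / (exp (2 * of_real pi * \<i> * z) - 1)"
  have "remove_sings ?q analytic_on {s}"
  proof (cases "s \<in> \<int>")
    case False
    thus ?thesis using analytic_rGamma_over_exp remove_sings_analytic_on by blast
  next
    case True
    then obtain m :: int where m: "s = of_int m" by (auto elim: Ints_cases)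
    have m0: "m \<le> 0" using assms m by simp
    define n where "n = nat (- m)"
    have s: "s = - of_nat n" using m m0 by (simp add: n_def)
    show ?thesis
    proof (rule remove_sings_analytic_at)
      have "z \<notin> \<int>" if "z \<in> ball s 1 - {s}" for z
      proof
        assume "z \<in> \<int>"
        then obtain k :: int where "z = of_int k" by (auto elim: Ints_cases)
        hence "dist s z = \<bar>of_int (m - k)\<bar>" using m by (simp add: dist_norm flip: of_int_diff)
        thus False using that \<open>z = of_int k\<close> m by auto
      qed
      thus "isolated_singularity_at ?q s"
        unfolding isolated_singularity_at_def
        using analytic_rGamma_over_exp analytic_on_analytic_at zero_less_one by blast
      have "((\<lambda>z. (rGamma z - rGamma s) / (z - s)) \<longlongrightarrow> (-1)^n * fact n) (at s)"
        using has_field_derivative_rGamma_nonpos_int[of n UNIV] unfolding s has_field_derivative_iff .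
      moreover have "((\<lambda>z. exp (2 * of_real pi * \<i> * z)) has_field_derivative exp (2 * of_real pi * \<i> * s) * (2 * of_real pi * \<i>)) (at s)"
        by (auto intro!: derivative_eq_intros)
      hence "((\<lambda>z. (exp (2 * of_real pi * \<i> * z) - exp (2 * of_real pi * \<i> * s)) / (z - s)) \<longlongrightarrow> exp (2 * of_real pi * \<i> * s) * (2 * of_real pi * \<i>)) (at s)"
        unfolding has_field_derivative_iff .
      ultimately have lim: "((\<lambda>z. ((rGamma z - rGamma s) / (z - s)) /
             ((exp (2 * of_real pi * \<i> * z) - exp (2 * of_real pi * \<i> * s)) / (z - s)))
           \<longlongrightarrow> ((-1)^n * fact n) / (exp (2 * of_real pi * \<i> * s) * (2 * of_real pi * \<i>))) (at s)"
        by (rule tendsto_divide) auto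
      have "exp (2 * of_real pi * \<i> * s) = 1"
        unfolding exp_eq_1 m by (auto intro!: exI[of _ m])
      moreover have "rGamma s = 0" unfolding s by (simp add: rGamma_eq_zero_iff)
      ultimately show "?q \<midarrow>s\<rightarrow> ((-1)^n * fact n) / (exp (2 * of_real pi * \<i> * s) * (2 * of_real pi * \<i>))"
        using lim by (elim Lim_transform_eventually) (auto simp: eventually_at intro!: exI[of _ 1])
    qed
  qed
  thus ?thesis unfolding hankel_factor_altdef using analytic_on_imp_differentiable_at by blast
qed

text \<open>The ray integral has to converge at 0; a Hankel contour has to avoid the poles of
  \<open>hankel_factor\<close>.\<close>

definition admissible :: "real \<Rightarrow> complex \<Rightarrow> bool" where
  "admissible r s \<longleftrightarrow> (if r = 0 then Re s > 0 else s \<notin> of_nat ` {1..})"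

section \<open>Change of contour in one variable\<close>

locale keyhole_function =
  fixes g :: "complex \<Rightarrow> complex" and e b M :: real
  assumes e: "e > 0" and b: "b > 0"
    and hol: "g holomorphic_on ball 0 e"
    and cont: "continuous_on (keyhole e) g"
    and bound: "\<And>x. x \<in> keyhole e \<Longrightarrow> norm (g x) \<le> M * exp (- (b * norm x))"
begin

definition contour_integral_value :: "real \<Rightarrow> complex \<Rightarrow> complex" where
  "contour_integral_value r s = (\<integral>t. contour_kernel r s t * g (contour_point r t) \<partial>lborel)"

lemma M_nonneg: "M \<ge> 0"
proof -
  have "0 \<in> keyhole e" using e by (simp add: keyhole_def)
  hence "norm (g 0) \<le> M" using bound[of 0] by simp
  thus ?thesis using norm_ge_zero order_trans by blast
qed

lemma measurable_g_contour_point: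
  assumes "0 \<le> r" "r < e"
  shows "(\<lambda>t. g (contour_point r t)) \<in> borel_measurable borel"
proof (rule borel_measurable_continuous_onI)
  show "continuous_on UNIV (\<lambda>t. g (contour_point r t))"
    by (rule continuous_on_compose2[OF cont continuous_contour_point])
       (use contour_point_in_keyhole assms in auto)
qed

lemma integrable_contour:
  assumes r: "0 \<le> r" "r < e" and s: "r = 0 \<Longrightarrow> Re s > 0"
  shows "integrable lborel (\<lambda>t. contour_kernel r s t * g (contour_point r t))"
proof -
  obtain k where k: "integrable lborel k"
    "\<And>s' t. norm (s' - s) \<le> 0 \<Longrightarrow> norm (contour_kernel r s' t) * exp (- (b * norm (contour_point r t))) \<le> k t"
    using contour_kernel_majorant[of r 0 s b] r s b by auto
  note [measurable] = measurable_g_contour_point[OF r] measurable_contour_kernel[OF r(1)]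
  have "integrable lborel (\<lambda>t. M * k t)" using k(1) by simp
  thus ?thesis
  proof (rule Bochner_Integration.integrable_bound)
    show "AE t in lborel. norm (contour_kernel r s t * g (contour_point r t)) \<le> norm (M * k t)"
    proof (intro AE_I2)
      fix t
      have "norm (contour_kernel r s t * g (contour_point r t))
          \<le> norm (contour_kernel r s t) * (M * exp (- (b * norm (contour_point r t))))"
        unfolding norm_mult by (intro mult_left_mono bound contour_point_in_keyhole r) auto
      also have "\<dots> = M * (norm (contour_kernel r s t) * exp (- (b * norm (contour_point r t))))" by simp
      also have "\<dots> \<le> M * k t" using k(2)[of s t] M_nonneg by (intro mult_left_mono) auto
      finally show "norm (contour_kernel r s t * g (contour_point r t)) \<le> norm (M * k t)" by simp
    qed
  qed measurable
qed

definition ray :: "complex \<Rightarrow> real \<Rightarrow> complex" where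
  "ray s u = contour_kernel 0 s u * g (contour_point 0 u)"

lemma ray_eq: "u > 0 \<Longrightarrow> ray s u = exp ((s - 1) * of_real (ln u)) * g (of_real u)"
  by (simp add: ray_def contour_kernel_def contour_point_def)

lemma measurable_ray [measurable]: "ray s \<in> borel_measurable borel"
proof -
  note [measurable] = measurable_g_contour_point[OF order.refl e] measurable_contour_kernel[OF order.refl]
  show ?thesis unfolding ray_def[abs_def] by measurable
qed

lemma integrable_ray:
  assumes r: "r > 0"
  shows "integrable lborel (\<lambda>u. indicator {r<..} u *\<^sub>R ray s u)"
proof -
  have "integrable lborel (\<lambda>u. M * (indicator {r..} u * (u powr (Re s - 1) * exp (- (b * u)))))"
    by (intro integrable_mult_right integrable_powr_exp_truncated r b)
  thus ?thesis
  proof (rule Bochner_Integration.integrable_bound)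
    show "AE u in lborel. norm (indicator {r<..} u *\<^sub>R ray s u)
        \<le> norm (M * (indicator {r..} u * (u powr (Re s - 1) * exp (- (b * u)))))"
    proof (intro AE_I2)
      fix u
      show "norm (indicator {r<..} u *\<^sub>R ray s u)
        \<le> norm (M * (indicator {r..} u * (u powr (Re s - 1) * exp (- (b * u)))))"
      proof (cases "u > r")
        case True
        hence u: "u > 0" using r by simp
        have "of_real u \<in> keyhole e" using u by (auto simp: keyhole_def)
        hence "norm (ray s u) \<le> u powr (Re s - 1) * (M * exp (- (b * u)))"
          unfolding ray_eq[OF u] norm_mult using bound[of "of_real u"] u
          by (intro mult_mono) (auto simp: powr_def)
        also have "\<dots> = M * (u powr (Re s - 1) * exp (- (b * u)))" by simp
        finally show ?thesis using True M_nonneg by (simp add: indicator_def)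
      qed (simp add: indicator_def)
    qed
  qed measurable
qed

text \<open>\<open>exp\<close> maps the half-plane into the disc where \<open>g\<close> is
  holomorphic, and the many-valued power becomes the entire function \<open>exp (s * z)\<close>. The
  half-plane is convex, whereas the punctured disc below it is not even simply connected.\<close>

lemma log_primitive:
  obtains P where "\<And>z. Re z < ln e \<Longrightarrow> (P has_field_derivative exp (s * z) * g (exp z)) (at z)"
proof -
  let ?E = "{z. Re z < ln e}"
  have E: "open ?E" "convex ?E" by (auto intro: open_halfspace_Re_lt convex_halfspace_Re_lt)
  have "exp (Re z) < e" if "Re z < ln e" for z using e that by (metis exp_less_mono exp_ln)
  hence "exp ` ?E \<subseteq> ball 0 e" by auto
  hence "(\<lambda>z. g (exp z)) holomorphic_on ?E"
    using holomorphic_on_compose_gen[OF _ hol, of exp ?E] by (auto simp: o_def intro: holomorphic_intros)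
  hence "(\<lambda>z. exp (s * z) * g (exp z)) holomorphic_on ?E"
    by (intro holomorphic_intros)
  then obtain P where P: "\<And>z. z \<in> ?E \<Longrightarrow> (P has_field_derivative exp (s * z) * g (exp z)) (at z within ?E)"
    using holomorphic_convex_primitive'[OF E(2,1)] by blast
  show ?thesis by (rule that[of P]) (use P at_within_open[OF _ E(1)] in fastforce)
qed

context
  fixes s :: complex and P :: "complex \<Rightarrow> complex"
  assumes P: "\<And>z. Re z < ln e \<Longrightarrow> (P has_field_derivative exp (s * z) * g (exp z)) (at z)"
begin

lemma Re_ln_less: "0 < r \<Longrightarrow> r < e \<Longrightarrow> Re (of_real (ln r) + of_real t * \<i>) < ln e"
  using e by simp

lemma circle_eq:
  assumes r: "0 < r" "r < e" and t: "0 < t" "t < 2 * pi"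
  shows "contour_kernel r s t * g (contour_point r t) =
    \<i> * (exp (s * (of_real (ln r) + of_real t * \<i>)) * g (exp (of_real (ln r) + of_real t * \<i>)))"
proof -
  have h: "hankel r t = exp (of_real (ln r) + of_real t * \<i>)"
    using r t by (simp add: hankel_def hankel_abs_def hankel_arg_def rcis_def cis_conv_exp exp_add exp_of_real mult.commute)
  have "hankel_powr r t (s - 1) * exp (of_real (ln r) + of_real t * \<i>) = exp (s * (of_real (ln r) + of_real t * \<i>))"
    using r t by (simp add: hankel_powr_def hankel_abs_def hankel_arg_def Complex_eq algebra_simps flip: exp_add)
  thus ?thesis using r t
    by (simp add: contour_kernel_def contour_point_def vector_derivative_hankel h)
qed

text \<open>The upper side is traversed towards the origin and gives minus the ray integral; the
  lower side gives it with the phase \<open>exp (2 * pi * \<i> * s)\<close>. The circle becomes a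
  vertical segment of length \<open>2 * pi\<close> in the logarithmic coordinate, where
  \<open>P\<close> evaluates it.\<close>

lemma contour_integral_value_eq:
  assumes r: "0 < r" "r < e"
  shows "contour_integral_value r s =
    (exp (2 * of_real pi * \<i> * s) - 1) * (\<integral>u. indicator {r<..} u *\<^sub>R ray s u \<partial>lborel)
    + (P (of_real (ln r) + of_real (2 * pi) * \<i>) - P (of_real (ln r)))"
proof -
  define X where "X = (\<integral>u. indicator {r<..} u *\<^sub>R ray s u \<partial>lborel)"
  define w where "w t = of_real (ln r) + of_real t * \<i>" for t
  have X: "has_bochner_integral lborel (\<lambda>u. indicator {r<..} u *\<^sub>R ray s u) X"
    unfolding X_def using integrable_ray[OF r(1)] by (rule has_bochner_integral_integrable)
  have 1: "has_bochner_integral lborel (\<lambda>t. - (indicator {r<..} (r + (-1) * t) *\<^sub>R ray s (r + (-1) * t))) (- X)"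
    using X by (subst (asm) lborel_has_bochner_integral_real_affine_iff[of "-1" _ _ r]) (auto intro: has_bochner_integral_minus)
  have 3: "has_bochner_integral lborel (\<lambda>t. exp (2 * of_real pi * \<i> * s) *
      (indicator {r<..} ((r - 2 * pi) + 1 * t) *\<^sub>R ray s ((r - 2 * pi) + 1 * t))) (exp (2 * of_real pi * \<i> * s) * X)"
    using X by (intro has_bochner_integral_mult_right)
      (subst (asm) lborel_has_bochner_integral_real_affine_iff[of 1 _ _ "r - 2 * pi"], auto)
  have 2: "has_bochner_integral lborel (\<lambda>t. indicator {0..2*pi} t *\<^sub>R (\<i> * (exp (s * w t) * g (exp (w t)))))
      (P (w (2 * pi)) - P (w 0))"
  proof (rule has_bochner_integral_FTC_Icc)
    have "Re (w t) < ln e" for t using Re_ln_less[OF r] by (simp add: w_def)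
    note Pw = P[OF this]
    have w': "(w has_vector_derivative \<i>) (at t within S)" for t S
      unfolding w_def[abs_def] by (auto intro!: derivative_eq_intros)
    show "((\<lambda>t. P (w t)) has_vector_derivative \<i> * (exp (s * w t) * g (exp (w t)))) (at t within {0..2*pi})" for t
      using field_vector_diff_chain_within[OF w' has_field_derivative_at_within[OF Pw]] by (simp add: o_def)
    have "exp (w t) \<in> ball 0 e" for t using r by (simp add: w_def)
    moreover have "continuous_on {0..2*pi} w" unfolding w_def by (intro continuous_intros)
    ultimately show "continuous_on {0..2 * pi} (\<lambda>t. \<i> * (exp (s * w t) * g (exp (w t))))"
      by (intro continuous_intros continuous_on_compose2[OF holomorphic_on_imp_continuous_on[OF hol]]) auto
  qed simp
  let ?S = "\<lambda>t. - (indicator {r<..} (r + (-1) * t) *\<^sub>R ray s (r + (-1) * t)) +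
      indicator {0..2*pi} t *\<^sub>R (\<i> * (exp (s * w t) * g (exp (w t)))) +
      exp (2 * of_real pi * \<i> * s) * (indicator {r<..} ((r - 2 * pi) + 1 * t) *\<^sub>R ray s ((r - 2 * pi) + 1 * t))"
  have sum: "has_bochner_integral lborel ?S (- X + (P (w (2 * pi)) - P (w 0)) + exp (2 * of_real pi * \<i> * s) * X)"
    by (intro has_bochner_integral_add 1 2 3)
  have eq: "contour_kernel r s t * g (contour_point r t) = ?S t" if t: "t \<noteq> 0" "t \<noteq> 2 * pi" for t
  proof -
    consider "t < 0" | "0 < t" "t < 2 * pi" | "2 * pi < t" using t by linarith
    thus ?thesis
    proof cases
      case 1
      hence "hankel r t = of_real (r - t)" "hankel_powr r t (s - 1) = exp ((s - 1) * of_real (ln (r - t)))"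
        by (auto simp: hankel_def hankel_powr_def hankel_abs_def hankel_arg_def rcis_def complex_of_real_def)
      thus ?thesis using 1 r pi_gt_zero
        by (simp add: contour_kernel_def contour_point_def vector_derivative_hankel ray_eq indicator_def del: pi_gt_zero)
    next
      case 2
      thus ?thesis using circle_eq[OF r 2] by (simp add: w_def indicator_def)
    next
      case 3
      have "hankel r t = of_real (r + (t - 2 * pi))" 
        using 3 pi_gt_zero by (auto simp: hankel_def hankel_abs_def hankel_arg_def rcis_def simp del: pi_gt_zero)
      moreover have "hankel_powr r t (s - 1) = exp (2 * of_real pi * \<i> * s) * exp ((s - 1) * of_real (ln (r + (t - 2 * pi))))"
      proof -
        \<comment> \<open>The argument \<open>2 * pi\<close> contributes the phase of
          \<open>s - 1\<close>, which equals that of \<open>s\<close> because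
          \<open>exp (2 * pi * \<i>) = 1\<close>.\<close>
        have "hankel_powr r t (s - 1) = exp ((s - 1) * (of_real (ln (r + (t - 2 * pi))) + \<i> * of_real (2 * pi)))"
          using 3 pi_gt_zero by (auto simp: hankel_powr_def hankel_abs_def hankel_arg_def Complex_eq simp del: pi_gt_zero)
        also have "(s - 1) * (of_real (ln (r + (t - 2 * pi))) + \<i> * of_real (2 * pi))
            = 2 * of_real pi * \<i> * s + (s - 1) * of_real (ln (r + (t - 2 * pi))) - 2 * of_real pi * \<i>"
          by (simp add: algebra_simps)
        also have "exp \<dots> = exp (2 * of_real pi * \<i> * s + (s - 1) * of_real (ln (r + (t - 2 * pi))))"
          unfolding exp_diff by simp
        finally show ?thesis by (simp add: exp_add)
      qed
      ultimately show ?thesis using 3 r pi_gt_zero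
        by (simp add: contour_kernel_def contour_point_def vector_derivative_hankel ray_eq indicator_def 
            add_diff_eq diff_add_eq mult.assoc del: pi_gt_zero)
    qed
  qed
  have "contour_integral_value r s = integral\<^sup>L lborel ?S"
    unfolding contour_integral_value_def
  proof (rule integral_cong_AE)
    show "(\<lambda>t. contour_kernel r s t * g (contour_point r t)) \<in> borel_measurable lborel"
      using integrable_contour[of r s] r by (intro borel_measurable_integrable) auto
    show "?S \<in> borel_measurable lborel" using sum by (intro borel_measurable_has_bochner_integral)
    \<comment> \<open>Here the corners, with their unspecified derivatives, are discarded as a null
      set.\<close>
    have "AE t in lborel. t \<noteq> 0 \<and> t \<noteq> 2 * pi"
      using AE_lborel_singleton[of 0] AE_lborel_singleton[of "2*pi"] by eventually_elim simp
    thus "AE t in lborel. contour_kernel r s t * g (contour_point r t) = ?S t"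
      by eventually_elim (use eq in blast)
  qed
  also have "\<dots> = - X + (P (w (2 * pi)) - P (w 0)) + exp (2 * of_real pi * \<i> * s) * X"
    using sum by (rule has_bochner_integral_integral_eq)
  finally show ?thesis by (simp add: X_def w_def algebra_simps)
qed

text \<open>On the line \<open>Im z = \<theta>\<close> the segment over \<open>ln r\<close> and
  \<open>ln r'\<close> corresponds to the piece of the ray between the two radii. The values 0 and
  \<open>2 * pi\<close> of \<theta> belong to the two sides of the contour.\<close>

lemma ray_difference:
  assumes r: "0 < r" "r < r'" "r' < e" and \<theta>: "exp (of_real \<theta> * \<i>) = 1"
  shows "exp (of_real \<theta> * \<i> * s) * ((\<integral>u. indicator {r<..} u *\<^sub>R ray s u \<partial>lborel) - (\<integral>u. indicator {r'<..} u *\<^sub>R ray s u \<partial>lborel))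
    = P (of_real (ln r') + of_real \<theta> * \<i>) - P (of_real (ln r) + of_real \<theta> * \<i>)"
proof -
  have "(\<integral>u. indicator {r<..} u *\<^sub>R ray s u \<partial>lborel) - (\<integral>u. indicator {r'<..} u *\<^sub>R ray s u \<partial>lborel)
     = (\<integral>u. indicator {r<..} u *\<^sub>R ray s u - indicator {r'<..} u *\<^sub>R ray s u \<partial>lborel)"
    using r integrable_ray by (intro Bochner_Integration.integral_diff[symmetric]) auto
  also have "\<dots> = (\<integral>u. indicator {r..r'} u *\<^sub>R ray s u \<partial>lborel)"
  proof (rule integral_cong_AE)
    show "AE u in lborel. indicator {r<..} u *\<^sub>R ray s u - indicator {r'<..} u *\<^sub>R ray s u = indicator {r..r'} u *\<^sub>R ray s u"
      using AE_lborel_singleton[of r] by eventually_elim (use r in \<open>auto simp: indicator_def\<close>)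
  qed measurable
  finally have "exp (of_real \<theta> * \<i> * s) * ((\<integral>u. indicator {r<..} u *\<^sub>R ray s u \<partial>lborel) - (\<integral>u. indicator {r'<..} u *\<^sub>R ray s u \<partial>lborel))
     = exp (of_real \<theta> * \<i> * s) * (\<integral>u. indicator {r..r'} u *\<^sub>R ray s u \<partial>lborel)" by simp
  also have "\<dots> = (\<integral>u. indicator {r..r'} u *\<^sub>R (exp (of_real \<theta> * \<i> * s) * ray s u) \<partial>lborel)"
    by (simp flip: Bochner_Integration.integral_mult_right_zero)
  also have "\<dots> = P (of_real (ln r') + of_real \<theta> * \<i>) - P (of_real (ln r) + of_real \<theta> * \<i>)"
  proof (rule integral_FTC_Icc[where F = "\<lambda>u. P (of_real (ln u) + of_real \<theta> * \<i>)"])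
    show "r \<le> r'" using r by simp
    define w where "w u = of_real (ln u) + of_real \<theta> * \<i>" for u
    have w': "(w has_vector_derivative of_real (1 / u)) (at u within S)" if "u > 0" for u S
      unfolding w_def[abs_def] has_vector_derivative_def using that
      by (auto intro!: derivative_eq_intros simp: scaleR_conv_of_real field_simps)
    show "((\<lambda>u. P (of_real (ln u) + of_real \<theta> * \<i>)) has_vector_derivative exp (of_real \<theta> * \<i> * s) * ray s u) (at u within {r..r'})"
      if u: "r \<le> u" "u \<le> r'" for u
    proof -
      have u0: "u > 0" "u < e" using u r by auto
      have ew: "exp (w u) = of_real u" using u0 \<theta> by (simp add: w_def exp_add exp_of_real)
      have "of_real (1 / u) * exp (s * w u) = exp (of_real \<theta> * \<i> * s) * exp ((s - 1) * of_real (ln u))"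
      proof -
        have "exp ((s - 1) * of_real (ln u)) = exp (s * of_real (ln u)) / of_real u"
          using u0 by (simp add: left_diff_distrib exp_diff exp_of_real)
        thus ?thesis by (simp add: w_def distrib_left exp_add mult_ac)
      qed
      hence "of_real (1 / u) * (exp (s * w u) * g (exp (w u))) = exp (of_real \<theta> * \<i> * s) * ray s u"
        unfolding ray_eq[OF u0(1)] ew by (simp add: mult.assoc[symmetric])
      moreover have "(P has_field_derivative exp (s * w u) * g (exp (w u))) (at (w u))"
        by (rule P) (use u0 in \<open>simp add: w_def\<close>)
      hence "((P \<circ> w) has_vector_derivative of_real (1 / u) * (exp (s * w u) * g (exp (w u)))) (at u within {r..r'})"
        by (rule field_vector_diff_chain_within[OF w'[OF u0(1)] has_field_derivative_at_within])
      ultimately show ?thesis unfolding o_def w_def[symmetric] by simp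
    qed
    have "continuous_on {r..r'} (\<lambda>u. exp (of_real \<theta> * \<i> * s) * (exp ((s - 1) * of_real (ln u)) * g (of_real u)))"
      by (intro continuous_intros continuous_on_compose2[OF holomorphic_on_imp_continuous_on[OF hol]])
         (use r in auto)
    thus "continuous_on {r..r'} (\<lambda>u. exp (of_real \<theta> * \<i> * s) * ray s u)"
      by (rule continuous_on_eq) (use r in \<open>auto simp: ray_eq\<close>)
  qed
  finally show ?thesis .
qed

text \<open>This is Cauchy's theorem for the rectangle with vertices \<open>ln r\<close>,
  \<open>ln r'\<close> and their translates by \<open>2 * pi * \<i>\<close>, read off from the
  primitive.\<close>

lemma contour_integral_value_radius:
  assumes r: "0 < r" "r < r'" "r' < e"
  shows "contour_integral_value r s = contour_integral_value r' s"
  using ray_difference[OF r, of 0] ray_difference[OF r, of "2 * pi"] r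
  by (simp add: contour_integral_value_eq algebra_simps)

text \<open>The mean value bound along the vertical segment. For \<open>Re s > 0\<close> the power
  of \<open>r\<close> makes the circle negligible as the radius tends to 0.\<close>

lemma circle_small:
  assumes r: "0 < r" "r < e"
  shows "norm (P (of_real (ln r) + of_real (2 * pi) * \<i>) - P (of_real (ln r)))
     \<le> r powr Re s * (exp (\<bar>Im s\<bar> * (2 * pi)) * M * (2 * pi))"
proof -
  let ?B = "r powr Re s * exp (\<bar>Im s\<bar> * (2 * pi)) * M"
  let ?S = "closed_segment (of_real (ln r)) (of_real (ln r) + of_real (2 * pi) * \<i>)"
  have "norm (P (of_real (ln r) + of_real (2 * pi) * \<i>) - P (of_real (ln r)))
     \<le> ?B * norm ((of_real (ln r) + of_real (2 * pi) * \<i>) - of_real (ln r))"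
  proof (rule field_differentiable_bound[of ?S])
    fix z assume "z \<in> ?S"
    then obtain u where u: "0 \<le> u" "u \<le> 1" "z = of_real (ln r) + of_real (u * (2 * pi)) * \<i>"
      by (auto simp: closed_segment_def algebra_simps scaleR_conv_of_real)
    have Rez: "Re z = ln r" and Imz: "Im z = u * (2 * pi)" using u by auto
    show "(P has_field_derivative exp (s * z) * g (exp z)) (at z within ?S)"
      by (rule has_field_derivative_at_within, rule P) (use r Rez in simp)
    have "norm (g (exp z)) \<le> M * exp (- (b * norm (exp z)))"
      by (rule bound) (use r Rez in \<open>auto simp: keyhole_def\<close>)
    also have "\<dots> \<le> M" using M_nonneg b by (intro mult_left_le) auto
    finally have g: "norm (g (exp z)) \<le> M" .
    have "- (Im s * Im z) \<le> \<bar>Im s\<bar> * (2 * pi)"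
    proof -
      have "- (Im s * Im z) \<le> \<bar>Im s\<bar> * \<bar>Im z\<bar>" by (metis abs_ge_minus_self abs_mult)
      also have "\<dots> \<le> \<bar>Im s\<bar> * (2 * pi)" using u Imz by (intro mult_left_mono) (auto simp: abs_mult)
      finally show ?thesis .
    qed
    hence "norm (exp (s * z)) \<le> r powr Re s * exp (\<bar>Im s\<bar> * (2 * pi))"
      using r by (simp add: Rez powr_def flip: exp_add)
    with g show "norm (exp (s * z) * g (exp z)) \<le> ?B"
      unfolding norm_mult by (intro mult_mono) auto
  qed auto
  thus ?thesis by (simp add: norm_mult mult_ac)
qed

end

text \<open>Since the value does not depend on the radius, the radius may tend to 0: the circle
  disappears and the truncated ray integrals converge by domination.\<close>

lemma contour_integral_value_0:
  assumes r: "0 < r" "r < e" and s: "Re s > 0"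
  shows "contour_integral_value r s = (exp (2 * of_real pi * \<i> * s) - 1) * contour_integral_value 0 s"
proof -
  obtain P where P: "\<And>z. Re z < ln e \<Longrightarrow> (P has_field_derivative exp (s * z) * g (exp z)) (at z)"
    using log_primitive[of s] by blast
  \<comment> \<open>The denominator \<open>n + 2\<close> makes every \<open>R n\<close>, including
    the first, strictly smaller than \<open>r\<close>, as the change of radius requires.\<close>
  define R where "R n = r / real (n + 2)" for n
  have R: "0 < R n" "R n < r" for n using r by (auto simp: R_def field_simps intro: add_pos_nonneg)
  have R0: "R \<longlonglongrightarrow> 0" unfolding R_def using LIMSEQ_ignore_initial_segment[OF lim_const_over_n[of r], of 2] by simp
  have ray0: "integrable lborel (ray s)"
    unfolding ray_def[abs_def] by (rule integrable_contour) (use e s in auto)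
  have 1: "(\<lambda>n. \<integral>u. indicator {R n<..} u *\<^sub>R ray s u \<partial>lborel) \<longlonglongrightarrow> (\<integral>u. ray s u \<partial>lborel)"
  proof (rule integral_dominated_convergence[where w = "\<lambda>u. norm (ray s u)"])
    show "AE u in lborel. (\<lambda>n. indicator {R n<..} u *\<^sub>R ray s u) \<longlonglongrightarrow> ray s u"
    proof (intro AE_I2)
      fix u
      show "(\<lambda>n. indicator {R n<..} u *\<^sub>R ray s u) \<longlonglongrightarrow> ray s u"
      proof (cases "u > 0")
        case True
        have "\<forall>\<^sub>F n in sequentially. R n < u" using order_tendstoD(2)[OF R0 True] .
        hence "\<forall>\<^sub>F n in sequentially. indicator {R n<..} u *\<^sub>R ray s u = ray s u"
          by eventually_elim simp
        thus ?thesis by (rule tendsto_eventually)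
      next
        case False
        thus ?thesis by (simp add: ray_def contour_kernel_def)
      qed
    qed
    show "AE u in lborel. norm (indicator {R n<..} u *\<^sub>R ray s u) \<le> norm (ray s u)" for n
      by (intro AE_I2) (auto simp: indicator_def)
  qed (use ray0 in auto)
  have 2: "(\<lambda>n. P (of_real (ln (R n)) + of_real (2 * pi) * \<i>) - P (of_real (ln (R n)))) \<longlonglongrightarrow> 0"
  proof (rule Lim_null_comparison)
    show "\<forall>\<^sub>F n in sequentially. norm (P (of_real (ln (R n)) + of_real (2 * pi) * \<i>) - P (of_real (ln (R n))))
        \<le> R n powr Re s * (exp (\<bar>Im s\<bar> * (2 * pi)) * M * (2 * pi))"
      by (intro always_eventually allI circle_small P) (use R r less_trans in blast)+
    have "(\<lambda>n. R n powr Re s * (exp (\<bar>Im s\<bar> * (2 * pi)) * M * (2 * pi))) \<longlonglongrightarrow> 0 powr Re s * (exp (\<bar>Im s\<bar> * (2 * pi)) * M * (2 * pi))"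
      by (intro tendsto_mult tendsto_const tendsto_powr2 R0) (use s R in \<open>auto intro: always_eventually less_imp_le\<close>)
    thus "(\<lambda>n. R n powr Re s * (exp (\<bar>Im s\<bar> * (2 * pi)) * M * (2 * pi))) \<longlonglongrightarrow> 0" by simp
  qed
  have "(\<lambda>n. contour_integral_value (R n) s) \<longlonglongrightarrow> (exp (2 * of_real pi * \<i> * s) - 1) * (\<integral>u. ray s u \<partial>lborel) + 0"
  proof -
    have "contour_integral_value (R n) s =
        (exp (2 * of_real pi * \<i> * s) - 1) * (\<integral>u. indicator {R n<..} u *\<^sub>R ray s u \<partial>lborel)
        + (P (of_real (ln (R n)) + of_real (2 * pi) * \<i>) - P (of_real (ln (R n))))" for n
      by (rule contour_integral_value_eq[OF P R(1) less_trans[OF R(2) r(2)]])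
    moreover have "(\<lambda>n. (exp (2 * of_real pi * \<i> * s) - 1) * (\<integral>u. indicator {R n<..} u *\<^sub>R ray s u \<partial>lborel)
        + (P (of_real (ln (R n)) + of_real (2 * pi) * \<i>) - P (of_real (ln (R n))))) \<longlonglongrightarrow>
        (exp (2 * of_real pi * \<i> * s) - 1) * (\<integral>u. ray s u \<partial>lborel) + 0"
      by (intro tendsto_add tendsto_mult tendsto_const 1 2)
    ultimately show ?thesis by simp
  qed
  moreover have "contour_integral_value (R n) s = contour_integral_value r s" for n
    by (rule contour_integral_value_radius[OF P R r(2)])
  ultimately have "contour_integral_value r s = (exp (2 * of_real pi * \<i> * s) - 1) * (\<integral>u. ray s u \<partial>lborel) + 0"
    by (simp add: LIMSEQ_const_iff)
  thus ?thesis by (simp add: contour_integral_value_def ray_def)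
qed

lemma contour_integral_value_Hankel_eq_ray:
  assumes r: "0 < r" "r < e" and s: "s \<notin> of_nat ` {1..}" "Re s > 0"
  shows "hankel_factor s * contour_integral_value r s = rGamma s * contour_integral_value 0 s"
proof -
  \<comment> \<open>Positive integers are excluded by assumption and the others by
    \<open>Re s > 0\<close>; hence \<open>exp (2 * pi * \<i> * s) - 1\<close> can be
    cancelled.\<close>
  have "s \<notin> \<int>"
  proof
    assume "s \<in> \<int>"
    then obtain m :: int where m: "s = of_int m" by (auto elim: Ints_cases)
    hence "s = of_nat (nat m)" "nat m \<in> {1..}" using s by auto
    thus False using s by blast
  qed
  from hankel_factor_eq[OF this] exp_2pi_i_neq_1[OF this] show ?thesis by (simp add: contour_integral_value_0[OF r s(2)])
qed

lemma contour_integral_value_independent: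
  assumes "0 \<le> r" "r < e" "admissible r s" "0 \<le> r'" "r' < e" "admissible r' s"
  shows "contour_factor r s * contour_integral_value r s = contour_factor r' s * contour_integral_value r' s"
proof -
  obtain P where P: "\<And>z. Re z < ln e \<Longrightarrow> (P has_field_derivative exp (s * z) * g (exp z)) (at z)"
    using log_primitive[of s] by blast
  consider "r = r'" | "r = 0" "r' > 0" | "r > 0" "r' = 0" | "0 < r" "r < r'" | "0 < r'" "r' < r"
    using assms(1,4) by linarith
  thus ?thesis
    by cases (use assms contour_integral_value_Hankel_eq_ray[of r s] contour_integral_value_Hankel_eq_ray[of r' s]
        contour_integral_value_radius[OF P, of r r'] contour_integral_value_radius[OF P, of r' r]
      in \<open>auto simp: contour_factor_def admissible_def\<close>)
qed

end

section \<open>Integrals over products of contours\<close>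

lemma measurable_vec_lambda:
  "(\<lambda>\<omega>. \<chi> j. \<omega> j) \<in> borel_measurable (\<Pi>\<^sub>M j\<in>(UNIV::'d::finite set). (lborel::real measure))"
proof (subst borel_measurable_euclidean_space, intro ballI)
  fix i :: "real^'d" assume "i \<in> Basis"
  then obtain l where "i = axis l 1" by (auto simp: Basis_vec_def)
  thus "(\<lambda>\<omega>. (\<chi> j. \<omega> j) \<bullet> i) \<in> borel_measurable (\<Pi>\<^sub>M j\<in>UNIV. lborel)"
    by (simp add: inner_axis)
qed

text \<open>Both measures give a box the product of its side lengths, and this determines
  \<open>lborel\<close>. The product form permits Fubini in a single coordinate.\<close>

lemma lborel_vec_eq:
  "(lborel :: (real^'d) measure) = distr (\<Pi>\<^sub>M j\<in>(UNIV::'d set). lborel) borel (\<lambda>\<omega>. \<chi> j. \<omega> j)"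
proof (rule lborel_eqI)
  interpret product_sigma_finite "\<lambda>_::'d. lborel :: real measure" by standard
  fix l u :: "real^'d" assume le: "\<And>b. b \<in> Basis \<Longrightarrow> l \<bullet> b \<le> u \<bullet> b"
  have le': "l $ j \<le> u $ j" for j using le[of "axis j 1"] by (simp add: inner_axis axis_in_Basis_iff)
  have "emeasure (distr (\<Pi>\<^sub>M j\<in>(UNIV::'d set). lborel) borel (\<lambda>\<omega>. \<chi> j. \<omega> j)) (box l u)
    = emeasure (\<Pi>\<^sub>M j\<in>(UNIV::'d set). lborel) ((\<lambda>\<omega>. \<chi> j. \<omega> j) -` box l u \<inter> space (\<Pi>\<^sub>M j\<in>(UNIV::'d set). lborel))"
    by (rule emeasure_distr[OF measurable_vec_lambda]) simp
  also have "(\<lambda>\<omega>. \<chi> j. \<omega> j) -` box l u \<inter> space (\<Pi>\<^sub>M j\<in>(UNIV::'d set). lborel) = (\<Pi>\<^sub>E j\<in>UNIV. box (l $ j) (u $ j))"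
    by (auto simp: space_PiM mem_box_cart PiE_def Pi_iff)
  also have "emeasure (\<Pi>\<^sub>M j\<in>(UNIV::'d set). lborel) \<dots> = (\<Prod>j\<in>UNIV. emeasure lborel (box (l $ j) (u $ j)))"
    by (rule emeasure_PiM) auto
  also have "\<dots> = (\<Prod>j\<in>UNIV. ennreal (u $ j - l $ j))"
    using le' by (intro prod.cong) auto
  also have "\<dots> = ennreal (\<Prod>j\<in>UNIV. (u - l) $ j)"
    using le' by (subst prod_ennreal) auto
  also have "(\<Prod>j\<in>UNIV. (u - l) $ j) = (\<Prod>b\<in>Basis. (u - l) \<bullet> b)"
  proof -
    have B: "Basis = (\<lambda>j. axis j (1::real)) ` (UNIV :: 'd set)" by (auto simp: Basis_vec_def)
    show ?thesis unfolding B
      by (subst prod.reindex) (auto simp: inj_on_def axis_eq_axis inner_axis)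
  qed
  finally show "emeasure (distr (\<Pi>\<^sub>M j\<in>(UNIV::'d set). lborel) borel (\<lambda>\<omega>. \<chi> j. \<omega> j)) (box l u)
    = (\<Prod>b\<in>Basis. (u - l) \<bullet> b)" .
qed simp

lemma
  fixes f :: "real^'d \<Rightarrow> complex"
  assumes "f \<in> borel_measurable borel"
  shows integral_lborel_vec: "(\<integral>t. f t \<partial>lborel) = (\<integral>\<omega>. f (\<chi> j. \<omega> j) \<partial>(\<Pi>\<^sub>M j\<in>UNIV. lborel))"
    and integrable_lborel_vec: "integrable lborel f \<longleftrightarrow> integrable (\<Pi>\<^sub>M j\<in>UNIV. lborel) (\<lambda>\<omega>. f (\<chi> j. \<omega> j))"
  unfolding lborel_vec_eq
  using integral_distr[OF measurable_vec_lambda assms] integrable_distr_eq[OF measurable_vec_lambda assms]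
  by auto

locale polykeyhole =
  fixes e b :: real
  assumes e: "e > 0" and b: "b > 0"
begin

abbreviation domain :: "(complex^'d) set" where "domain \<equiv> {x. \<forall>j. x $ j \<in> keyhole e}"

definition dominated :: "real \<Rightarrow> (complex^'d \<Rightarrow> complex) \<Rightarrow> bool" where
  "dominated M F \<longleftrightarrow> continuous_on domain F \<and>
     (\<forall>x\<in>domain. norm (F x) \<le> M * (\<Prod>j\<in>UNIV. exp (- (b * norm (x $ j)))))"

text \<open>Parameters and radii are functions on the index type rather than vectors, so that
  \<open>fun_upd\<close> changes one coordinate and the product measure applies. Every coordinate
  has its own radius because each chooses its own representation.\<close>

definition point :: "('d \<Rightarrow> real) \<Rightarrow> ('d \<Rightarrow> real) \<Rightarrow> complex^'d" where
  "point r t = (\<chi> j. contour_point (r j) (t j))"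

definition integrand :: "(complex^'d \<Rightarrow> complex) \<Rightarrow> ('d \<Rightarrow> real) \<Rightarrow> complex^'d \<Rightarrow> ('d \<Rightarrow> real) \<Rightarrow> complex" where
  "integrand F r s t = (\<Prod>j\<in>UNIV. contour_kernel (r j) (s $ j) (t j)) * F (point r t)"

definition contour_value :: "(complex^'d \<Rightarrow> complex) \<Rightarrow> ('d \<Rightarrow> real) \<Rightarrow> complex^'d \<Rightarrow> complex" where
  "contour_value F r s = (\<Prod>j\<in>UNIV. contour_factor (r j) (s $ j)) * (\<integral>t. integrand F r s t \<partial>(\<Pi>\<^sub>M j\<in>UNIV. lborel))"

definition radii :: "('d \<Rightarrow> real) \<Rightarrow> bool" where
  "radii r \<longleftrightarrow> (\<forall>j. 0 \<le> r j \<and> r j < e)"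

lemma point_in_domain: "radii r \<Longrightarrow> point r t \<in> domain"
  using contour_point_in_keyhole by (auto simp: point_def radii_def)

lemma measurable_integrand:
  fixes F :: "complex^'d \<Rightarrow> complex"
  assumes F: "continuous_on domain F" and r: "radii r"
  shows "integrand F r s \<in> borel_measurable (\<Pi>\<^sub>M j\<in>UNIV. lborel)"
proof -
  have "continuous_on UNIV (\<lambda>t::real^'d. \<chi> j. contour_point (r j) (t $ j))"
    by (intro continuous_on_vec_lambda continuous_on_compose2[OF continuous_contour_point] continuous_intros) auto
  hence "continuous_on UNIV (\<lambda>t::real^'d. F (\<chi> j. contour_point (r j) (t $ j)))"
    by (rule continuous_on_compose2[OF F]) (use r contour_point_in_keyhole in \<open>auto simp: radii_def\<close>)
  hence "(\<lambda>t::real^'d. F (\<chi> j. contour_point (r j) (t $ j))) \<in> borel_measurable borel"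
    by (rule borel_measurable_continuous_onI)
  from measurable_compose[OF measurable_vec_lambda this]
  have [measurable]: "(\<lambda>t. F (point r t)) \<in> borel_measurable (\<Pi>\<^sub>M j\<in>UNIV. lborel)"
    by (simp add: point_def)
  have "(\<lambda>t. contour_kernel (r j) (s $ j) (t j)) \<in> borel_measurable (\<Pi>\<^sub>M j\<in>UNIV. lborel)" for j
  proof -
    have "(\<lambda>t. t j) \<in> borel_measurable (\<Pi>\<^sub>M j\<in>UNIV. (lborel::real measure))" by measurable
    from measurable_compose[OF this measurable_contour_kernel] r show ?thesis by (auto simp: radii_def)
  qed
  thus ?thesis unfolding integrand_def[abs_def] by (intro borel_measurable_times borel_measurable_prod) auto
qed

text \<open>The order of the quantifiers matters: one \<open>K\<close> serves every \<open>F\<close>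
  with the same constant \<open>M\<close> and all \<open>s\<close> in a polydisc. Varying
  \<open>F\<close> is for the limit in c, varying \<open>s\<close> for differentiation.\<close>

lemma integrand_majorant:
  fixes r :: "'d::finite \<Rightarrow> real" and s0 :: "complex^'d"
  assumes r: "radii r" and R: "R \<ge> 0" and s0: "\<And>j. r j = 0 \<Longrightarrow> Re (s0 $ j) > R" and M: "M \<ge> 0"
  obtains K where "integrable (\<Pi>\<^sub>M j\<in>UNIV. lborel) K"
    "\<And>F s t. dominated M F \<Longrightarrow> (\<And>j. norm (s $ j - s0 $ j) \<le> R) \<Longrightarrow> norm (integrand F r s t) \<le> K t"
proof -
  interpret product_sigma_finite "\<lambda>_::'d. lborel :: real measure" by standard
  have "\<exists>k. integrable lborel k \<and>
    (\<forall>s t. norm (s - s0 $ j) \<le> R \<longrightarrow> norm (contour_kernel (r j) s t) * exp (- (b * norm (contour_point (r j) t))) \<le> k t)" for j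
    using contour_kernel_majorant[of "r j" R "s0 $ j" b] r R s0[of j] b unfolding radii_def by metis
  then obtain k where k: "\<And>j. integrable lborel (k j)"
    "\<And>j s t. norm (s - s0 $ j) \<le> R \<Longrightarrow> norm (contour_kernel (r j) s t) * exp (- (b * norm (contour_point (r j) t))) \<le> k j t"
    by metis
  show ?thesis
  proof (rule that[of "\<lambda>t. M * (\<Prod>j\<in>UNIV. k j (t j))"])
    show "integrable (\<Pi>\<^sub>M j\<in>UNIV. lborel) (\<lambda>t. M * (\<Prod>j\<in>UNIV. k j (t j)))"
      by (intro integrable_mult_right product_integrable_prod k) auto
    fix F :: "complex^'d \<Rightarrow> complex" and s t assume F: "dominated M F" and s: "\<And>j. norm (s $ j - s0 $ j) \<le> R"
    have "norm (integrand F r s t) \<le> (\<Prod>j\<in>UNIV. norm (contour_kernel (r j) (s $ j) (t j))) *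
        (M * (\<Prod>j\<in>UNIV. exp (- (b * norm (point r t $ j)))))"
      unfolding integrand_def norm_mult prod_norm
      using F point_in_domain[OF r, of t] unfolding dominated_def by (intro mult_left_mono) auto
    also have "\<dots> = M * (\<Prod>j\<in>UNIV. norm (contour_kernel (r j) (s $ j) (t j)) * exp (- (b * norm (contour_point (r j) (t j)))))"
      by (simp add: prod.distrib point_def mult_ac)
    also have "\<dots> \<le> M * (\<Prod>j\<in>UNIV. k j (t j))"
      by (intro mult_left_mono prod_mono M conjI k s) auto
    finally show "norm (integrand F r s t) \<le> M * (\<Prod>j\<in>UNIV. k j (t j))" .
  qed
qed

lemma integrable_integrand:
  fixes r :: "'d::finite \<Rightarrow> real" and s :: "complex^'d"
  assumes F: "dominated M F" and M: "M \<ge> 0" and r: "radii r" and s: "\<And>j. r j = 0 \<Longrightarrow> Re (s $ j) > 0"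
  shows "integrable (\<Pi>\<^sub>M j\<in>UNIV. lborel) (integrand F r s)"
proof -
  obtain K where K: "integrable (\<Pi>\<^sub>M j\<in>UNIV. lborel) K"
    "\<And>F s' t. dominated M F \<Longrightarrow> (\<And>j. norm (s' $ j - s $ j) \<le> 0) \<Longrightarrow> norm (integrand F r s' t) \<le> K t"
    using integrand_majorant[OF r order.refl, of s M] s M by blast
  show ?thesis
    by (rule Bochner_Integration.integrable_bound[OF K(1)])
       (use measurable_integrand[OF _ r] F K(2)[of F s] in
         \<open>auto simp: dominated_def intro!: AE_I2 order_trans[OF _ abs_ge_self]\<close>)
qed

context
  fixes F :: "complex^'d \<Rightarrow> complex" and M :: real
  assumes dom: "dominated M F" and M: "M \<ge> 0"
    and hol: "\<And>x j. x \<in> domain \<Longrightarrow> (\<lambda>z. F (\<chi> l. if l = j then z else x $ l)) holomorphic_on ball 0 e"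
begin

lemma keyhole_function_slice:
  assumes x: "x \<in> domain"
  shows "keyhole_function (\<lambda>z. F (\<chi> l. if l = j then z else x $ l)) e b M"
proof
  show "continuous_on (keyhole e) (\<lambda>z. F (\<chi> l. if l = j then z else x $ l))"
  proof (rule continuous_on_compose2[of domain F])
    show "continuous_on (keyhole e) (\<lambda>z. \<chi> l. if l = j then z else x $ l)"
    proof (rule continuous_on_vec_lambda)
      show "continuous_on (keyhole e) (\<lambda>z. if l = j then z else x $ l)" for l
        by (cases "l = j") (auto intro: continuous_on_id continuous_on_const)
    qed
  qed (use dom x in \<open>auto simp: dominated_def\<close>)
  fix z assume z: "z \<in> keyhole e"
  have "norm (F (\<chi> l. if l = j then z else x $ l))
      \<le> M * (\<Prod>l\<in>UNIV. exp (- (b * norm ((\<chi> l. if l = j then z else x $ l) $ l))))"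
    by (rule bspec[OF conjunct2[OF dom[unfolded dominated_def]]]) (use x z in auto)
  also have "\<dots> = M * (exp (- (b * norm z)) * (\<Prod>l\<in>UNIV - {j}. exp (- (b * norm ((\<chi> l. if l = j then z else x $ l) $ l)))))"
    by (subst prod.remove[of _ j]) auto
  also have "\<dots> \<le> M * (exp (- (b * norm z)) * 1)"
    using M b by (intro mult_left_mono prod_le_1) auto
  finally show "norm (F (\<chi> l. if l = j then z else x $ l)) \<le> M * exp (- (b * norm z))" by simp
qed (use e b hol x in auto)

text \<open>Fubini isolates coordinate \<open>i\<close>: with the other parameters fixed, the inner
  integral is a contour integral of a slice of \<open>F\<close>, and the exchange of representations
  in one variable applies to it together with its prefactor.\<close>

lemma contour_value_update:
  assumes r: "radii r" "\<And>j. admissible (r j) (s $ j)" and r': "0 \<le> r'" "r' < e" "admissible r' (s $ i)"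
  shows "contour_value F (r(i := r')) s = contour_value F r s"
proof -
  interpret product_sigma_finite "\<lambda>_::'d. lborel :: real measure" by standard
  define q where "q = r(i := r')"
  have q: "radii q" "\<And>j. admissible (q j) (s $ j)" using r r' by (auto simp: q_def radii_def)
  have qr: "q j = r j" if "j \<noteq> i" for j using that by (simp add: q_def)
  define A where "A x = (\<Prod>l\<in>UNIV-{i}. contour_factor (r l) (s $ l)) * (\<Prod>l\<in>UNIV-{i}. contour_kernel (r l) (s $ l) (x l))" for x
  define g where "g x z = F (\<chi> l. if l = i then z else point r x $ l)" for x z
  \<comment> \<open>Stated for every \<open>p\<close> that agrees with \<open>r\<close> off
    \<open>i\<close>, so as to cover both \<open>r\<close> and \<open>q\<close>; \<open>A\<close>
    collects what these have in common.\<close>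
  have main: "contour_value F p s = (\<integral>x. A x * (contour_factor (p i) (s $ i) * 
       (\<integral>y. contour_kernel (p i) (s $ i) y * g x (contour_point (p i) y) \<partial>lborel)) \<partial>(\<Pi>\<^sub>M j\<in>UNIV-{i}. lborel))"
    if p: "radii p" "\<And>j. admissible (p j) (s $ j)" "\<And>j. j \<noteq> i \<Longrightarrow> p j = r j" for p
  proof -
    have int: "integrable (\<Pi>\<^sub>M j\<in>insert i (UNIV-{i}). lborel) (integrand F p s)"
      using integrable_integrand[OF dom M p(1), of s] p(2) by (force simp: insert_UNIV admissible_def)
    have split: "integrand F p s (x(i := y)) = (\<Prod>l\<in>UNIV-{i}. contour_kernel (r l) (s $ l) (x l)) *
        (contour_kernel (p i) (s $ i) y * g x (contour_point (p i) y))" for x y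
    proof -
      have "(\<Prod>j\<in>UNIV. contour_kernel (p j) (s $ j) ((x(i := y)) j)) = contour_kernel (p i) (s $ i) y *
          (\<Prod>j\<in>UNIV-{i}. contour_kernel (p j) (s $ j) ((x(i := y)) j))"
        by (subst prod.remove[of _ i]) auto
      also have "(\<Prod>j\<in>UNIV-{i}. contour_kernel (p j) (s $ j) ((x(i := y)) j)) = (\<Prod>l\<in>UNIV-{i}. contour_kernel (r l) (s $ l) (x l))"
        by (rule prod.cong) (use p(3) in auto)
      finally have 1: "(\<Prod>j\<in>UNIV. contour_kernel (p j) (s $ j) ((x(i := y)) j)) =
         contour_kernel (p i) (s $ i) y * (\<Prod>l\<in>UNIV-{i}. contour_kernel (r l) (s $ l) (x l))" .
      have 2: "point p (x(i := y)) = (\<chi> l. if l = i then contour_point (p i) y else point r x $ l)"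
        using p(3) by (auto simp: point_def vec_eq_iff)
      show ?thesis unfolding integrand_def 1 2 g_def by (simp add: mult_ac)
    qed
    have fac: "(\<Prod>j\<in>UNIV. contour_factor (p j) (s $ j)) = contour_factor (p i) (s $ i) * (\<Prod>l\<in>UNIV-{i}. contour_factor (r l) (s $ l))"
    proof -
      have "(\<Prod>j\<in>UNIV-{i}. contour_factor (p j) (s $ j)) = (\<Prod>l\<in>UNIV-{i}. contour_factor (r l) (s $ l))"
        by (rule prod.cong) (use p(3) in auto)
      thus ?thesis by (subst prod.remove[of _ i]) auto
    qed
    have "(\<integral>t. integrand F p s t \<partial>(\<Pi>\<^sub>M j\<in>UNIV. lborel)) = (\<integral>t. integrand F p s t \<partial>(\<Pi>\<^sub>M j\<in>insert i (UNIV-{i}). lborel))"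
      by (simp add: insert_UNIV)
    also have "\<dots> = (\<integral>x. (\<integral>y. integrand F p s (x(i := y)) \<partial>lborel) \<partial>(\<Pi>\<^sub>M j\<in>UNIV-{i}. lborel))"
      by (rule product_integral_insert[OF _ _ int]) auto
    finally show ?thesis unfolding contour_value_def fac
      by (simp add: split A_def mult_ac flip: Bochner_Integration.integral_mult_right_zero)
  qed
  have inner: "contour_factor (q i) (s $ i) * (\<integral>y. contour_kernel (q i) (s $ i) y * g x (contour_point (q i) y) \<partial>lborel)
     = contour_factor (r i) (s $ i) * (\<integral>y. contour_kernel (r i) (s $ i) y * g x (contour_point (r i) y) \<partial>lborel)" for x
  proof -
    interpret keyhole_function "g x" e b M
      unfolding g_def[abs_def] by (rule keyhole_function_slice[OF point_in_domain[OF r(1)]])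
    show ?thesis
      using contour_integral_value_independent[of "q i" "s $ i" "r i"] q r
      unfolding contour_integral_value_def radii_def by blast
  qed
  have "contour_value F q s = contour_value F r s"
    using main[OF q qr] main[OF r refl] by (simp add: inner)
  thus ?thesis unfolding q_def .
qed

text \<open>The coordinates are switched one after another, \<open>A\<close> being the set already
  switched. Every intermediate choice is admissible because admissibility is a condition on each
  coordinate separately.\<close>

lemma contour_value_independent:
  assumes r: "radii r" "\<And>j. admissible (r j) (s $ j)" and r': "radii r'" "\<And>j. admissible (r' j) (s $ j)"
  shows "contour_value F r' s = contour_value F r s"
proof -
  have "contour_value F (\<lambda>j. if j \<in> A then r' j else r j) s = contour_value F r s" if "finite A" for A
    using that
  proof (induction A)
    case (insert i A)
    let ?r = "\<lambda>j. if j \<in> A then r' j else r j"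
    have "(\<lambda>j. if j \<in> insert i A then r' j else r j) = ?r(i := r' i)" by auto
    moreover have "contour_value F (?r(i := r' i)) s = contour_value F ?r s"
      by (rule contour_value_update) (use r r' in \<open>auto simp: radii_def\<close>)
    ultimately show ?case using insert by simp
  qed simp
  from this[of UNIV] show ?thesis by simp
qed

lemma contour_value_complex_differentiable:
  assumes r: "radii r" and s0: "\<And>j. r j = 0 \<Longrightarrow> Re (s0 $ j) > 0" "\<And>j. r j \<noteq> 0 \<Longrightarrow> Re (s0 $ j) < 1"
  shows "complex_differentiable_at (contour_value F r) s0"
proof -
  \<comment> \<open>Halving \<open>Re (s0 $ j)\<close> leaves it strictly above \<open>R\<close>, so
    that a majorant exists on the whole ball; the inserted 1 covers the case that no radius is
    0.\<close>
  define R where "R = Min (insert 1 ((\<lambda>j. Re (s0 $ j) / 2) ` {j. r j = 0}))"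
  have R: "R > 0" using s0 by (auto simp: R_def)
  have Rj: "Re (s0 $ j) > R" if "r j = 0" for j
  proof -
    have "R \<le> Re (s0 $ j) / 2" unfolding R_def by (rule Min_le) (use that in auto)
    thus ?thesis using s0(1)[OF that] by simp
  qed
  obtain K where K: "integrable (\<Pi>\<^sub>M j\<in>UNIV. lborel) K"
    "\<And>F s t. dominated M F \<Longrightarrow> (\<And>j. norm (s $ j - s0 $ j) \<le> R) \<Longrightarrow> norm (integrand F r s t) \<le> K t"
    using integrand_majorant[OF r less_imp_le[OF R], of s0 M] Rj M by blast
  have "complex_differentiable_at (\<lambda>s. \<integral>t. integrand F r s t \<partial>(\<Pi>\<^sub>M j\<in>UNIV. lborel)) s0"
  proof (rule complex_differentiable_at_integral[OF R _ _ _ K(1)])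
    fix s :: "complex^'d" assume s: "s \<in> ball s0 R"
    show "integrand F r s \<in> borel_measurable (\<Pi>\<^sub>M j\<in>UNIV. lborel)"
      using dom r by (intro measurable_integrand) (auto simp: dominated_def)
    fix t
    show "complex_differentiable_at (\<lambda>s. integrand F r s t) s"
      unfolding integrand_def
      by (intro complex_differentiable_at_mult complex_differentiable_at_prod complex_differentiable_at_const
            complex_differentiable_at_nth[where h = "\<lambda>z. contour_kernel _ z _"] contour_kernel_field_differentiable)
    show "norm (integrand F r s t) \<le> K t"
    proof (rule K(2)[OF dom])
      fix j
      have "norm ((s - s0) $ j) \<le> norm (s - s0)" by (rule Finite_Cartesian_Product.norm_nth_le)
      thus "norm (s $ j - s0 $ j) \<le> R" using s by (simp add: dist_norm norm_minus_commute)
    qed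
  qed
  moreover have "complex_differentiable_at (\<lambda>s. \<Prod>j\<in>UNIV. contour_factor (r j) (s $ j)) s0"
  proof (intro complex_differentiable_at_prod complex_differentiable_at_nth)
    fix j
    show "contour_factor (r j) field_differentiable at (s0 $ j)"
    proof (cases "r j = 0")
      case True
      have "rGamma field_differentiable at (s0 $ j)"
        unfolding field_differentiable_def using has_field_derivative_rGamma by blast
      thus ?thesis using True by (simp add: contour_factor_def[abs_def])
    next
      case False
      thus ?thesis using hankel_factor_field_differentiable[OF s0(2)[OF False]]
        by (simp add: contour_factor_def[abs_def])
    qed
  qed
  ultimately show ?thesis unfolding contour_value_def[abs_def] by (intro complex_differentiable_at_mult)
qed

text \<open>The half-planes \<open>Re s > 0\<close> and \<open>Re s < 1\<close> are open and cover
  the plane, so near any point each coordinate has a holomorphic representation. Where two choices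
  are both admissible they agree, hence the local functions define a single one.\<close>

lemma entire_continuation:
  "\<exists>Z. entire_fun Z \<and> (\<forall>r s. radii r \<longrightarrow> (\<forall>j. admissible (r j) (s $ j)) \<longrightarrow> Z s = contour_value F r s)"
proof -
  \<comment> \<open>Any threshold strictly between 0 and 1 and any radius in \<open>(0, e)\<close>
    would do; what matters is that the choice made at one point stays admissible in a
    neighbourhood.\<close>
  define q where "q s j = (if Re (s $ j) > 1/2 then 0 else e / 2)" for s :: "complex^'d" and j
  have q: "radii (q s)" for s using e by (auto simp: q_def radii_def)
  have adm: "admissible (e/2) z" if "Re z < 1" for z using that e by (auto simp: admissible_def)
  have qa: "admissible (q s j) (s $ j)" for s j
  proof (cases "Re (s $ j) > 1/2")
    case False thus ?thesis using adm[of "s $ j"] by (simp add: q_def)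
  qed (auto simp: q_def admissible_def)
  define Z where "Z s = contour_value F (q s) s" for s
  have Z: "Z s = contour_value F r s" if "radii r" "\<And>j. admissible (r j) (s $ j)" for r s
    unfolding Z_def by (rule contour_value_independent) (use that q qa in auto)
  have "complex_differentiable_at Z s0" for s0
  proof (rule complex_differentiable_at_transform)
    show "complex_differentiable_at (contour_value F (q s0)) s0"
      by (rule contour_value_complex_differentiable[OF q]) (use e in \<open>auto simp: q_def split: if_splits\<close>)
    let ?S = "\<Inter>j. {s. if Re (s0 $ j) > 1/2 then 0 < Re (s $ j) else Re (s $ j) < 1}"
    have "open {s. if Re (s0 $ j) > 1/2 then 0 < Re (s $ j) else Re (s $ j) < 1}" for j
      by (cases "Re (s0 $ j) > 1/2") (auto intro!: open_Collect_less continuous_intros)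
    thus "open ?S" by (intro open_INT) auto
    show "s0 \<in> ?S" by auto
    fix s assume s: "s \<in> ?S"
    show "contour_value F (q s0) s = Z s"
    proof (rule Z[symmetric, OF q])
      fix j show "admissible (q s0 j) (s $ j)"
      proof (cases "Re (s0 $ j) > 1/2")
        case True
        hence "0 < Re (s $ j)" using s by auto
        thus ?thesis using True by (simp add: q_def admissible_def)
      next
        case False
        hence "Re (s $ j) < 1" using s by (auto split: if_splits)
        thus ?thesis using False adm by (simp add: q_def)
      qed
    qed
  qed
  thus ?thesis using Z unfolding entire_fun_def complex_differentiable_at_def by blast
qed

end

end

section \<open>The factors of the integrand\<close>

definition bernoulli_fun :: "complex \<Rightarrow> complex" where
  "bernoulli_fun y = (if y = 0 then 1 else y / (exp y - 1))"

text \<open>Large enough for all sectors with \<open>A \<ge> 0\<close> and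
  \<open>\<eta> < 2 * pi\<close>, yet free of the nonzero zeros of \<open>exp y - 1\<close>, the
  nearest of which are \<open>2 * pi * \<i>\<close> and its conjugate.\<close>

definition bernoulli_dom :: "complex set" where
  "bernoulli_dom = {y. Re y > 0} \<union> ball 0 (2 * pi)"

text \<open>For \<open>A \<ge> 0\<close> a cone around the positive real axis, thickened near the
  origin: left of the imaginary axis only points of modulus at most \<eta> remain, while to the
  right the modulus is controlled by the real part.\<close>

definition sector :: "real \<Rightarrow> real \<Rightarrow> complex set" where
  "sector A \<eta> = {y. norm y \<le> A * Re y + \<eta>}"

lemma open_bernoulli_dom: "open bernoulli_dom"
  unfolding bernoulli_dom_def by (intro open_Un open_halfspace_Re_gt open_ball)

lemma zero_in_bernoulli_dom: "0 \<in> bernoulli_dom"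
  by (simp add: bernoulli_dom_def)

lemma exp_eq_1_bernoulli_dom:
  assumes "y \<in> bernoulli_dom" "exp y = 1"
  shows "y = 0"
proof -
  from assms(2) obtain n :: int where n: "Re y = 0" "Im y = of_int (2 * n) * pi"
    unfolding exp_eq_1 by auto
  hence "norm y < 2 * pi" using assms(1) by (auto simp: bernoulli_dom_def)
  moreover have "\<bar>real_of_int n\<bar> * (2 * pi) \<le> norm y"
    using abs_Im_le_cmod[of y] n by (simp add: abs_mult mult_ac)
  ultimately have "\<bar>real_of_int n\<bar> * (2 * pi) < 1 * (2 * pi)" by linarith
  hence "\<bar>real_of_int n\<bar> < 1" by (rule mult_right_less_imp_less) simp
  hence "n = 0" by linarith
  thus ?thesis using n by (simp add: complex_eq_iff)
qed

lemma bernoulli_fun_holomorphic: "bernoulli_fun holomorphic_on bernoulli_dom"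
proof -
  \<comment> \<open>The quotient \<open>(exp z - 1) / z\<close>, filled in at 0, is holomorphic
    without zeros on the domain; \<open>bernoulli_fun\<close> is its reciprocal.\<close>
  let ?\<psi> = "\<lambda>z. if z = 0 then deriv exp 0 else (exp z - exp 0) / (z - 0) :: complex"
  have d: "deriv exp (0::complex) = 1" by (rule DERIV_imp_deriv) (auto intro!: derivative_eq_intros)
  have "?\<psi> holomorphic_on bernoulli_dom"
    by (rule pole_lemma_open) (auto intro: holomorphic_intros open_bernoulli_dom)
  moreover have "?\<psi> z \<noteq> 0" if "z \<in> bernoulli_dom" for z
    using exp_eq_1_bernoulli_dom[OF that] d by auto
  ultimately have "(\<lambda>z. 1 / ?\<psi> z) holomorphic_on bernoulli_dom"
    by (intro holomorphic_intros) auto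
  thus ?thesis by (rule holomorphic_transform) (auto simp: bernoulli_fun_def d)
qed

lemma deriv_bernoulli_fun_holomorphic: "deriv bernoulli_fun holomorphic_on bernoulli_dom"
  by (rule holomorphic_deriv[OF bernoulli_fun_holomorphic open_bernoulli_dom])

lemma DERIV_bernoulli_fun:
  "y \<in> bernoulli_dom \<Longrightarrow> (bernoulli_fun has_field_derivative deriv bernoulli_fun y) (at y)"
  by (rule holomorphic_derivI[OF bernoulli_fun_holomorphic open_bernoulli_dom])

lemma deriv_bernoulli_fun:
  assumes "y \<in> bernoulli_dom" "y \<noteq> 0"
  shows "deriv bernoulli_fun y = 1 / (exp y - 1) - y * exp y / (exp y - 1)\<^sup>2"
proof (rule DERIV_imp_deriv)
  have nz: "exp y - 1 \<noteq> 0" using exp_eq_1_bernoulli_dom assms by auto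
  have "((\<lambda>y. y / (exp y - 1)) has_field_derivative 1 / (exp y - 1) - y * exp y / (exp y - 1)\<^sup>2) (at y)"
  proof (rule DERIV_cong)
    show "((\<lambda>y. y / (exp y - 1)) has_field_derivative (1 * (exp y - 1) - y * (exp y - 0)) / ((exp y - 1) * (exp y - 1))) (at y)"
      by (intro DERIV_divide DERIV_ident DERIV_diff DERIV_exp DERIV_const nz)
    show "(1 * (exp y - 1) - y * (exp y - 0)) / ((exp y - 1) * (exp y - 1)) = 1 / (exp y - 1) - y * exp y / (exp y - 1)\<^sup>2"
      using nz by (simp add: diff_divide_distrib[of "exp y - 1"] power2_eq_square)
  qed
  moreover have "open (bernoulli_dom - {0})" using open_bernoulli_dom by (simp add: open_delete)
  ultimately show "(bernoulli_fun has_field_derivative 1 / (exp y - 1) - y * exp y / (exp y - 1)\<^sup>2) (at y)"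
    by (rule has_field_derivative_transform_within_open) (use assms in \<open>auto simp: bernoulli_fun_def\<close>)
qed

text \<open>At 0 division by zero gives \<open>des_F\<close> the value 0, whereas the derivative is
  -1/2 there; only removing the singularity reconciles the two.\<close>

lemma remove_sings_des_F:
  assumes y: "y \<in> bernoulli_dom"
  shows "remove_sings (\<lambda>y. des_F 1 y 1) y = deriv bernoulli_fun y"
proof (rule remove_sings_eqI)
  have "continuous_on bernoulli_dom (deriv bernoulli_fun)"
    by (intro holomorphic_on_imp_continuous_on deriv_bernoulli_fun_holomorphic)
  hence "deriv bernoulli_fun \<midarrow>y\<rightarrow> deriv bernoulli_fun y"
    using y open_bernoulli_dom by (simp add: continuous_on_eq_continuous_at isContD)
  moreover have "\<forall>\<^sub>F w in at y. w \<in> bernoulli_dom" "\<forall>\<^sub>F w in at y. w \<noteq> 0"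
    by (rule eventually_at_in_open'[OF open_bernoulli_dom y], rule eventually_neq_at_within)
  hence "\<forall>\<^sub>F w in at y. deriv bernoulli_fun w = des_F 1 w 1"
    by eventually_elim (simp add: deriv_bernoulli_fun des_F_def)
  ultimately show "(\<lambda>y. des_F 1 y 1) \<midarrow>y\<rightarrow> deriv bernoulli_fun y"
    by (rule Lim_transform_eventually)
qed

definition bernoulli_quot :: "real \<Rightarrow> complex \<Rightarrow> complex" where
  "bernoulli_quot c y = (if y = 0 then (1 - of_real c) * deriv bernoulli_fun 0
     else (bernoulli_fun y - bernoulli_fun (of_real c * y)) / y)"

text \<open>The quotient is the filled-in difference quotient at 0 of
  \<open>bernoulli_fun y - bernoulli_fun (c * y)\<close>, hence holomorphic. The second part must
  exclude \<open>c = 0\<close>, where the subtracted term of \<open>des_F_approx\<close> is 0 by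
  convention instead of \<open>1 / y\<close>.\<close>

lemma isCont_bernoulli_quot:
  assumes y: "y \<in> bernoulli_dom" "of_real c * y \<in> bernoulli_dom"
  shows "isCont (bernoulli_quot c) y"
    and "c \<noteq> 0 \<Longrightarrow> remove_sings (\<lambda>y. des_F_approx c 1 y 1) y = bernoulli_quot c y"
proof -
  define V where "V = bernoulli_dom \<inter> (\<lambda>y. of_real c * y) -` bernoulli_dom"
  have "open ((\<lambda>y. complex_of_real c * y) -` bernoulli_dom)"
    by (intro open_vimage open_bernoulli_dom continuous_intros)
  hence V: "open V" "y \<in> V" "0 \<in> V"
    using y open_bernoulli_dom zero_in_bernoulli_dom by (auto simp: V_def)
  define f where "f y = bernoulli_fun y - bernoulli_fun (of_real c * y)" for y
  have f: "f holomorphic_on V"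
  proof -
    have "(bernoulli_fun \<circ> (\<lambda>y. of_real c * y)) holomorphic_on V"
      by (rule holomorphic_on_compose_gen[OF holomorphic_on_linear bernoulli_fun_holomorphic]) (auto simp: V_def)
    moreover have "bernoulli_fun holomorphic_on V"
      using bernoulli_fun_holomorphic by (rule holomorphic_on_subset) (auto simp: V_def)
    ultimately show ?thesis unfolding f_def[abs_def] o_def by (intro holomorphic_on_diff)
  qed
  have D0: "(bernoulli_fun has_field_derivative deriv bernoulli_fun 0) (at 0)"
    by (rule DERIV_bernoulli_fun[OF zero_in_bernoulli_dom])
  have "((\<lambda>y. bernoulli_fun (of_real c * y)) has_field_derivative deriv bernoulli_fun 0 * of_real c) (at 0)"
  proof -
    have "(bernoulli_fun has_field_derivative deriv bernoulli_fun 0) (at (of_real c * 0))" using D0 by simp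
    from DERIV_chain2[OF this DERIV_cmult_Id] show ?thesis .
  qed
  from DERIV_imp_deriv[OF DERIV_diff[OF D0 this]] have df: "deriv f 0 = (1 - of_real c) * deriv bernoulli_fun 0"
    unfolding f_def[abs_def] by (simp add: algebra_simps)
  have f0: "f 0 = 0" unfolding f_def by simp
  have eq: "(\<lambda>z. if z = 0 then deriv f 0 else (f z - f 0) / (z - 0)) = bernoulli_quot c"
    unfolding df f0 diff_zero unfolding f_def bernoulli_quot_def[abs_def] ..
  have "bernoulli_quot c holomorphic_on V"
    using pole_lemma_open[OF f V(1), of 0] unfolding eq .
  hence "continuous_on V (bernoulli_quot c)" by (rule holomorphic_on_imp_continuous_on)
  thus cont: "isCont (bernoulli_quot c) y"
    using V(2) by (simp add: continuous_on_eq_continuous_at[OF V(1)])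
  show "remove_sings (\<lambda>y. des_F_approx c 1 y 1) y = bernoulli_quot c y" if c: "c \<noteq> 0"
  proof (rule remove_sings_eqI)
    have "\<forall>\<^sub>F w in at y. w \<in> V" "\<forall>\<^sub>F w in at y. w \<noteq> 0"
      by (rule eventually_at_in_open'[OF V(1,2)], rule eventually_neq_at_within)
    hence "\<forall>\<^sub>F w in at y. bernoulli_quot c w = des_F_approx c 1 w 1"
    proof eventually_elim
      case (elim w)
      have "bernoulli_quot c w = w / (exp w - 1) / w - of_real c * w / (exp (of_real c * w) - 1) / w"
        using elim c by (simp only: bernoulli_quot_def bernoulli_fun_def diff_divide_distrib) simp
      also have "w / (exp w - 1) / w = 1 / (exp w - 1)" using elim by simp
      also have "of_real c * w / (exp (of_real c * w) - 1) / w = of_real c / (exp (of_real c * w) - 1)" using elim by simp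
      finally show ?case by (simp only: des_F_approx_def mult_1)
    qed
    thus "(\<lambda>y. des_F_approx c 1 y 1) \<midarrow>y\<rightarrow> bernoulli_quot c y"
      by (rule Lim_transform_eventually[OF cont[unfolded isCont_def]])
  qed
qed

section \<open>Estimates in sectors\<close>

lemma sector_Re_neg:
  assumes "y \<in> sector A \<eta>" "A \<ge> 0" "Re y \<le> 0"
  shows "norm y \<le> \<eta>"
proof -
  have "A * Re y \<le> 0" using assms by (simp add: mult_nonneg_nonpos)
  thus ?thesis using assms by (simp add: sector_def)
qed

lemma sector_Re_ge:
  assumes "y \<in> sector A \<eta>" "A \<ge> 0" "\<eta> \<ge> 0"
  shows "Re y \<ge> - \<eta>"
proof (cases "Re y \<le> 0")
  case True
  thus ?thesis using sector_Re_neg[OF assms(1,2) True] abs_Re_le_cmod[of y] by linarith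
qed (use assms in auto)

lemma sector_subset_bernoulli_dom:
  assumes "A \<ge> 0" "\<eta> < 2 * pi"
  shows "sector A \<eta> \<subseteq> bernoulli_dom"
proof
  fix y assume "y \<in> sector A \<eta>"
  thus "y \<in> bernoulli_dom" using sector_Re_neg[of y A \<eta>] assms
    by (cases "Re y > 0") (auto simp: bernoulli_dom_def)
qed

lemma compact_truncated_sector:
  assumes "A \<ge> 0"
  shows "compact (sector A \<eta> \<inter> {y. Re y \<le> 1})"
proof (rule compact_eq_bounded_closed[THEN iffD2, OF conjI])
  have "norm y \<le> A + \<eta>" if "y \<in> sector A \<eta> \<inter> {y. Re y \<le> 1}" for y
  proof -
    have "A * Re y \<le> A * 1" using that assms by (intro mult_left_mono) auto
    thus ?thesis using that by (simp add: sector_def)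
  qed
  thus "bounded (sector A \<eta> \<inter> {y. Re y \<le> 1})" by (auto simp: bounded_iff)
  show "closed (sector A \<eta> \<inter> {y. Re y \<le> 1})"
    unfolding sector_def by (intro closed_Int closed_Collect_le continuous_intros)
qed

text \<open>For large \<open>Re z\<close> the derivative is of size
  \<open>(1 + norm z) * exp (- Re z)\<close>. In the sector \<open>norm z\<close> grows at most
  linearly in \<open>Re z\<close>, and \<open>exp (- (\<kappa> * Re z))\<close> absorbs a linear
  factor. The remaining part \<open>Re z \<le> 1\<close> is compact.\<close>

lemma deriv_bernoulli_fun_bound:
  assumes A: "A \<ge> 0" and \<eta>: "0 \<le> \<eta>" "\<eta> < 2 * pi" and \<kappa>: "\<kappa> > 0"
  obtains K where "K \<ge> 0"
    "\<And>z. z \<in> sector A \<eta> \<Longrightarrow> norm (deriv bernoulli_fun z) \<le> K * exp (- ((1 - \<kappa>) * Re z))"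
proof -
  let ?S = "sector A \<eta> \<inter> {y. Re y \<le> 1}"
  have "continuous_on ?S (\<lambda>z. deriv bernoulli_fun z * exp (of_real (1 - \<kappa>) * z))"
    by (intro continuous_intros holomorphic_on_imp_continuous_on
          holomorphic_on_subset[OF deriv_bernoulli_fun_holomorphic])
       (use sector_subset_bernoulli_dom[OF A \<eta>(2)] in auto)
  hence "bounded ((\<lambda>z. deriv bernoulli_fun z * exp (of_real (1 - \<kappa>) * z)) ` ?S)"
    using compact_truncated_sector[OF A] compact_continuous_image compact_imp_bounded by blast
  then obtain B where B: "\<And>z. z \<in> ?S \<Longrightarrow> norm (deriv bernoulli_fun z * exp (of_real (1 - \<kappa>) * z)) \<le> B"
    unfolding bounded_iff by auto
  \<comment> \<open>From \<open>norm (exp z - 1) \<ge> exp (Re z) / 2\<close> comes the bound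
    \<open>exp (- Re z) * (2 + 4 * norm z)\<close>. Inserting
    \<open>norm z \<le> A * Re z + \<eta>\<close> gives \<open>4 * \<eta>\<close>, and
    \<open>x * exp (- (\<kappa> * x)) \<le> 1 / \<kappa>\<close> gives
    \<open>4 * A / \<kappa>\<close>.\<close>
  define C where "C = 2 + 4 * \<eta> + 4 * A / \<kappa>"
  have far: "norm (deriv bernoulli_fun z) * exp ((1 - \<kappa>) * Re z) \<le> C" if z: "z \<in> sector A \<eta>" "Re z > 1" for z
  proof -
    let ?x = "Re z"
    have "(2::real) \<le> exp ?x" using z exp_ge_add_one_self[of ?x] by linarith
    hence "exp ?x / 2 \<le> norm (exp z) - norm (1::complex)" by simp
    also have "\<dots> \<le> norm (exp z - 1)" by (rule norm_triangle_ineq2)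
    finally have low: "exp ?x / 2 \<le> norm (exp z - 1)" .
    hence pos: "norm (exp z - 1) > 0" using exp_gt_zero[of ?x] by linarith
    have 1: "1 / norm (exp z - 1) \<le> 2 * exp (- ?x)"
    proof -
      have "1 / norm (exp z - 1) \<le> 1 / (exp ?x / 2)" using low pos by (intro divide_left_mono mult_pos_pos) auto
      thus ?thesis by (simp add: exp_minus field_simps)
    qed
    have "norm (deriv bernoulli_fun z) \<le> norm (1 / (exp z - 1)) + norm (z * exp z / (exp z - 1)\<^sup>2)"
    proof -
      have "z \<noteq> 0" "z \<in> bernoulli_dom" using z sector_subset_bernoulli_dom[OF A \<eta>(2)] by auto
      thus ?thesis unfolding deriv_bernoulli_fun[OF \<open>z \<in> bernoulli_dom\<close> \<open>z \<noteq> 0\<close>]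
        by (intro norm_triangle_ineq4)
    qed
    also have "\<dots> = 1 / norm (exp z - 1) + norm z * exp ?x * (1 / norm (exp z - 1))\<^sup>2"
      by (simp add: norm_divide norm_mult norm_power power_divide)
    also have "\<dots> \<le> 2 * exp (- ?x) + norm z * exp ?x * (2 * exp (- ?x))\<^sup>2"
      using 1 by (intro add_mono mult_left_mono power_mono) auto
    also have "\<dots> = exp (- ?x) * (2 + 4 * norm z)"
      by (simp add: power2_eq_square exp_minus field_simps)
    also have "\<dots> \<le> exp (- ?x) * (2 + 4 * (A * ?x + \<eta>))"
      using z by (intro mult_left_mono) (auto simp: sector_def)
    finally have "norm (deriv bernoulli_fun z) * exp ((1 - \<kappa>) * ?x)
        \<le> exp (- ?x) * (2 + 4 * (A * ?x + \<eta>)) * exp ((1 - \<kappa>) * ?x)" by (rule mult_right_mono) simp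
    also have "\<dots> = (2 + 4 * \<eta>) * exp (- (\<kappa> * ?x)) + 4 * A / \<kappa> * (\<kappa> * ?x * exp (- (\<kappa> * ?x)))"
    proof -
      have "exp (- ?x) * exp ((1 - \<kappa>) * ?x) = exp (- (\<kappa> * ?x))" by (simp add: algebra_simps flip: exp_add)
      thus ?thesis using \<kappa> by (simp add: field_simps)
    qed
    also have "\<dots> \<le> (2 + 4 * \<eta>) * 1 + 4 * A / \<kappa> * 1"
    proof (intro add_mono mult_left_mono)
      show "exp (- (\<kappa> * ?x)) \<le> 1" using \<kappa> z by simp
      have "\<kappa> * ?x \<le> exp (\<kappa> * ?x)" using exp_ge_add_one_self[of "\<kappa> * ?x"] by linarith
      thus "\<kappa> * ?x * exp (- (\<kappa> * ?x)) \<le> 1" by (simp add: exp_minus field_simps)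
    qed (use A \<eta> \<kappa> in auto)
    finally show ?thesis by (simp add: C_def)
  qed
  show ?thesis
  proof (rule that[of "max 0 (max B C)"])
    fix z assume z: "z \<in> sector A \<eta>"
    have "norm (deriv bernoulli_fun z) * exp ((1 - \<kappa>) * Re z) \<le> max 0 (max B C)"
    proof (cases "Re z \<le> 1")
      case True
      thus ?thesis using B[of z] z by (simp add: norm_mult)
    next
      case False
      thus ?thesis using far[of z] z by simp
    qed
    thus "norm (deriv bernoulli_fun z) \<le> max 0 (max B C) * exp (- ((1 - \<kappa>) * Re z))"
      unfolding exp_minus divide_inverse[symmetric] by (subst pos_le_divide_eq) auto
  qed simp
qed

text \<open>The mean value inequality on the segment from \<open>c * y\<close> to \<open>y\<close>
  produces the factor \<open>\<bar>1 - c\<bar>\<close> that later cancels the denominator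
  \<open>1 - c\<close>, uniformly in \<open>c\<close>. Points of the segment are multiples
  \<open>\<mu> * y\<close> with \<mu> near 1. This rescaling costs exponent and width, so the
  derivative is estimated with \<open>\<kappa> / 2\<close> and on the sector of width
  \<open>2 * \<eta>\<close>, whence \<open>\<eta> < pi\<close>.\<close>

lemma bernoulli_quot_bound:
  assumes A: "A \<ge> 0" and \<eta>: "0 \<le> \<eta>" "\<eta> < pi" and \<kappa>: "0 < \<kappa>" "\<kappa> < 1"
  obtains K where "K \<ge> 0"
    "\<And>c y. \<bar>c - 1\<bar> < \<kappa> / 2 \<Longrightarrow> y \<in> sector A \<eta> \<Longrightarrow>
       norm (bernoulli_quot c y) \<le> \<bar>1 - c\<bar> * (K * exp (- ((1 - \<kappa>) * Re y)))"
    "\<And>y. y \<in> sector A \<eta> \<Longrightarrow> norm (deriv bernoulli_fun y) \<le> K * exp (- ((1 - \<kappa>) * Re y))"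
proof -
  obtain K where K: "K \<ge> 0"
    "\<And>z. z \<in> sector A (2 * \<eta>) \<Longrightarrow> norm (deriv bernoulli_fun z) \<le> K * exp (- ((1 - \<kappa>/2) * Re z))"
    using deriv_bernoulli_fun_bound[of A "2 * \<eta>" "\<kappa>/2"] A \<eta> \<kappa> by auto
  \<comment> \<open>For \<open>Re y \<ge> 0\<close> the exponents compare through
    \<open>(1 - \<kappa>/2)\<^sup>2 \<ge> 1 - \<kappa>\<close>; for \<open>Re y < 0\<close> through
    \<open>- Re y \<le> \<eta>\<close> and \<open>\<mu> \<le> 2\<close>, at the cost of
    \<open>exp (2 * \<eta>)\<close>.\<close>
  define L where "L = K * exp (2 * \<eta>)"
  have L0: "L \<ge> 0" using K by (simp add: L_def)
  have scale: "norm (deriv bernoulli_fun (of_real \<mu> * y)) \<le> L * exp (- ((1 - \<kappa>) * Re y)) \<and>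
      of_real \<mu> * y \<in> sector A (2 * \<eta>)"
    if \<mu>: "\<bar>\<mu> - 1\<bar> < \<kappa> / 2" and y: "y \<in> sector A \<eta>" for \<mu> y
  proof -
    have \<mu>': "1 - \<kappa>/2 \<le> \<mu>" "0 < \<mu>" "\<mu> \<le> 2" using \<mu> \<kappa> by (auto simp: abs_if split: if_splits)
    have "\<mu> * norm y \<le> \<mu> * (A * Re y + \<eta>)" using y \<mu>' by (intro mult_left_mono) (auto simp: sector_def)
    also have "\<dots> \<le> A * (\<mu> * Re y) + 2 * \<eta>" using \<mu>' \<eta> by (simp add: algebra_simps mult_left_mono)
    finally have sec: "of_real \<mu> * y \<in> sector A (2 * \<eta>)" using \<mu>' by (simp add: sector_def norm_mult)
    have "exp (- ((1 - \<kappa>/2) * (\<mu> * Re y))) \<le> exp (2 * \<eta>) * exp (- ((1 - \<kappa>) * Re y))"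
    proof (cases "Re y \<ge> 0")
      case True
      have "1 - \<kappa> \<le> (1 - \<kappa>/2) * (1 - \<kappa>/2)" by (simp add: algebra_simps)
      also have "\<dots> \<le> (1 - \<kappa>/2) * \<mu>" using \<kappa> \<mu>' by (intro mult_left_mono) auto
      finally have "(1 - \<kappa>) * Re y \<le> (1 - \<kappa>/2) * \<mu> * Re y" using True by (rule mult_right_mono)
      hence "- ((1 - \<kappa>/2) * (\<mu> * Re y)) \<le> 2 * \<eta> + - ((1 - \<kappa>) * Re y)" using \<eta> by (simp add: algebra_simps)
      thus ?thesis by (simp flip: exp_add)
    next
      case False
      have "- Re y \<le> \<eta>" using sector_Re_ge[OF y A \<eta>(1)] by simp
      have "(1 - \<kappa>/2) * (\<mu> * - Re y) \<le> 1 * (2 * \<eta>)"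
        using \<kappa> \<mu>' False \<eta> \<open>- Re y \<le> \<eta>\<close> by (intro mult_mono) (auto simp: mult_nonneg_nonpos)
      moreover have "(1 - \<kappa>) * Re y \<le> 0" using False \<kappa> by (simp add: mult_nonneg_nonpos)
      ultimately have "- ((1 - \<kappa>/2) * (\<mu> * Re y)) \<le> 2 * \<eta> + - ((1 - \<kappa>) * Re y)" by simp
      thus ?thesis by (simp flip: exp_add)
    qed
    hence "K * exp (- ((1 - \<kappa>/2) * (\<mu> * Re y))) \<le> L * exp (- ((1 - \<kappa>) * Re y))"
      using K(1) unfolding L_def mult.assoc by (intro mult_left_mono)
    with K(2)[OF sec] sec show ?thesis by simp
  qed
  have one: "norm (deriv bernoulli_fun y) \<le> L * exp (- ((1 - \<kappa>) * Re y))" if "y \<in> sector A \<eta>" for y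
    using scale[of 1 y] that \<kappa> by simp
  show ?thesis
  proof (rule that[OF L0 _ one])
    fix c y assume c: "\<bar>c - 1\<bar> < \<kappa> / 2" and y: "y \<in> sector A \<eta>"
    let ?B = "L * exp (- ((1 - \<kappa>) * Re y))"
    show "norm (bernoulli_quot c y) \<le> \<bar>1 - c\<bar> * ?B"
    proof (cases "y = 0")
      case True
      have "norm (1 - complex_of_real c) = \<bar>1 - c\<bar>" by (metis norm_of_real of_real_1 of_real_diff)
      thus ?thesis using one[OF y] True by (simp add: bernoulli_quot_def norm_mult mult_left_mono)
    next
      case False
      let ?S = "closed_segment (of_real c * y) y"
      have "norm (bernoulli_fun y - bernoulli_fun (of_real c * y)) \<le> ?B * norm (y - of_real c * y)"
      proof (rule field_differentiable_bound[of ?S])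
        fix z assume "z \<in> ?S"
        then obtain u where u: "0 \<le> u" "u \<le> 1" "z = of_real ((1 - u) * c + u) * y"
          by (auto simp: closed_segment_def algebra_simps scaleR_conv_of_real)
        have "\<bar>((1 - u) * c + u) - 1\<bar> = (1 - u) * \<bar>c - 1\<bar>"
        proof -
          have "((1 - u) * c + u) - 1 = (1 - u) * (c - 1)" by (simp add: algebra_simps)
          thus ?thesis using u by (simp add: abs_mult)
        qed
        also have "\<dots> \<le> 1 * \<bar>c - 1\<bar>" using u by (intro mult_right_mono) auto
        finally have \<mu>: "\<bar>((1 - u) * c + u) - 1\<bar> < \<kappa> / 2" using c by simp
        show "norm (deriv bernoulli_fun z) \<le> ?B" unfolding u(3) using scale[OF \<mu> y] by blast
        have "z \<in> bernoulli_dom" unfolding u(3)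
          using scale[OF \<mu> y] sector_subset_bernoulli_dom[of A "2 * \<eta>"] A \<eta> by auto
        thus "(bernoulli_fun has_field_derivative deriv bernoulli_fun z) (at z within ?S)"
          using DERIV_bernoulli_fun has_field_derivative_at_within by blast
      qed auto
      also have "norm (y - of_real c * y) = \<bar>1 - c\<bar> * norm y"
      proof -
        have "y - of_real c * y = of_real (1 - c) * y" by (simp add: algebra_simps)
        thus ?thesis by (simp only: norm_mult norm_of_real)
      qed
      finally show ?thesis using False by (simp add: bernoulli_quot_def norm_divide field_simps)
    qed
  qed
qed

lemma bernoulli_quot_tendsto:
  assumes y: "y \<in> bernoulli_dom"
  shows "((\<lambda>c. bernoulli_quot c y / (1 - of_real c)) \<longlongrightarrow> deriv bernoulli_fun y) (at 1)"
proof (cases "y = 0")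
  case True
  have "\<forall>\<^sub>F c in at (1::real). bernoulli_quot c y / (1 - of_real c) = deriv bernoulli_fun y"
    using eventually_neq_at_within[of 1] by eventually_elim (auto simp: True bernoulli_quot_def)
  thus ?thesis by (rule tendsto_eventually)
next
  case False
  have "((\<lambda>z. (bernoulli_fun z - bernoulli_fun y) / (z - y)) \<longlongrightarrow> deriv bernoulli_fun y) (at y)"
    using DERIV_bernoulli_fun[OF y] unfolding has_field_derivative_iff .
  moreover have "filterlim (\<lambda>c. of_real c * y) (at y) (at (1::real))"
  proof -
    have "((\<lambda>c. of_real c * y) \<longlongrightarrow> of_real 1 * y) (at (1::real))" by (intro tendsto_intros)
    moreover have "\<forall>\<^sub>F c in at (1::real). of_real c * y \<noteq> y"
      using eventually_neq_at_within[of 1] by eventually_elim (use False in auto)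
    ultimately show ?thesis by (simp add: filterlim_at)
  qed
  ultimately have "((\<lambda>c. (bernoulli_fun (of_real c * y) - bernoulli_fun y) / (of_real c * y - y)) \<longlongrightarrow> deriv bernoulli_fun y) (at (1::real))"
    by (rule filterlim_compose)
  moreover have "\<forall>\<^sub>F c in at (1::real). (bernoulli_fun (of_real c * y) - bernoulli_fun y) / (of_real c * y - y)
      = bernoulli_quot c y / (1 - of_real c)"
    using eventually_neq_at_within[of 1]
  proof eventually_elim
    case (elim c)
    have "of_real c * y - y = - (y * (1 - of_real c))" by (simp add: algebra_simps)
    moreover have "bernoulli_fun (of_real c * y) - bernoulli_fun y = - (bernoulli_fun y - bernoulli_fun (of_real c * y))"
      by simp
    ultimately show ?case using False
      by (simp only: bernoulli_quot_def minus_divide_divide divide_divide_eq_left if_False)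
  qed
  ultimately show ?thesis by (rule Lim_transform_eventually)
qed

section \<open>Uniform control of a single factor\<close>

definition exact_factor :: "complex \<Rightarrow> complex \<Rightarrow> complex" where
  "exact_factor \<xi> = remove_sings (\<lambda>y. des_F (delta_one \<xi>) y \<xi>)"

text \<open>The prefactor of \<open>zeta_des_approx\<close> is distributed over the factors, so that
  each of them converges by itself as \<open>c\<close> tends to 1.\<close>

definition approx_factor :: "real \<Rightarrow> complex \<Rightarrow> complex \<Rightarrow> complex" where
  "approx_factor c \<xi> y = remove_sings (\<lambda>y. des_F_approx c (delta_one \<xi>) y \<xi>) y / (1 - delta_one \<xi> * of_real c)"

text \<open>Everything needed of one factor on a set of values of its linear form. The limit and the
  approximations share \<open>K\<close>, so that one majorant serves them all; analyticity is asked
  of the limit, which is what gets continued in s.\<close>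

definition tame :: "real \<Rightarrow> complex \<Rightarrow> real \<Rightarrow> complex set \<Rightarrow> bool" where
  "tame \<kappa> \<xi> K Y \<longleftrightarrow> K \<ge> 0 \<and>
     (\<forall>y\<in>Y. norm (exact_factor \<xi> y) \<le> K * exp (- ((1 - \<kappa>) * Re y)) \<and>
            exact_factor \<xi> analytic_on {y} \<and>
            ((\<lambda>c. approx_factor c \<xi> y) \<longlongrightarrow> exact_factor \<xi> y) (at 1)) \<and>
     (\<forall>c. \<bar>c - 1\<bar> < \<kappa> / 2 \<longrightarrow> c \<noteq> 1 \<longrightarrow> (\<forall>y\<in>Y.
            norm (approx_factor c \<xi> y) \<le> K * exp (- ((1 - \<kappa>) * Re y)) \<and>
            isCont (approx_factor c \<xi>) y))"

lemma tame_subset: "tame \<kappa> \<xi> K Y \<Longrightarrow> Y' \<subseteq> Y \<Longrightarrow> K \<le> K' \<Longrightarrow> tame \<kappa> \<xi> K' Y'"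
proof -
  assume t: "tame \<kappa> \<xi> K Y" and Y: "Y' \<subseteq> Y" and K: "K \<le> K'"
  have "K * exp x \<le> K' * exp x" for x :: real using K by (intro mult_right_mono) auto
  thus ?thesis using t Y K unfolding tame_def by (meson order_trans subsetD)
qed

text \<open>Writing the factor as \<open>exp (- y) / (1 - \<xi> * exp (- y))\<close> shows the full
  decay \<open>exp (- Re y)\<close>; relaxing the exponent to \<open>1 - \<kappa>\<close> costs
  \<open>exp (\<kappa> * \<eta>)\<close> where \<open>Re y\<close> is negative. There is no
  dependence on \<open>c\<close>, because \<open>delta_one\<close> vanishes.\<close>

lemma tame_regular:
  assumes "\<xi> \<noteq> 1" and m: "m > 0" and \<kappa>: "\<kappa> > 0"
    and Y: "\<And>y. y \<in> Y \<Longrightarrow> Re y \<ge> - \<eta>" "\<And>y. y \<in> Y \<Longrightarrow> norm (1 - \<xi> * exp (- y)) \<ge> m"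
  shows "\<exists>K. tame \<kappa> \<xi> K Y"
proof -
  have d: "delta_one \<xi> = 0" using assms by (simp add: delta_one_def)
  have nz: "exp y - \<xi> \<noteq> 0" if "y \<in> Y" for y
  proof
    assume "exp y - \<xi> = 0"
    hence "\<xi> = exp y" by simp
    hence "\<xi> * exp (- y) = 1" by (simp add: exp_minus)
    thus False using Y(2)[OF that] m by simp
  qed
  have an: "(\<lambda>y. 1 / (exp y - \<xi>)) analytic_on {y}" if "y \<in> Y" for y
    using nz[OF that] by (intro analytic_intros) auto
  have ex: "exact_factor \<xi> = remove_sings (\<lambda>y. 1 / (exp y - \<xi>))"
    "approx_factor c \<xi> = remove_sings (\<lambda>y. 1 / (exp y - \<xi>))" for c
    by (simp_all add: fun_eq_iff exact_factor_def approx_factor_def des_F_def des_F_approx_def d)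
  have bnd: "norm (remove_sings (\<lambda>y. 1 / (exp y - \<xi>)) y) \<le> exp (\<kappa> * \<eta>) / m * exp (- ((1 - \<kappa>) * Re y))"
    if y: "y \<in> Y" for y
  proof -
    have "norm (exp y - \<xi>) = exp (Re y) * norm (1 - \<xi> * exp (- y))"
    proof -
      have "exp y - \<xi> = exp y * (1 - \<xi> * exp (- y))" by (simp add: algebra_simps exp_minus)
      thus ?thesis by (simp add: norm_mult)
    qed
    also have "\<dots> \<ge> exp (Re y) * m" using Y(2)[OF y] by simp
    finally have "1 / norm (exp y - \<xi>) \<le> 1 / (exp (Re y) * m)"
      using m nz[OF y] by (intro divide_left_mono mult_pos_pos) auto
    also have "\<dots> = exp (- Re y) / m" by (simp add: exp_minus field_simps)
    also have "exp (- Re y) \<le> exp (\<kappa> * \<eta>) * exp (- ((1 - \<kappa>) * Re y))"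
    proof -
      have "\<kappa> * - \<eta> \<le> \<kappa> * Re y" using Y(1)[OF y] \<kappa> by (intro mult_left_mono) auto
      thus ?thesis by (simp add: algebra_simps flip: exp_add)
    qed
    hence "exp (- Re y) / m \<le> exp (\<kappa> * \<eta>) * exp (- ((1 - \<kappa>) * Re y)) / m"
      using m by (intro divide_right_mono) auto
    finally show ?thesis using an[OF y] by (simp add: norm_divide)
  qed
  have ana: "remove_sings (\<lambda>y. 1 / (exp y - \<xi>)) analytic_on {y}" if "y \<in> Y" for y
    using an[OF that] by (rule remove_sings_analytic_on)
  show ?thesis unfolding tame_def ex
    by (intro exI[of _ "exp (\<kappa> * \<eta>) / m"] conjI ballI allI impI bnd ana analytic_at_imp_isCont)
       (use m in auto)
qed

text \<open>A half-plane suffices: there \<open>norm (\<xi> * exp (- y))\<close> is at most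
  \<open>norm \<xi> * exp \<eta>\<close>, which is below 1 for small \<eta>.\<close>

lemma tame_inside:
  assumes \<xi>: "norm \<xi> < 1" and \<kappa>: "\<kappa> > 0"
  shows "\<exists>\<eta>>0. \<exists>K. tame \<kappa> \<xi> K {y. Re y \<ge> - \<eta>}"
proof -
  have "((\<lambda>\<eta>. norm \<xi> * exp \<eta>) \<longlongrightarrow> norm \<xi> * exp 0) (at_right (0::real))" by (intro tendsto_intros)
  hence "\<forall>\<^sub>F \<eta> in at_right (0::real). norm \<xi> * exp \<eta> < 1" using \<xi> by (intro order_tendstoD(2)) auto
  hence "\<forall>\<^sub>F \<eta> in at_right (0::real). norm \<xi> * exp \<eta> < 1 \<and> \<eta> > 0"
    using eventually_at_right_less by (rule eventually_conj)
  then obtain \<eta> :: real where \<eta>: "norm \<xi> * exp \<eta> < 1" "\<eta> > 0"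
    using eventually_happens trivial_limit_at_right_real by blast
  have "norm (1 - \<xi> * exp (- y)) \<ge> 1 - norm \<xi> * exp \<eta>" if "Re y \<ge> - \<eta>" for y
  proof -
    have "norm (\<xi> * exp (- y)) \<le> norm \<xi> * exp \<eta>"
      using that by (simp add: norm_mult mult_left_mono)
    thus ?thesis using norm_triangle_ineq2[of 1 "\<xi> * exp (- y)"] by simp
  qed
  moreover have "\<xi> \<noteq> 1" using \<xi> by auto
  ultimately show ?thesis using tame_regular[of \<xi> "1 - norm \<xi> * exp \<eta>" \<kappa> "{y. Re y \<ge> - \<eta>}" \<eta>] \<eta> \<kappa> \<xi> by auto
qed

text \<open>Solutions of \<open>exp y = \<xi>\<close> lie on the imaginary axis, where the sector
  has only points of modulus at most \<eta>; there \<open>exp y\<close> is too close to 1 to reach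
  \<xi>. Compactness turns this into a positive lower bound for \<open>Re y \<le> 1\<close>, and
  beyond that \<open>exp (- y)\<close> is small.\<close>

lemma tame_unit:
  assumes \<xi>: "norm \<xi> = 1" "\<xi> \<noteq> 1" and \<kappa>: "\<kappa> > 0" and A: "A \<ge> 0"
  shows "\<exists>\<eta>>0. \<exists>K. tame \<kappa> \<xi> K (sector A \<eta>)"
proof -
  have "isCont (exp :: complex \<Rightarrow> complex) 0" by simp
  moreover have "norm (\<xi> - 1) > 0" using \<xi>(2) by simp
  ultimately obtain d where d: "d > 0" "\<And>y::complex. dist y 0 < d \<Longrightarrow> dist (exp y) (exp 0) < norm (\<xi> - 1)"
    unfolding continuous_at_eps_delta by blast
  define \<eta> where "\<eta> = d / 2"
  have \<eta>: "\<eta> > 0" "\<eta> < d" using d by (auto simp: \<eta>_def)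
  let ?S = "sector A \<eta> \<inter> {y. Re y \<le> 1}"
  have nz: "1 - \<xi> * exp (- y) \<noteq> 0" if y: "y \<in> sector A \<eta>" for y
  proof
    assume "1 - \<xi> * exp (- y) = 0"
    hence eq: "exp y = \<xi>" by (simp add: exp_minus field_simps)
    hence "Re y = 0" using \<xi>(1) norm_exp_eq_Re[of y] by simp
    hence "norm y < d" using sector_Re_neg[OF y A] \<eta> by simp
    thus False using d(2)[of y] eq by (simp add: dist_norm)
  qed
  obtain m where m: "m > 0" "\<And>y. y \<in> ?S \<Longrightarrow> norm (1 - \<xi> * exp (- y)) \<ge> m"
  proof (cases "?S = {}")
    case True
    show ?thesis by (rule that[of 1]) (use True in auto)
  next
    case False
    have "continuous_on ?S (\<lambda>y. norm (1 - \<xi> * exp (- y)))" by (intro continuous_intros)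
    from continuous_attains_inf[OF compact_truncated_sector[OF A] False this]
    obtain y0 where y0: "y0 \<in> ?S" "\<And>y. y \<in> ?S \<Longrightarrow> norm (1 - \<xi> * exp (- y0)) \<le> norm (1 - \<xi> * exp (- y))" by blast
    show ?thesis by (rule that[of "norm (1 - \<xi> * exp (- y0))"]) (use y0 nz[of y0] in auto)
  qed
  have far: "norm (1 - \<xi> * exp (- y)) \<ge> 1 - exp (-1)" if "Re y > 1" for y
  proof -
    have "norm (\<xi> * exp (- y)) \<le> exp (-1)" using that \<xi> by (simp add: norm_mult)
    thus ?thesis using norm_triangle_ineq2[of 1 "\<xi> * exp (- y)"] by simp
  qed
  have "\<exists>K. tame \<kappa> \<xi> K (sector A \<eta>)"
  proof (rule tame_regular[OF \<xi>(2) _ \<kappa>])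
    show "min m (1 - exp (-1)) > 0" using m by simp
    show "min m (1 - exp (-1)) \<le> norm (1 - \<xi> * exp (- y))" if "y \<in> sector A \<eta>" for y
      using m(2)[of y] far[of y] that by (cases "Re y > 1") auto
    show "- \<eta> \<le> Re y" if "y \<in> sector A \<eta>" for y using sector_Re_ge[OF that A] \<eta> by simp
  qed
  thus ?thesis using \<eta> by blast
qed

lemma tame_one:
  assumes \<kappa>: "0 < \<kappa>" "\<kappa> < 1" and A: "A \<ge> 0"
  shows "\<exists>\<eta>>0. \<exists>K. tame \<kappa> 1 K (sector A \<eta>)"
proof -
  \<comment> \<open>Any width in \<open>(0, pi)\<close> would do: multiples \<open>c * y\<close>
    with \<open>c \<le> 2\<close> must stay in a sector of width below
    \<open>2 * pi\<close>.\<close>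
  let ?Y = "sector A 1"
  have \<eta>: "(0::real) \<le> 1" "1 < pi" using pi_gt3 by auto
  obtain K where K: "K \<ge> 0"
    "\<And>c y. \<bar>c - 1\<bar> < \<kappa> / 2 \<Longrightarrow> y \<in> ?Y \<Longrightarrow>
       norm (bernoulli_quot c y) \<le> \<bar>1 - c\<bar> * (K * exp (- ((1 - \<kappa>) * Re y)))"
    "\<And>y. y \<in> ?Y \<Longrightarrow> norm (deriv bernoulli_fun y) \<le> K * exp (- ((1 - \<kappa>) * Re y))"
    using bernoulli_quot_bound[OF A \<eta> \<kappa>] by blast
  have dom: "y \<in> bernoulli_dom" if "y \<in> ?Y" for y
    using that sector_subset_bernoulli_dom[of A 1] A \<eta> by auto
  have exact: "exact_factor 1 y = deriv bernoulli_fun y" if "y \<in> bernoulli_dom" for y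
    using remove_sings_des_F[OF that] by (simp add: exact_factor_def delta_one_def)
  have an: "exact_factor 1 analytic_on {y}" if "y \<in> bernoulli_dom" for y
  proof -
    have "exact_factor 1 holomorphic_on bernoulli_dom"
      using deriv_bernoulli_fun_holomorphic by (rule holomorphic_transform) (simp add: exact)
    thus ?thesis using analytic_on_open[OF open_bernoulli_dom] analytic_on_subset that by blast
  qed
  have cdom: "of_real c * y \<in> bernoulli_dom" if c: "\<bar>c - 1\<bar> < \<kappa> / 2" and y: "y \<in> ?Y" for c y
  proof -
    have c': "0 < c" "c \<le> 2" using c \<kappa> by (auto simp: abs_if split: if_splits)
    have "c * norm y \<le> c * (A * Re y + 1)" using y c' by (intro mult_left_mono) (auto simp: sector_def)
    also have "\<dots> \<le> A * (c * Re y) + 2" using c' by (simp add: algebra_simps)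
    finally have "of_real c * y \<in> sector A 2" using c' by (simp add: sector_def norm_mult)
    thus ?thesis using sector_subset_bernoulli_dom[of A 2] A pi_gt3 by auto
  qed
  have approx: "approx_factor c 1 y = bernoulli_quot c y / (1 - of_real c)"
    if "c \<noteq> 0" "y \<in> bernoulli_dom" "of_real c * y \<in> bernoulli_dom" for c y
    using isCont_bernoulli_quot(2)[of y c] that by (simp add: approx_factor_def delta_one_def)
  have c0: "c \<noteq> 0" if "\<bar>c - 1\<bar> < \<kappa> / 2" for c using that \<kappa> by auto
  have cont: "isCont (approx_factor c 1) y" if c: "\<bar>c - 1\<bar> < \<kappa> / 2" "c \<noteq> 1" and y: "y \<in> ?Y" for c y
  proof -
    define V where "V = bernoulli_dom \<inter> (\<lambda>y. of_real c * y) -` bernoulli_dom"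
    have "open ((\<lambda>y. complex_of_real c * y) -` bernoulli_dom)"
      by (intro open_vimage open_bernoulli_dom continuous_intros)
    hence V: "open V" "y \<in> V" using dom[OF y] cdom[OF c(1) y] open_bernoulli_dom by (auto simp: V_def)
    have "isCont (\<lambda>y. bernoulli_quot c y / (1 - of_real c)) y"
      using isCont_bernoulli_quot(1)[OF dom[OF y] cdom[OF c(1) y]] c(2) by (intro continuous_intros) auto
    moreover have "\<forall>\<^sub>F w in nhds y. bernoulli_quot c w / (1 - of_real c) = approx_factor c 1 w"
      using eventually_nhds_in_open[OF V] by eventually_elim (use approx[OF c0[OF c(1)]] in \<open>auto simp: V_def\<close>)
    ultimately show ?thesis by (simp add: isCont_cong)
  qed
  have lim: "((\<lambda>c. approx_factor c 1 y) \<longlongrightarrow> exact_factor 1 y) (at 1)" if y: "y \<in> ?Y" for y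
  proof -
    have "\<forall>\<^sub>F c in at (1::real). dist c 1 < \<kappa> / 2"
      using \<kappa> by (auto simp: eventually_at intro!: exI[of _ "\<kappa>/2"])
    hence "\<forall>\<^sub>F c in at (1::real). bernoulli_quot c y / (1 - of_real c) = approx_factor c 1 y"
      by eventually_elim (use approx[OF c0 dom[OF y] cdom[OF _ y]] in \<open>auto simp: dist_real_def\<close>)
    from Lim_transform_eventually[OF bernoulli_quot_tendsto[OF dom[OF y]] this]
    show ?thesis by (simp add: exact[OF dom[OF y]])
  qed
  have bnd: "norm (approx_factor c 1 y) \<le> K * exp (- ((1 - \<kappa>) * Re y))"
    if c: "\<bar>c - 1\<bar> < \<kappa> / 2" "c \<noteq> 1" and y: "y \<in> ?Y" for c y
  proof -
    have "norm (1 - complex_of_real c) = \<bar>1 - c\<bar>" by (metis norm_of_real of_real_1 of_real_diff)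
    hence "norm (approx_factor c 1 y) = norm (bernoulli_quot c y) / \<bar>1 - c\<bar>"
      using approx[OF c0[OF c(1)] dom[OF y] cdom[OF c(1) y]] by (simp add: norm_divide)
    thus ?thesis using K(2)[OF c(1) y] c(2) by (simp add: divide_le_eq mult.commute)
  qed
  have "tame \<kappa> 1 K ?Y"
    unfolding tame_def
  proof (intro conjI ballI allI impI K(1))
    fix y assume y: "y \<in> ?Y"
    show "norm (exact_factor 1 y) \<le> K * exp (- ((1 - \<kappa>) * Re y))" using K(3)[OF y] exact[OF dom[OF y]] by simp
    show "exact_factor 1 analytic_on {y}" by (rule an[OF dom[OF y]])
    show "((\<lambda>c. approx_factor c 1 y) \<longlongrightarrow> exact_factor 1 y) (at 1)" by (rule lim[OF y])
  qed (fact bnd, fact cont)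
  thus ?thesis using zero_less_one by blast
qed

section \<open>Domination of the integrand\<close>

lemma keyhole_mono: "e \<le> e' \<Longrightarrow> keyhole e \<subseteq> keyhole e'"
  by (auto simp: keyhole_def)

lemma keyhole_cases:
  assumes "x \<in> keyhole e"
  obtains "norm x < e" | u where "u \<ge> 0" "x = of_real u"
  using assms by (auto simp: keyhole_def)

lemma linear_form_Re_ge:
  fixes a :: "'d::finite \<Rightarrow> complex"
  assumes a: "\<And>j. Re (a j) \<ge> 0" and e: "e > 0" and x: "\<And>j. x j \<in> keyhole e"
  shows "Re (\<Sum>j\<in>UNIV. a j * x j) \<ge> - ((\<Sum>j\<in>UNIV. norm (a j)) * e)"
proof -
  have "Re (a j * x j) \<ge> - (norm (a j) * e)" for j
    using x[of j]
  proof (cases rule: keyhole_cases)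
    case 1
    have "\<bar>Re (a j * x j)\<bar> \<le> norm (a j) * norm (x j)" using abs_Re_le_cmod[of "a j * x j"] by (simp add: norm_mult)
    also have "\<dots> \<le> norm (a j) * e" using 1 by (intro mult_left_mono) auto
    finally show ?thesis by simp
  next
    case (2 u)
    have "Re (a j * x j) \<ge> 0" using a[of j] 2 by simp
    moreover have "norm (a j) * e \<ge> 0" using e by simp
    ultimately show ?thesis by linarith
  qed
  hence "(\<Sum>j\<in>UNIV. - (norm (a j) * e)) \<le> (\<Sum>j\<in>UNIV. Re (a j * x j))" by (intro sum_mono)
  thus ?thesis by (simp add: sum_negf sum_distrib_right)
qed

text \<open>The number \<open>A\<close> is at least every ratio
  \<open>norm (a j) / Re (a j)\<close>, so a term on the ray satisfies
  \<open>norm (a j * x j) \<le> A * Re (a j * x j)\<close>. A term in the disc has size at most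
  \<open>norm (a j) * e\<close>, and its error goes into the width of the sector. Vanishing
  coefficients add 0 to \<open>A\<close>.\<close>

lemma linear_form_sector:
  fixes a :: "'d::finite \<Rightarrow> complex"
  assumes a: "\<And>j. a j = 0 \<or> Re (a j) > 0" and e: "e > 0" and x: "\<And>j. x j \<in> keyhole e"
  defines "A \<equiv> \<Sum>j\<in>UNIV. norm (a j) / Re (a j)"
  shows "(\<Sum>j\<in>UNIV. a j * x j) \<in> sector A ((1 + A) * (\<Sum>j\<in>UNIV. norm (a j)) * e)"
proof -
  have term_nonneg: "norm (a j) / Re (a j) \<ge> 0" for j using a[of j] by auto
  have A0: "A \<ge> 0" unfolding A_def by (intro sum_nonneg term_nonneg)
  have Aj: "norm (a j) \<le> A * Re (a j)" for j
  proof (cases "a j = 0")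
    case False
    hence "Re (a j) > 0" using a[of j] by auto
    moreover have "norm (a j) / Re (a j) \<le> A"
      unfolding A_def by (rule member_le_sum) (auto intro: term_nonneg)
    ultimately show ?thesis by (simp add: field_simps)
  qed simp
  have "norm (a j * x j) \<le> A * Re (a j * x j) + (1 + A) * norm (a j) * e" for j
    using x[of j]
  proof (cases rule: keyhole_cases)
    case 1
    have n: "norm (a j * x j) \<le> norm (a j) * e"
      unfolding norm_mult using 1 by (intro mult_left_mono) auto
    have "- Re (a j * x j) \<le> norm (a j) * e" using abs_Re_le_cmod[of "a j * x j"] n by linarith
    hence "A * - Re (a j * x j) \<le> A * (norm (a j) * e)" using A0 by (rule mult_left_mono)
    thus ?thesis using n by (simp add: algebra_simps)
  next
    case (2 u)
    have "norm (a j) * u \<le> A * Re (a j) * u" using Aj 2 by (intro mult_right_mono) auto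
    moreover have "(1 + A) * norm (a j) * e \<ge> 0" using A0 e by simp
    ultimately show ?thesis using 2 by (simp add: norm_mult)
  qed
  hence "(\<Sum>j\<in>UNIV. norm (a j * x j)) \<le> (\<Sum>j\<in>UNIV. A * Re (a j * x j) + (1 + A) * norm (a j) * e)"
    by (intro sum_mono)
  also have "\<dots> = A * Re (\<Sum>j\<in>UNIV. a j * x j) + (1 + A) * (\<Sum>j\<in>UNIV. norm (a j)) * e"
    by (simp add: sum.distrib sum_distrib_left sum_distrib_right)
  finally show ?thesis unfolding sector_def using norm_sum[of "\<lambda>j. a j * x j" UNIV] by simp
qed

definition form_values :: "('d::finite \<Rightarrow> complex) \<Rightarrow> real \<Rightarrow> complex set" where
  "form_values a e = {\<Sum>j\<in>UNIV. a j * x j |x. \<forall>j. x j \<in> keyhole e}"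

lemma form_values_mono: "e \<le> e' \<Longrightarrow> form_values a e \<subseteq> form_values a e'"
  unfolding form_values_def using keyhole_mono[of e e'] by fastforce

text \<open>The cases |\<xi>| < 1, \<xi> = 1 and the rest of the unit circle each provide a
  half-plane or a sector of some width; shrinking \<open>e\<close> then forces the values of the
  form into it.\<close>

lemma tame_form_values:
  fixes a :: "'d::finite \<Rightarrow> complex"
  assumes \<xi>: "norm \<xi> \<le> 1" and a: "\<And>j. Re (a j) \<ge> 0"
    and reg: "norm \<xi> = 1 \<Longrightarrow> (\<forall>j. a j = 0 \<or> Re (a j) > 0)" and \<kappa>: "0 < \<kappa>" "\<kappa> < 1"
  shows "\<exists>e>0. \<exists>K. tame \<kappa> \<xi> K (form_values a e)"
proof -
  \<comment> \<open>The denominator \<open>C + 1\<close> also covers \<open>C = 0\<close>, which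
    occurs when all coefficients vanish.\<close>
  have small: "\<exists>e>0. C * e \<le> \<eta>" if "\<eta> > 0" "C \<ge> 0" for C \<eta> :: real
    by (rule exI[of _ "\<eta> / (C + 1)"]) (use that in \<open>auto simp: field_simps\<close>)
  show ?thesis
  proof (cases "norm \<xi> = 1")
    case False
    then obtain \<eta> K where \<eta>: "\<eta> > 0" "tame \<kappa> \<xi> K {y. Re y \<ge> - \<eta>}"
      using tame_inside[of \<xi> \<kappa>] \<xi> \<kappa> by auto
    obtain e where e: "e > 0" "(\<Sum>j\<in>UNIV. norm (a j)) * e \<le> \<eta>"
      using small[OF \<eta>(1), of "\<Sum>j\<in>UNIV. norm (a j)"] by (auto simp: sum_nonneg)
    have "form_values a e \<subseteq> {y. Re y \<ge> - \<eta>}"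
    proof
      fix y assume "y \<in> form_values a e"
      then obtain x where x: "y = (\<Sum>j\<in>UNIV. a j * x j)" "\<And>j. x j \<in> keyhole e"
        by (auto simp: form_values_def)
      show "y \<in> {y. Re y \<ge> - \<eta>}" unfolding x(1) using linear_form_Re_ge[of a e x] a e x(2) by simp
    qed
    from tame_subset[OF \<eta>(2) this order.refl] e show ?thesis by blast
  next
    case True
    define A where "A = (\<Sum>j\<in>UNIV. norm (a j) / Re (a j))"
    have A0: "A \<ge> 0" unfolding A_def using a by (intro sum_nonneg divide_nonneg_nonneg) auto
    obtain \<eta> K where \<eta>: "\<eta> > 0" "tame \<kappa> \<xi> K (sector A \<eta>)"
    proof (cases "\<xi> = 1")
      case True
      thus ?thesis using tame_one[OF \<kappa> A0] that by blast
    next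
      case False
      thus ?thesis using tame_unit[OF True False \<kappa>(1) A0] that by blast
    qed
    obtain e where e: "e > 0" "(1 + A) * (\<Sum>j\<in>UNIV. norm (a j)) * e \<le> \<eta>"
      using small[OF \<eta>(1), of "(1 + A) * (\<Sum>j\<in>UNIV. norm (a j))"] A0 by (auto simp: sum_nonneg)
    have "form_values a e \<subseteq> sector A \<eta>"
    proof
      fix y assume "y \<in> form_values a e"
      then obtain x where x: "y = (\<Sum>j\<in>UNIV. a j * x j)" "\<And>j. x j \<in> keyhole e"
        by (auto simp: form_values_def)
      have "y \<in> sector A ((1 + A) * (\<Sum>j\<in>UNIV. norm (a j)) * e)"
        unfolding x(1) A_def using reg[OF True] e x(2) by (intro linear_form_sector) auto
      thus "y \<in> sector A \<eta>" using e(2) by (simp add: sector_def)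
    qed
    from tame_subset[OF \<eta>(2) this order.refl] e show ?thesis by blast
  qed
qed

section \<open>The integrand on the product of keyholes\<close>

definition keyhole_integrand :: "complex^'r^'d \<Rightarrow> complex^'d \<Rightarrow> ('r \<Rightarrow> complex \<Rightarrow> complex) \<Rightarrow> complex^'d \<Rightarrow> complex" where
  "keyhole_integrand \<gamma> \<beta> g x =
     (\<Prod>j\<in>UNIV. exp (((\<Sum>k\<in>UNIV. \<gamma> $ j $ k) - \<beta> $ j) * x $ j)) * (\<Prod>k\<in>UNIV. g k (\<Sum>j\<in>UNIV. \<gamma> $ j $ k * x $ j))"

context polykeyhole
begin

lemma hankel_integrand_eq:
  fixes \<gamma> :: "complex^'r^'d"
  assumes "\<epsilon> \<noteq> 0"
  shows "hankel_integrand \<epsilon> \<gamma> \<beta> s G t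
    = integrand (keyhole_integrand \<gamma> \<beta> (\<lambda>k. remove_sings (G k))) (\<lambda>_. \<epsilon>) s (vec_nth t)"
  using assms
  by (simp add: hankel_integrand_def integrand_def keyhole_integrand_def point_def contour_point_def
      contour_kernel_def hankel_form_def prod.distrib mult_ac)

lemma
  fixes \<gamma> :: "complex^'r^'d"
  assumes F: "continuous_on domain (keyhole_integrand \<gamma> \<beta> (\<lambda>k. remove_sings (G k)))" and \<epsilon>: "0 < \<epsilon>" "\<epsilon> < e"
  shows integral_hankel_integrand: "(\<integral>t. hankel_integrand \<epsilon> \<gamma> \<beta> s G t \<partial>lborel)
      = (\<integral>t. integrand (keyhole_integrand \<gamma> \<beta> (\<lambda>k. remove_sings (G k))) (\<lambda>_. \<epsilon>) s t \<partial>(\<Pi>\<^sub>M j\<in>UNIV. lborel))"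
    and integrable_hankel_integrand: "integrable lborel (hankel_integrand \<epsilon> \<gamma> \<beta> s G) \<longleftrightarrow>
      integrable (\<Pi>\<^sub>M j\<in>UNIV. lborel) (integrand (keyhole_integrand \<gamma> \<beta> (\<lambda>k. remove_sings (G k))) (\<lambda>_. \<epsilon>) s)"
proof -
  let ?F = "keyhole_integrand \<gamma> \<beta> (\<lambda>k. remove_sings (G k))"
  have "radii (\<lambda>_::'d. \<epsilon>)" using \<epsilon> by (simp add: radii_def)
  hence m: "integrand ?F (\<lambda>_. \<epsilon>) s \<in> borel_measurable (\<Pi>\<^sub>M j\<in>UNIV. lborel)"
    by (rule measurable_integrand[OF F])
  have "(\<lambda>t::real^'d. \<lambda>j. t $ j) \<in> borel \<rightarrow>\<^sub>M (\<Pi>\<^sub>M j\<in>UNIV. lborel)"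
    by (rule measurable_abs_UNIV) (auto intro!: borel_measurable_continuous_onI continuous_intros)
  moreover have "hankel_integrand \<epsilon> \<gamma> \<beta> s G = (\<lambda>t. integrand ?F (\<lambda>_. \<epsilon>) s (vec_nth t))"
    by (rule ext, rule hankel_integrand_eq) (use \<epsilon> in simp)
  ultimately have mh: "hankel_integrand \<epsilon> \<gamma> \<beta> s G \<in> borel_measurable borel"
    using measurable_compose[OF _ m] by simp
  have eq: "hankel_integrand \<epsilon> \<gamma> \<beta> s G (\<chi> j. \<omega> j) = integrand ?F (\<lambda>_. \<epsilon>) s \<omega>" for \<omega>
    using \<epsilon> by (simp add: hankel_integrand_eq vec_lambda_inverse)
  show "(\<integral>t. hankel_integrand \<epsilon> \<gamma> \<beta> s G t \<partial>lborel) = (\<integral>t. integrand ?F (\<lambda>_. \<epsilon>) s t \<partial>(\<Pi>\<^sub>M j\<in>UNIV. lborel))"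
    unfolding integral_lborel_vec[OF mh] eq ..
  show "integrable lborel (hankel_integrand \<epsilon> \<gamma> \<beta> s G) \<longleftrightarrow> integrable (\<Pi>\<^sub>M j\<in>UNIV. lborel) (integrand ?F (\<lambda>_. \<epsilon>) s)"
    unfolding integrable_lborel_vec[OF mh] eq ..
qed

text \<open>Let \<Gamma>_j be the sum over k of \<open>\<gamma> $ j $ k\<close>. After interchanging
  the sums over j and k, the bounds of the factors multiply to the exponential of -(1 - \<kappa>)
  times the real part of the sum of \<Gamma>_j x_j. This cancels all but the share \<kappa> of
  \<Gamma>_j in the exponent \<Gamma>_j - \<beta>_j. On the ray the remainder \<kappa> \<Gamma>_j -
  \<beta>_j has real part at most -b; on the disc it is bounded, which the constant in front
  accounts for.\<close>

lemma dominated_keyhole_integrand: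
  fixes \<gamma> :: "complex^'r^'d" and \<beta> :: "complex^'d"
  assumes K: "K \<ge> 0" and \<kappa>: "\<kappa> > 0"
    and b_le: "\<And>j. b \<le> Re (\<beta> $ j) - \<kappa> * norm (\<Sum>k\<in>UNIV. \<gamma> $ j $ k)"
    and g: "\<And>k y. y \<in> form_values (\<lambda>j. \<gamma> $ j $ k) e \<Longrightarrow>
       norm (g k y) \<le> K * exp (- ((1 - \<kappa>) * Re y)) \<and> isCont (g k) y"
  shows "dominated (K ^ CARD('r) * (\<Prod>j\<in>UNIV. exp ((norm (of_real \<kappa> * (\<Sum>k\<in>UNIV. \<gamma> $ j $ k) - \<beta> $ j) + b) * e)))
           (keyhole_integrand \<gamma> \<beta> g)"
  unfolding dominated_def
proof (intro conjI ballI)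
  let ?\<Gamma> = "\<lambda>j. \<Sum>k\<in>UNIV. \<gamma> $ j $ k"
  let ?y = "\<lambda>x k. \<Sum>j\<in>UNIV. \<gamma> $ j $ k * x $ j"
  have y: "?y x k \<in> form_values (\<lambda>j. \<gamma> $ j $ k) e" if "x \<in> domain" for x :: "complex^'d" and k
    using that by (auto simp: form_values_def)
  have gc: "continuous_on (form_values (\<lambda>j. \<gamma> $ j $ k) e) (g k)" for k
    using g by (intro continuous_at_imp_continuous_on) auto
  show "continuous_on domain (keyhole_integrand \<gamma> \<beta> g)"
    unfolding keyhole_integrand_def[abs_def]
  proof (intro continuous_on_mult continuous_on_prod)
    show "continuous_on domain (\<lambda>x. g k (?y x k))" for k
      by (rule continuous_on_compose2[OF gc]) (use y in \<open>auto intro!: continuous_intros\<close>)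
  qed (auto intro!: continuous_intros)
  fix x :: "complex^'d" assume x: "x \<in> domain"
  have "norm (keyhole_integrand \<gamma> \<beta> g x)
      = (\<Prod>j\<in>UNIV. exp (Re ((?\<Gamma> j - \<beta> $ j) * x $ j))) * (\<Prod>k\<in>UNIV. norm (g k (?y x k)))"
    by (simp add: keyhole_integrand_def norm_mult prod_norm[symmetric])
  also have "\<dots> \<le> (\<Prod>j\<in>UNIV. exp (Re ((?\<Gamma> j - \<beta> $ j) * x $ j))) * (\<Prod>k\<in>UNIV. K * exp (- ((1 - \<kappa>) * Re (?y x k))))"
    using g[OF y[OF x]] by (intro mult_left_mono prod_mono prod_nonneg) auto
  also have "(\<Prod>k\<in>UNIV. K * exp (- ((1 - \<kappa>) * Re (?y x k)))) = K ^ CARD('r) * exp (- ((1 - \<kappa>) * (\<Sum>k\<in>UNIV. Re (?y x k))))"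
    by (simp add: prod.distrib exp_sum[symmetric] sum_negf sum_distrib_left)
  also have "(\<Sum>k\<in>UNIV. Re (?y x k)) = (\<Sum>j\<in>UNIV. Re (?\<Gamma> j * x $ j))"
  proof -
    have "(\<Sum>k\<in>UNIV. ?y x k) = (\<Sum>j\<in>UNIV. ?\<Gamma> j * x $ j)"
      by (subst sum.swap) (simp add: sum_distrib_right)
    thus ?thesis by (metis Re_sum)
  qed
  also have "(\<Prod>j\<in>UNIV. exp (Re ((?\<Gamma> j - \<beta> $ j) * x $ j))) * (K ^ CARD('r) * exp (- ((1 - \<kappa>) * (\<Sum>j\<in>UNIV. Re (?\<Gamma> j * x $ j)))))
      = K ^ CARD('r) * (\<Prod>j\<in>UNIV. exp (Re ((of_real \<kappa> * ?\<Gamma> j - \<beta> $ j) * x $ j)))"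
  proof -
    have "(\<Prod>j\<in>UNIV. exp (Re ((?\<Gamma> j - \<beta> $ j) * x $ j))) * exp (- ((1 - \<kappa>) * (\<Sum>j\<in>UNIV. Re (?\<Gamma> j * x $ j))))
       = exp (\<Sum>j\<in>UNIV. Re ((?\<Gamma> j - \<beta> $ j) * x $ j) - (1 - \<kappa>) * Re (?\<Gamma> j * x $ j))"
      unfolding exp_sum[OF finite_class.finite_UNIV, symmetric] exp_add[symmetric]
      by (simp only: sum.distrib sum_negf sum_distrib_left diff_conv_add_uminus)
    also have "(\<Sum>j\<in>UNIV. Re ((?\<Gamma> j - \<beta> $ j) * x $ j) - (1 - \<kappa>) * Re (?\<Gamma> j * x $ j))
       = (\<Sum>j\<in>UNIV. Re ((of_real \<kappa> * ?\<Gamma> j - \<beta> $ j) * x $ j))"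
      by (intro sum.cong refl) (simp add: algebra_simps)
    finally show ?thesis by (simp add: exp_sum)
  qed
  also have "\<dots> \<le> K ^ CARD('r) * (\<Prod>j\<in>UNIV. exp ((norm (of_real \<kappa> * ?\<Gamma> j - \<beta> $ j) + b) * e) * exp (- (b * norm (x $ j))))"
  proof (intro mult_left_mono prod_mono conjI)
    fix j
    have "Re ((of_real \<kappa> * ?\<Gamma> j - \<beta> $ j) * x $ j) \<le> (norm (of_real \<kappa> * ?\<Gamma> j - \<beta> $ j) + b) * e - b * norm (x $ j)"
    proof -
      have "x $ j \<in> keyhole e" using x by simp
      thus ?thesis
      proof (cases rule: keyhole_cases)
        case 1
        have "Re ((of_real \<kappa> * ?\<Gamma> j - \<beta> $ j) * x $ j) \<le> norm (of_real \<kappa> * ?\<Gamma> j - \<beta> $ j) * norm (x $ j)"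
          using complex_Re_le_cmod by (metis norm_mult)
        also have "\<dots> \<le> norm (of_real \<kappa> * ?\<Gamma> j - \<beta> $ j) * e" using 1 by (intro mult_left_mono) auto
        finally have "Re ((of_real \<kappa> * ?\<Gamma> j - \<beta> $ j) * x $ j) \<le> norm (of_real \<kappa> * ?\<Gamma> j - \<beta> $ j) * e" .
        moreover have "b * norm (x $ j) \<le> b * e" using 1 b by (intro mult_left_mono) auto
        ultimately show ?thesis unfolding distrib_right by linarith
      next
        case (2 u)
        have "Re (of_real \<kappa> * ?\<Gamma> j - \<beta> $ j) \<le> - b"
        proof -
          have "Re (of_real \<kappa> * ?\<Gamma> j) \<le> \<kappa> * norm (?\<Gamma> j)"
            using complex_Re_le_cmod[of "?\<Gamma> j"] \<kappa> by (simp del: Re_sum)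
          thus ?thesis using b_le[of j] by (simp del: Re_sum)
        qed
        hence "Re (of_real \<kappa> * ?\<Gamma> j - \<beta> $ j) * u \<le> - b * u" using 2 by (intro mult_right_mono) auto
        moreover have "(norm (of_real \<kappa> * ?\<Gamma> j - \<beta> $ j) + b) * e \<ge> 0" using e b by simp
        moreover have "Re ((of_real \<kappa> * ?\<Gamma> j - \<beta> $ j) * x $ j) = Re (of_real \<kappa> * ?\<Gamma> j - \<beta> $ j) * u"
          unfolding 2 by (simp del: Re_sum)
        ultimately show ?thesis using 2 by simp
      qed
    qed
    thus "exp (Re ((of_real \<kappa> * ?\<Gamma> j - \<beta> $ j) * x $ j))
       \<le> exp ((norm (of_real \<kappa> * ?\<Gamma> j - \<beta> $ j) + b) * e) * exp (- (b * norm (x $ j)))"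
      by (simp only: exp_add[symmetric] exp_le_cancel_iff)
  qed (use K in auto)
  finally show "norm (keyhole_integrand \<gamma> \<beta> g x) \<le> K ^ CARD('r) * (\<Prod>j\<in>UNIV. exp ((norm (of_real \<kappa> * ?\<Gamma> j - \<beta> $ j) + b) * e)) *
      (\<Prod>j\<in>UNIV. exp (- (b * norm (x $ j))))"
    by (simp add: prod.distrib mult.assoc)
qed

lemma holomorphic_keyhole_integrand:
  fixes \<gamma> :: "complex^'r^'d" and \<beta> :: "complex^'d"
  assumes g: "\<And>k y. y \<in> form_values (\<lambda>j. \<gamma> $ j $ k) e \<Longrightarrow> g k analytic_on {y}" and x: "x \<in> domain"
  shows "(\<lambda>z. keyhole_integrand \<gamma> \<beta> g (\<chi> l. if l = j then z else x $ l)) holomorphic_on ball 0 e"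
proof (rule analytic_imp_holomorphic)
  have comp: "(\<lambda>z. c * (\<chi> l. if l = j then z else x $ l) $ l) analytic_on ball 0 e" for c l
    by (cases "l = j") (auto intro!: analytic_intros)
  have "(\<lambda>z. g k (\<Sum>l\<in>UNIV. \<gamma> $ l $ k * (\<chi> l. if l = j then z else x $ l) $ l)) analytic_on ball 0 e" for k
  proof -
    have "(g k \<circ> (\<lambda>z. \<Sum>l\<in>UNIV. \<gamma> $ l $ k * (\<chi> l. if l = j then z else x $ l) $ l)) analytic_on ball 0 e"
    proof (rule analytic_on_compose_gen)
      show "(\<lambda>z. \<Sum>l\<in>UNIV. \<gamma> $ l $ k * (\<chi> l. if l = j then z else x $ l) $ l) analytic_on ball 0 e"
        by (intro analytic_on_sum comp)
      show "g k analytic_on form_values (\<lambda>j. \<gamma> $ j $ k) e"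
        using g analytic_on_analytic_at by blast
      fix z :: complex assume "z \<in> ball 0 e"
      hence "\<forall>l. (\<chi> l. if l = j then z else x $ l) $ l \<in> keyhole e" using x by (auto simp: keyhole_def)
      thus "(\<Sum>l\<in>UNIV. \<gamma> $ l $ k * (\<chi> l. if l = j then z else x $ l) $ l) \<in> form_values (\<lambda>j. \<gamma> $ j $ k) e"
        unfolding form_values_def by blast
    qed
    thus ?thesis by (simp add: o_def)
  qed
  thus "(\<lambda>z. keyhole_integrand \<gamma> \<beta> g (\<chi> l. if l = j then z else x $ l)) analytic_on ball 0 e"
    unfolding keyhole_integrand_def
    by (intro analytic_intros comp)
qed

end

lemma (in polykeyhole) tendsto_integral_integrand:
  fixes F :: "real \<Rightarrow> complex^'d \<Rightarrow> complex" and s :: "complex^'d"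
  assumes dom: "\<forall>\<^sub>F c in at 1. dominated M (F c)" and dom1: "dominated M F1" and M: "M \<ge> 0"
    and lim: "\<And>x. x \<in> domain \<Longrightarrow> ((\<lambda>c. F c x) \<longlongrightarrow> F1 x) (at 1)"
    and r: "radii r" "\<And>j. r j = 0 \<Longrightarrow> Re (s $ j) > 0"
  shows "((\<lambda>c. \<integral>t. integrand (F c) r s t \<partial>(\<Pi>\<^sub>M j\<in>UNIV. lborel)) \<longlongrightarrow>
           (\<integral>t. integrand F1 r s t \<partial>(\<Pi>\<^sub>M j\<in>UNIV. lborel))) (at 1)"
  unfolding tendsto_at_iff_sequentially
proof (intro allI impI)
  fix X :: "nat \<Rightarrow> real" assume X: "\<forall>i. X i \<in> UNIV - {1}" "X \<longlonglongrightarrow> 1"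
  have Xat: "filterlim X (at 1) sequentially"
    using X by (auto simp: filterlim_at)
  obtain K where K: "integrable (\<Pi>\<^sub>M j\<in>UNIV. lborel) K"
    "\<And>F s' t. dominated M F \<Longrightarrow> (\<And>j. norm (s' $ j - s $ j) \<le> 0) \<Longrightarrow> norm (integrand F r s' t) \<le> K t"
    using integrand_majorant[OF r(1) order.refl, of s M] r(2) M by blast
  \<comment> \<open>Domination holds only for parameters close to 1, so the first \<open>N\<close>
    terms of the sequence are dropped.\<close>
  have "\<forall>\<^sub>F n in sequentially. dominated M (F (X n))"
    using dom Xat by (rule eventually_compose_filterlim)
  then obtain N where N: "\<And>n. n \<ge> N \<Longrightarrow> dominated M (F (X n))"
    unfolding eventually_sequentially by blast
  have "(\<lambda>n. \<integral>t. integrand (F (X n)) r s t \<partial>(\<Pi>\<^sub>M j\<in>UNIV. lborel)) \<longlonglongrightarrow>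
           (\<integral>t. integrand F1 r s t \<partial>(\<Pi>\<^sub>M j\<in>UNIV. lborel))"
  proof (rule LIMSEQ_offset[of _ N], rule integral_dominated_convergence)
    show "integrand F1 r s \<in> borel_measurable (\<Pi>\<^sub>M j\<in>UNIV. lborel)"
      using dom1 by (intro measurable_integrand r) (auto simp: dominated_def)
    show "integrand (F (X (n + N))) r s \<in> borel_measurable (\<Pi>\<^sub>M j\<in>UNIV. lborel)" for n
      using N[of "n + N"] by (intro measurable_integrand r) (auto simp: dominated_def)
    show "AE t in (\<Pi>\<^sub>M j\<in>UNIV. lborel). norm (integrand (F (X (n + N))) r s t) \<le> K t" for n
      by (intro AE_I2 K(2) N) auto
    show "AE t in (\<Pi>\<^sub>M j\<in>UNIV. lborel). (\<lambda>n. integrand (F (X (n + N))) r s t) \<longlonglongrightarrow> integrand F1 r s t"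
    proof (intro AE_I2)
      fix t
      have "(\<lambda>n. F (X n) (point r t)) \<longlonglongrightarrow> F1 (point r t)"
        using lim[OF point_in_domain[OF r(1)]] Xat by (rule filterlim_compose)
      hence "(\<lambda>n. integrand (F (X n)) r s t) \<longlonglongrightarrow> integrand F1 r s t"
        unfolding integrand_def by (intro tendsto_intros)
      thus "(\<lambda>n. integrand (F (X (n + N))) r s t) \<longlonglongrightarrow> integrand F1 r s t"
        by (rule LIMSEQ_ignore_initial_segment)
    qed
  qed (fact K(1))
  thus "((\<lambda>c. \<integral>t. integrand (F c) r s t \<partial>(\<Pi>\<^sub>M j\<in>UNIV. lborel)) \<circ> X) \<longlonglongrightarrow>
           (\<integral>t. integrand F1 r s t \<partial>(\<Pi>\<^sub>M j\<in>UNIV. lborel))"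
    by (simp add: o_def)
qed

lemma keyhole_integrand_scale:
  fixes \<gamma> :: "complex^'r^'d"
  assumes "\<And>k y. g k y = a k * h k y"
  shows "keyhole_integrand \<gamma> \<beta> g x = (\<Prod>k\<in>UNIV. a k) * keyhole_integrand \<gamma> \<beta> h x"
  by (simp add: keyhole_integrand_def assms prod.distrib mult_ac)

text \<open>There are finitely many k, and \<open>tame\<close> survives shrinking the set and
  enlarging the constant: a minimum of radii and a maximum of constants serve all factors.\<close>

lemma ex_uniform_radius:
  fixes \<xi> :: "complex^'r" and \<gamma> :: "complex^'r^'d"
  assumes "\<And>k. norm (\<xi> $ k) \<le> 1" and "\<And>j k. Re (\<gamma> $ j $ k) \<ge> 0" and "hankel_regular \<xi> \<gamma>"
    and \<kappa>: "0 < \<kappa>" "\<kappa> < 1"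
  shows "\<exists>e>0. \<exists>K. \<forall>k. tame \<kappa> (\<xi> $ k) K (form_values (\<lambda>j. \<gamma> $ j $ k) e)"
proof -
  have reg: "\<forall>k. norm (\<xi> $ k) = 1 \<longrightarrow> (\<forall>j. \<gamma> $ j $ k = 0 \<or> Re (\<gamma> $ j $ k) > 0)"
    using hankel_regular_iff[of \<xi> \<gamma>] assms(1-3) by blast
  have "\<forall>k. \<exists>e>0. \<exists>K. tame \<kappa> (\<xi> $ k) K (form_values (\<lambda>j. \<gamma> $ j $ k) e)"
    using reg assms \<kappa> by (intro allI tame_form_values) auto
  then obtain e K where eK: "\<And>k. e k > (0::real)" "\<And>k. tame \<kappa> (\<xi> $ k) (K k) (form_values (\<lambda>j. \<gamma> $ j $ k) (e k))"
    by metis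
  have "Min (range e) > 0" using eK(1) by simp
  moreover have "tame \<kappa> (\<xi> $ k) (Max (range K)) (form_values (\<lambda>j. \<gamma> $ j $ k) (Min (range e)))" for k
    by (rule tame_subset[OF eK(2)[of k] form_values_mono]) auto
  ultimately show ?thesis by blast
qed

theorem theorem2p3:
  fixes \<xi> :: "complex^'r" and \<gamma> :: "complex^'r^'d" and \<beta> :: "complex^'d"
  assumes "\<And>k. norm (\<xi> $ k) \<le> 1"
    and "\<And>j k. Re (\<gamma> $ j $ k) \<ge> 0"
    and "\<And>j. Re (\<beta> $ j) > 0"
    and "\<And>j. \<exists>k. Re (\<gamma> $ j $ k) > 0"
    and "hankel_regular \<xi> \<gamma>"
  shows "\<exists>Z. entire_fun Z \<and>
    (\<forall>\<^sub>F \<epsilon> in at_right 0. \<forall>s.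
      (\<forall>\<^sub>F c in at 1. integrable lborel
         (hankel_integrand \<epsilon> \<gamma> \<beta> s (\<lambda>k y. des_F_approx c (delta_one (\<xi> $ k)) y (\<xi> $ k)))) \<and>
      integrable lborel
         (hankel_integrand \<epsilon> \<gamma> \<beta> s (\<lambda>k y. des_F (delta_one (\<xi> $ k)) y (\<xi> $ k))) \<and>
      ((\<forall>j. s $ j \<notin> of_nat ` {1..}) \<longrightarrow>
         (zeta_des_approx \<epsilon> \<xi> \<gamma> \<beta> s \<longlongrightarrow> zeta_des \<epsilon> \<xi> \<gamma> \<beta> s) (at 1) \<and>
         zeta_des \<epsilon> \<xi> \<gamma> \<beta> s
           = hankel_value \<epsilon> \<gamma> \<beta> s (\<lambda>k y. des_F (delta_one (\<xi> $ k)) y (\<xi> $ k)) \<and>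
         Z s = zeta_des \<epsilon> \<xi> \<gamma> \<beta> s))"
proof -
  let ?\<Gamma> = "\<lambda>j. \<Sum>k\<in>UNIV. \<gamma> $ j $ k"
  \<comment> \<open>Half of \<open>Re (\<beta> $ j)\<close> is kept as decay rate, the other half
    pays for \<kappa> times the norm of \<Gamma>_j.\<close>
  define b where "b = Min (range (\<lambda>j. Re (\<beta> $ j) / 2))"
  have b0: "b > 0" using assms(3) by (auto simp: b_def)
  have b_le: "b \<le> Re (\<beta> $ j) / 2" for j unfolding b_def by (rule Min_le) auto
  \<comment> \<open>The entry 1/2 ensures \<open>\<kappa> < 1\<close>, and the summand 1 keeps the
    denominators positive.\<close>
  define \<kappa> where "\<kappa> = Min (insert (1/2) (range (\<lambda>j. Re (\<beta> $ j) / 2 / (1 + norm (?\<Gamma> j)))))"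
  have pos: "1 + norm (?\<Gamma> j) > 0" for j by (simp add: add_pos_nonneg)
  have \<kappa>: "0 < \<kappa>" "\<kappa> < 1"
  proof -
    have "0 < Re (\<beta> $ j) / 2 / (1 + norm (?\<Gamma> j))" for j
      using assms(3) pos by (intro divide_pos_pos) auto
    thus "0 < \<kappa>" unfolding \<kappa>_def by (subst Min_gr_iff) auto
    have "\<kappa> \<le> 1/2" unfolding \<kappa>_def by (rule Min_le) auto
    thus "\<kappa> < 1" by simp
  qed
  have \<kappa>_le: "b \<le> Re (\<beta> $ j) - \<kappa> * norm (?\<Gamma> j)" for j
  proof -
    have "\<kappa> \<le> Re (\<beta> $ j) / 2 / (1 + norm (?\<Gamma> j))" unfolding \<kappa>_def by (rule Min_le) auto
    hence "\<kappa> * (1 + norm (?\<Gamma> j)) \<le> Re (\<beta> $ j) / 2" by (subst (asm) pos_le_divide_eq[OF pos])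
    hence "\<kappa> * norm (?\<Gamma> j) \<le> Re (\<beta> $ j) / 2" using \<kappa> by (simp add: distrib_left)
    thus ?thesis using b_le[of j] by simp
  qed
  obtain e K where e: "e > 0" and tame: "\<And>k. tame \<kappa> (\<xi> $ k) K (form_values (\<lambda>j. \<gamma> $ j $ k) e)"
    using ex_uniform_radius[OF assms(1,2,5) \<kappa>] by blast
  have K: "K \<ge> 0" using tame unfolding tame_def by blast
  interpret polykeyhole e b using e b0 by unfold_locales

  define F where "F = keyhole_integrand \<gamma> \<beta> (\<lambda>k. exact_factor (\<xi> $ k))"
  define Fc where "Fc c = keyhole_integrand \<gamma> \<beta> (\<lambda>k. approx_factor c (\<xi> $ k))" for c
  define p where "p c = (\<Prod>k\<in>UNIV. 1 - delta_one (\<xi> $ k) * complex_of_real c)" for c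
  define M where "M = K ^ CARD('r) * (\<Prod>j\<in>UNIV. exp ((norm (of_real \<kappa> * ?\<Gamma> j - \<beta> $ j) + b) * e))"
  have M: "M \<ge> 0" unfolding M_def using K by (simp add: prod_nonneg)

  have domF: "dominated M F"
    unfolding M_def F_def using tame K \<kappa> \<kappa>_le
    by (intro dominated_keyhole_integrand conjI analytic_at_imp_isCont) (auto simp: tame_def)
  have domFc: "dominated M (Fc c)" if "\<bar>c - 1\<bar> < \<kappa> / 2" "c \<noteq> 1" for c
    unfolding M_def Fc_def using tame K \<kappa> \<kappa>_le that
    by (intro dominated_keyhole_integrand) (auto simp: tame_def)
  have ev: "\<forall>\<^sub>F c in at (1::real). \<bar>c - 1\<bar> < \<kappa> / 2 \<and> c \<noteq> 1"
    using \<kappa> by (auto simp: eventually_at dist_real_def intro!: exI[of _ "\<kappa> / 2"])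
  have holF: "(\<lambda>z. F (\<chi> l. if l = j then z else x $ l)) holomorphic_on ball 0 e" if "x \<in> domain" for x j
    unfolding F_def by (rule holomorphic_keyhole_integrand[OF _ that]) (use tame in \<open>auto simp: tame_def\<close>)
  have limF: "((\<lambda>c. Fc c x) \<longlongrightarrow> F x) (at 1)" if "x \<in> domain" for x
  proof -
    have "(\<Sum>j\<in>UNIV. \<gamma> $ j $ k * x $ j) \<in> form_values (\<lambda>j. \<gamma> $ j $ k) e" for k
      using that by (auto simp: form_values_def)
    hence "((\<lambda>c. approx_factor c (\<xi> $ k) (\<Sum>j\<in>UNIV. \<gamma> $ j $ k * x $ j)) \<longlongrightarrow>
             exact_factor (\<xi> $ k) (\<Sum>j\<in>UNIV. \<gamma> $ j $ k * x $ j)) (at 1)" for k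
      using tame[of k] by (simp add: tame_def)
    thus ?thesis unfolding F_def Fc_def keyhole_integrand_def
      by (intro tendsto_mult tendsto_const tendsto_prod)
  qed
  \<comment> \<open>\<open>p c\<close> is the denominator in \<open>zeta_des_approx\<close>; taken
    out of the normalised factors, it cancels against the prefactor.\<close>
  have p_nz: "p c \<noteq> 0" and approx_eq: "keyhole_integrand \<gamma> \<beta>
      (\<lambda>k. remove_sings (\<lambda>y. des_F_approx c (delta_one (\<xi> $ k)) y (\<xi> $ k))) = (\<lambda>x. p c * Fc c x)"
    if c: "c \<noteq> 1" for c
  proof -
    have nz: "1 - delta_one (\<xi> $ k) * complex_of_real c \<noteq> 0" for k
      using c by (auto simp: delta_one_def)
    thus "p c \<noteq> 0" by (simp add: p_def)
    show "keyhole_integrand \<gamma> \<beta> (\<lambda>k. remove_sings (\<lambda>y. des_F_approx c (delta_one (\<xi> $ k)) y (\<xi> $ k)))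
        = (\<lambda>x. p c * Fc c x)"
      unfolding p_def Fc_def
      by (rule ext, rule keyhole_integrand_scale) (use nz in \<open>simp add: approx_factor_def\<close>)
  qed
  have exact_eq: "keyhole_integrand \<gamma> \<beta> (\<lambda>k. remove_sings (\<lambda>y. des_F (delta_one (\<xi> $ k)) y (\<xi> $ k))) = F"
    by (simp add: F_def exact_factor_def[abs_def])

  \<comment> \<open>\<open>Z\<close> is fixed before the radius, so the same entire function
    continues the Hankel representation for every \<open>\<epsilon> < e\<close>.\<close>
  obtain Z where Z: "entire_fun Z"
    "\<And>r s. radii r \<Longrightarrow> (\<forall>j. admissible (r j) (s $ j)) \<Longrightarrow> Z s = contour_value F r s"
    using entire_continuation[OF domF M holF] by blast

  have main: "(\<forall>\<^sub>F c in at 1. integrable lborel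
         (hankel_integrand \<epsilon> \<gamma> \<beta> s (\<lambda>k y. des_F_approx c (delta_one (\<xi> $ k)) y (\<xi> $ k)))) \<and>
      integrable lborel
         (hankel_integrand \<epsilon> \<gamma> \<beta> s (\<lambda>k y. des_F (delta_one (\<xi> $ k)) y (\<xi> $ k))) \<and>
      ((\<forall>j. s $ j \<notin> of_nat ` {1..}) \<longrightarrow>
         (zeta_des_approx \<epsilon> \<xi> \<gamma> \<beta> s \<longlongrightarrow> zeta_des \<epsilon> \<xi> \<gamma> \<beta> s) (at 1) \<and>
         zeta_des \<epsilon> \<xi> \<gamma> \<beta> s
           = hankel_value \<epsilon> \<gamma> \<beta> s (\<lambda>k y. des_F (delta_one (\<xi> $ k)) y (\<xi> $ k)) \<and>
         Z s = zeta_des \<epsilon> \<xi> \<gamma> \<beta> s)"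
    if \<epsilon>: "0 < \<epsilon>" "\<epsilon> < e" for \<epsilon> :: real and s :: "complex^'d"
  proof -
    let ?r = "\<lambda>_::'d. \<epsilon>"
    have r: "radii ?r" using \<epsilon> by (simp add: radii_def)
    have contF: "continuous_on domain F" using domF by (simp add: dominated_def)
    have contFc: "continuous_on domain (\<lambda>x. p c * Fc c x)" if "\<bar>c - 1\<bar> < \<kappa> / 2 \<and> c \<noteq> 1" for c
      using domFc[of c] that by (intro continuous_intros) (auto simp: dominated_def)
    have scale: "integrand (\<lambda>x. p c * Fc c x) ?r s = (\<lambda>t. p c * integrand (Fc c) ?r s t)" for c
      by (simp add: fun_eq_iff integrand_def mult_ac)
    note approx = integral_hankel_integrand[OF _ \<epsilon>, of \<gamma> \<beta> "\<lambda>k y. des_F_approx _ (delta_one (\<xi> $ k)) y (\<xi> $ k)" s]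
      integrable_hankel_integrand[OF _ \<epsilon>, of \<gamma> \<beta> "\<lambda>k y. des_F_approx _ (delta_one (\<xi> $ k)) y (\<xi> $ k)" s]
    note exact = integral_hankel_integrand[OF _ \<epsilon>, of \<gamma> \<beta> "\<lambda>k y. des_F (delta_one (\<xi> $ k)) y (\<xi> $ k)" s]
      integrable_hankel_integrand[OF _ \<epsilon>, of \<gamma> \<beta> "\<lambda>k y. des_F (delta_one (\<xi> $ k)) y (\<xi> $ k)" s]
    have int_exact: "integrable lborel (hankel_integrand \<epsilon> \<gamma> \<beta> s (\<lambda>k y. des_F (delta_one (\<xi> $ k)) y (\<xi> $ k)))"
      using exact(2) contF integrable_integrand[OF domF M r, of s] \<epsilon> unfolding exact_eq by simp
    have int_approx: "\<forall>\<^sub>F c in at 1. integrable lborel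
         (hankel_integrand \<epsilon> \<gamma> \<beta> s (\<lambda>k y. des_F_approx c (delta_one (\<xi> $ k)) y (\<xi> $ k)))"
      using ev
    proof eventually_elim
      case (elim c)
      have "integrable (\<Pi>\<^sub>M j\<in>UNIV. lborel) (integrand (Fc c) ?r s)"
        using elim \<epsilon> by (intro integrable_integrand[OF domFc M r]) auto
      thus ?case using approx(2)[of c] contFc[OF elim] elim by (simp add: approx_eq scale)
    qed
    have val_eq: "hankel_value \<epsilon> \<gamma> \<beta> s (\<lambda>k y. des_F (delta_one (\<xi> $ k)) y (\<xi> $ k)) = contour_value F ?r s"
      using exact(1) contF \<epsilon> unfolding exact_eq by (simp add: hankel_value_def contour_value_def contour_factor_def)
    have "((\<lambda>c. (\<Prod>j\<in>UNIV. hankel_factor (s $ j)) * (\<integral>t. integrand (Fc c) ?r s t \<partial>(\<Pi>\<^sub>M j\<in>UNIV. lborel))) \<longlongrightarrow>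
        (\<Prod>j\<in>UNIV. hankel_factor (s $ j)) * (\<integral>t. integrand F ?r s t \<partial>(\<Pi>\<^sub>M j\<in>UNIV. lborel))) (at 1)"
    proof (intro tendsto_mult tendsto_const tendsto_integral_integrand[OF _ domF M limF r])
      show "\<forall>\<^sub>F c in at 1. dominated M (Fc c)" using ev by eventually_elim (use domFc in blast)
    qed (use \<epsilon> in auto)
    moreover have "\<forall>\<^sub>F c in at 1. (\<Prod>j\<in>UNIV. hankel_factor (s $ j)) *
        (\<integral>t. integrand (Fc c) ?r s t \<partial>(\<Pi>\<^sub>M j\<in>UNIV. lborel)) = zeta_des_approx \<epsilon> \<xi> \<gamma> \<beta> s c"
      using ev
    proof eventually_elim
      case (elim c)
      have "(\<integral>t. hankel_integrand \<epsilon> \<gamma> \<beta> s (\<lambda>k y. des_F_approx c (delta_one (\<xi> $ k)) y (\<xi> $ k)) t \<partial>lborel)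
          = p c * (\<integral>t. integrand (Fc c) ?r s t \<partial>(\<Pi>\<^sub>M j\<in>UNIV. lborel))"
        using approx(1)[of c] contFc[OF elim] elim by (simp add: approx_eq scale)
      thus ?case using p_nz[of c] elim
        by (simp add: zeta_des_approx_def hankel_value_def p_def[symmetric])
    qed
    ultimately have lim: "(zeta_des_approx \<epsilon> \<xi> \<gamma> \<beta> s \<longlongrightarrow> contour_value F ?r s) (at 1)"
      using \<epsilon> by (simp add: contour_value_def contour_factor_def Lim_transform_eventually)
    \<comment> \<open>\<open>Lim\<close> is determined once convergence is known, because limits at
      1 are unique.\<close>
    hence zd: "zeta_des \<epsilon> \<xi> \<gamma> \<beta> s = contour_value F ?r s"
      unfolding zeta_des_def by (intro tendsto_Lim) auto
    have "Z s = contour_value F ?r s" if "\<forall>j. s $ j \<notin> of_nat ` {1..}"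
      using Z(2)[OF r, of s] that \<epsilon> by (simp add: admissible_def)
    thus ?thesis using int_exact int_approx lim zd val_eq by simp
  qed
  have "\<forall>\<^sub>F \<epsilon> in at_right 0. 0 < \<epsilon> \<and> \<epsilon> < e"
    using e by (auto simp: eventually_at_right_field)
  hence "\<forall>\<^sub>F \<epsilon> in at_right 0. \<forall>s. (\<forall>\<^sub>F c in at 1. integrable lborel
         (hankel_integrand \<epsilon> \<gamma> \<beta> s (\<lambda>k y. des_F_approx c (delta_one (\<xi> $ k)) y (\<xi> $ k)))) \<and>
      integrable lborel
         (hankel_integrand \<epsilon> \<gamma> \<beta> s (\<lambda>k y. des_F (delta_one (\<xi> $ k)) y (\<xi> $ k))) \<and>
      ((\<forall>j. s $ j \<notin> of_nat ` {1..}) \<longrightarrow>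
         (zeta_des_approx \<epsilon> \<xi> \<gamma> \<beta> s \<longlongrightarrow> zeta_des \<epsilon> \<xi> \<gamma> \<beta> s) (at 1) \<and>
         zeta_des \<epsilon> \<xi> \<gamma> \<beta> s
           = hankel_value \<epsilon> \<gamma> \<beta> s (\<lambda>k y. des_F (delta_one (\<xi> $ k)) y (\<xi> $ k)) \<and>
         Z s = zeta_des \<epsilon> \<xi> \<gamma> \<beta> s)"
    by (rule eventually_mono) (use main in blast)
  thus ?thesis using Z(1) by blast
qed

end
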